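(* Let $X$ be a smooth manifold, let $M\to X$ be the bundle of pseudo-Riemannian metrics of a fixed signature and let $p\ge1$. Any natural $p$-tensor $T\colon J^2M\to\otimes^pTX$ that is divergence-free admits a decomposition $$T=T_0+\cdots+T_m ,$$ where each addend $T_k$ is a divergence-free, second-order, natural $p$-tensor which is a homogeneous polynomial of degree $k$ in the second derivatives of the metric.
   Context: $X$ is a smooth manifold; $M\to X$ is the bundle of pseudo-Riemannian metrics of a fixed signature; $J^2M$ is the bundle of 2-jets of sections of $M$. A second-order $p$-tensor is a smooth morphism of bundles $T\colon J^2M\to\otimes^pTX$ (over the identity of $X$); for a metric $g$, $T(g)$ is the contravariant tensor field $x\mapsto T(j^2_xg)$. It is natural if $T(\tau\cdot j^2_xg)=\tau_*T(j^2_xg)$ for every diffeomorphism $\tau\colon U\to V$ between open sets of $X$ and every metric $g$ (of the fixed signature) near $x\in U$, where $\tau\cdot j^2_xg:=j^2_{\tau(x)}(\tau_*g)$. Divergence: $(\mathrm{div}\,T)(g)^{j_1\ldots j_{p-1}}=\nabla_kT(g)^{j_1\ldots j_{p-1}k}$, with $\nabla$ the Levi-Civita connection of $g$. $T$ is divergence-free if $(\mathrm{div}\,T)(g)=0$ for every metric $g$ (of the fixed signature, on any open set). Homogeneity: let $N_2\subset S^2T_x^*X\otimes S^2T_x^*X$ be the kernel of the symmetrization in the last 3 indices. A jet $j^2_xg$ defines $g^2_x\in N_2$ by $(g^2_x)_{ijkl}:=g_{ij,kl}$, the second partial derivatives at $x$ of the components of $g$ in normal coordinates for $g$ at $x$.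 It is known that, for a fixed metric $g_x$ at $x$, each natural $T$ corresponds bijectively to an $O_{g_x}$-equivariant smooth map $\mathfrak{t}\colon N_2\to\otimes^pT_xX$ with $T(j^2_x\tilde g)=\mathfrak{t}(\tilde g^2_x)$ for every $j^2_x\tilde g$ with value $g_x$ at $x$ ($O_{g_x}$ is the orthogonal group of $(T_xX,g_x)$). $T$ is a homogeneous polynomial of degree $k$ in the second derivatives of the metric if $\mathfrak{t}$ is a homogeneous polynomial map of degree $k$; this does not depend on the choice of $x$ and $g_x$. *)

theory Defs
  imports "HOL-Analysis.Analysis"
begin

section \<open>Smooth functions on Euclidean spaces\<close>

definition partial :: "'n::finite \<Rightarrow> (real^'n \<Rightarrow> real) \<Rightarrow> real^'n \<Rightarrow> real" where
  "partial k f y = frechet_derivative f (at y) (axis k 1)"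

primrec Ck_on ::
  "nat \<Rightarrow> 'v::real_normed_vector set \<Rightarrow> ('v \<Rightarrow> 'w::real_normed_vector) \<Rightarrow> bool" where
  "Ck_on 0 S f \<longleftrightarrow> continuous_on S f"
| "Ck_on (Suc k) S f \<longleftrightarrow> (\<forall>y\<in>S. f differentiable (at y)) \<and>
     (\<forall>v. Ck_on k S (\<lambda>y. frechet_derivative f (at y) v))"

text \<open>Only used for open \<open>S\<close> in finite-dimensional spaces.\<close>

definition smooth_on ::
  "'v::real_normed_vector set \<Rightarrow> ('v \<Rightarrow> 'w::real_normed_vector) \<Rightarrow> bool" where
  "smooth_on S f \<longleftrightarrow> (\<forall>k. Ck_on k S f)"

text \<open>Smoothness on an arbitrary subset, by local smooth extension. It is used for sets that are
  relatively open in a product of an open set with a linear subspace; there it is ordinary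
  smoothness.\<close>

definition smooth_on_subset ::
  "'v::real_normed_vector set \<Rightarrow> ('v \<Rightarrow> 'w::real_normed_vector) \<Rightarrow> bool" where
  "smooth_on_subset S f \<longleftrightarrow>
     (\<forall>z\<in>S. \<exists>W F. open W \<and> z \<in> W \<and> smooth_on W F \<and> (\<forall>w\<in>S \<inter> W. F w = f w))"

section \<open>Smooth manifolds\<close>

text \<open>A chart \<open>(U, \<phi>)\<close>; the values of \<open>\<phi>\<close> outside \<open>U\<close> are irrelevant.\<close>

type_synonym ('a, 'n) chart = "'a set \<times> ('a \<Rightarrow> real^'n)"

abbreviation cdom :: "('a, 'n::finite) chart \<Rightarrow> 'a set" where
  "cdom c \<equiv> fst c"

abbreviation cmap :: "('a, 'n::finite) chart \<Rightarrow> 'a \<Rightarrow> real^'n" where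
  "cmap c \<equiv> snd c"

definition cinv :: "('a, 'n::finite) chart \<Rightarrow> real^'n \<Rightarrow> 'a" where
  "cinv c = inv_into (cdom c) (cmap c)"

definition is_chart :: "'a topology \<Rightarrow> ('a, 'n::finite) chart \<Rightarrow> bool" where
  "is_chart X c \<longleftrightarrow> openin X (cdom c) \<and> open (cmap c ` cdom c) \<and>
     homeomorphic_map (subtopology X (cdom c)) (top_of_set (cmap c ` cdom c)) (cmap c)"

definition compatible :: "('a, 'n::finite) chart \<Rightarrow> ('a, 'n) chart \<Rightarrow> bool" where
  "compatible c d \<longleftrightarrow>
     smooth_on (cmap c ` (cdom c \<inter> cdom d)) (cmap d \<circ> cinv c) \<and>
     smooth_on (cmap d ` (cdom c \<inter> cdom d)) (cmap c \<circ> cinv d)"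

text \<open>The smooth structure is given by its maximal atlas \<open>\<A>\<close>.\<close>

definition smooth_manifold :: "'a topology \<Rightarrow> ('a, 'n::finite) chart set \<Rightarrow> bool" where
  "smooth_manifold X \<A> \<longleftrightarrow>
     Hausdorff_space X \<and> second_countable X \<and>
     (\<forall>c\<in>\<A>. is_chart X c) \<and> (\<Union>c\<in>\<A>. cdom c) = topspace X \<and>
     (\<forall>c\<in>\<A>. \<forall>d\<in>\<A>. compatible c d) \<and>
     (\<forall>c. is_chart X c \<and> (\<forall>d\<in>\<A>. compatible c d) \<longrightarrow> c \<in> \<A>)"

definition charts_at :: "('a, 'n::finite) chart set \<Rightarrow> 'a \<Rightarrow> ('a, 'n) chart set" where
  "charts_at \<A> x = {c \<in> \<A>. x \<in> cdom c}"

definition smooth_between ::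
  "('a, 'n::finite) chart set \<Rightarrow> 'a set \<Rightarrow> ('a \<Rightarrow> 'a) \<Rightarrow> bool" where
  "smooth_between \<A> U \<tau> \<longleftrightarrow> (\<forall>c\<in>\<A>. \<forall>d\<in>\<A>.
     smooth_on (cmap c ` (cdom c \<inter> U \<inter> \<tau> -` cdom d)) (cmap d \<circ> \<tau> \<circ> cinv c))"

definition diffeo ::
  "'a topology \<Rightarrow> ('a, 'n::finite) chart set \<Rightarrow> 'a set \<Rightarrow> 'a set \<Rightarrow> ('a \<Rightarrow> 'a) \<Rightarrow> bool" where
  "diffeo X \<A> U V \<tau> \<longleftrightarrow> openin X U \<and> openin X V \<and>
     homeomorphic_map (subtopology X U) (subtopology X V) \<tau> \<and>
     smooth_between \<A> U \<tau> \<and> smooth_between \<A> V (inv_into U \<tau>)"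

section \<open>Tensors\<close>

text \<open>A tensor at a point is the family of its components in all charts around that point, subject
  to the transformation law; components are indexed by lists of indices whose length is the order.
  Everything else is normalised to \<open>0\<close>, so that equal tensors are equal as functions.\<close>

type_synonym ('a, 'n) tensor = "('a, 'n) chart \<Rightarrow> 'n list \<Rightarrow> real"

type_synonym ('a, 'n) field = "'a \<Rightarrow> ('a, 'n) tensor"

definition multi_indices :: "nat \<Rightarrow> 'n list set" where
  "multi_indices p = {I. length I = p}"

text \<open>Row \<open>j\<close>, column \<open>i\<close>: the derivative of the \<open>j\<close>-th coordinate of \<open>d\<close> with respect to the
  \<open>i\<close>-th coordinate of \<open>c\<close>.\<close>

definition jacobian ::
  "('a, 'n::finite) chart \<Rightarrow> ('a, 'n) chart \<Rightarrow> 'a \<Rightarrow> real^'n^'n" where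
  "jacobian c d x = (\<chi> j i. partial i (\<lambda>y. cmap d (cinv c y) $ j) (cmap c x))"

definition contra_transform ::
  "('a, 'n::finite) chart \<Rightarrow> ('a, 'n) chart \<Rightarrow> 'a \<Rightarrow> ('n list \<Rightarrow> real) \<Rightarrow> 'n list \<Rightarrow> real" where
  "contra_transform c d x t J =
     (\<Sum>I\<in>multi_indices (length J). (\<Prod>a<length J. jacobian c d x $ (J ! a) $ (I ! a)) * t I)"

definition cov_transform ::
  "('a, 'n::finite) chart \<Rightarrow> ('a, 'n) chart \<Rightarrow> 'a \<Rightarrow> ('n list \<Rightarrow> real) \<Rightarrow> 'n list \<Rightarrow> real" where
  "cov_transform c d x t J =
     (\<Sum>I\<in>multi_indices (length J). (\<Prod>a<length J. jacobian d c x $ (I ! a) $ (J ! a)) * t I)"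

definition normalised :: "('a, 'n::finite) chart set \<Rightarrow> 'a \<Rightarrow> nat \<Rightarrow> ('a, 'n) tensor \<Rightarrow> bool" where
  "normalised \<A> x p t \<longleftrightarrow> (\<forall>c I. c \<notin> charts_at \<A> x \<or> I \<notin> multi_indices p \<longrightarrow> t c I = 0)"

text \<open>The spaces of contravariant and of covariant \<open>p\<close>-tensors at \<open>x\<close>.\<close>

definition contra_tensors ::
  "('a, 'n::finite) chart set \<Rightarrow> 'a \<Rightarrow> nat \<Rightarrow> ('a, 'n) tensor set" where
  "contra_tensors \<A> x p = {t. normalised \<A> x p t \<and>
     (\<forall>c\<in>charts_at \<A> x. \<forall>d\<in>charts_at \<A> x. \<forall>J\<in>multi_indices p.
        t d J = contra_transform c d x (t c) J)}"

definition cov_tensors ::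
  "('a, 'n::finite) chart set \<Rightarrow> 'a \<Rightarrow> nat \<Rightarrow> ('a, 'n) tensor set" where
  "cov_tensors \<A> x p = {t. normalised \<A> x p t \<and>
     (\<forall>c\<in>charts_at \<A> x. \<forall>d\<in>charts_at \<A> x. \<forall>J\<in>multi_indices p.
        t d J = cov_transform c d x (t c) J)}"

text \<open>Push-forward along a diffeomorphism \<open>\<tau>\<close> with domain \<open>U\<close>: the components of \<open>\<tau>\<^sub>*t\<close> in a chart
  \<open>\<psi>\<close> around \<open>\<tau> x\<close> are the components of \<open>t\<close> in the chart \<open>\<psi> \<circ> \<tau>\<close> around \<open>x\<close>. (By the transformation
  law this is multiplication by the Jacobian of \<open>\<tau>\<close>, resp. of its inverse, in each index.)\<close>

definition pull_chart :: "'a set \<Rightarrow> ('a \<Rightarrow> 'a) \<Rightarrow> ('a, 'n::finite) chart \<Rightarrow> ('a, 'n) chart" where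
  "pull_chart U \<tau> c = (U \<inter> \<tau> -` cdom c, cmap c \<circ> \<tau>)"

definition push_tensor ::
  "('a, 'n::finite) chart set \<Rightarrow> 'a set \<Rightarrow> ('a \<Rightarrow> 'a) \<Rightarrow> 'a \<Rightarrow> ('a, 'n) tensor \<Rightarrow> ('a, 'n) tensor" where
  "push_tensor \<A> U \<tau> x t =
     (\<lambda>c I. if c \<in> charts_at \<A> (\<tau> x) then t (pull_chart U \<tau> c) I else 0)"

definition push_field ::
  "('a, 'n::finite) chart set \<Rightarrow> 'a set \<Rightarrow> ('a \<Rightarrow> 'a) \<Rightarrow> ('a, 'n) field \<Rightarrow> ('a, 'n) field" where
  "push_field \<A> U \<tau> g = (\<lambda>y. let x = inv_into U \<tau> y in push_tensor \<A> U \<tau> x (g x))"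

section \<open>Metrics and their 2-jets\<close>

definition has_signature :: "nat \<times> nat \<Rightarrow> real^'n::finite^'n \<Rightarrow> bool" where
  "has_signature \<sigma> G \<longleftrightarrow> (\<exists>(P :: real^'n^'n) N. invertible P \<and> card N = fst \<sigma> \<and> card (- N) = snd \<sigma> \<and>
     transpose P ** G ** P = (\<chi> i j. if i = j then (if i \<in> N then 1 else - 1) else 0))"

definition gram :: "(('n::finite) list \<Rightarrow> real) \<Rightarrow> real^'n^'n" where
  "gram b = (\<chi> i j. b [i, j])"

text \<open>The fibre over \<open>x\<close> of the bundle of metrics of signature \<open>\<sigma>\<close>.\<close>

definition metrics_at ::
  "('a, 'n::finite) chart set \<Rightarrow> nat \<times> nat \<Rightarrow> 'a \<Rightarrow> ('a, 'n) tensor set" where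
  "metrics_at \<A> \<sigma> x = {b \<in> cov_tensors \<A> x 2. \<forall>c\<in>charts_at \<A> x.
     (\<forall>i j. b c [i, j] = b c [j, i]) \<and> has_signature \<sigma> (gram (b c))}"

definition components ::
  "('a, 'n::finite) chart \<Rightarrow> ('a, 'n) field \<Rightarrow> 'n list \<Rightarrow> real^'n \<Rightarrow> real" where
  "components c S I = (\<lambda>y. S (cinv c y) c I)"

definition metric_on ::
  "('a, 'n::finite) chart set \<Rightarrow> nat \<times> nat \<Rightarrow> 'a set \<Rightarrow> ('a, 'n) field \<Rightarrow> bool" where
  "metric_on \<A> \<sigma> U g \<longleftrightarrow> (\<forall>x\<in>U. g x \<in> metrics_at \<A> \<sigma> x) \<and>
     (\<forall>c\<in>\<A>. \<forall>i j. smooth_on (cmap c ` (cdom c \<inter> U)) (components c g [i, j]))"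

definition metric_near ::
  "'a topology \<Rightarrow> ('a, 'n::finite) chart set \<Rightarrow> nat \<times> nat \<Rightarrow> 'a \<Rightarrow> ('a, 'n) field \<Rightarrow> bool" where
  "metric_near X \<A> \<sigma> x g \<longleftrightarrow> (\<exists>U. openin X U \<and> x \<in> U \<and> metric_on \<A> \<sigma> U g)"

definition second_partials ::
  "('a, 'n::finite) chart \<Rightarrow> ('a, 'n) field \<Rightarrow> 'a \<Rightarrow> 'n \<Rightarrow> 'n \<Rightarrow> 'n \<Rightarrow> 'n \<Rightarrow> real" where
  "second_partials c g x i j k l = partial l (partial k (components c g [i, j])) (cmap c x)"

type_synonym 'n jet_coordinates =
  "(real^'n) \<times> (real^'n^'n) \<times> (real^'n^'n^'n) \<times> (real^'n^'n^'n^'n)"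

definition jet_coords ::
  "('a, 'n::finite) chart \<Rightarrow> 'a \<Rightarrow> ('a, 'n) field \<Rightarrow> 'n jet_coordinates" where
  "jet_coords c x g =
     (cmap c x,
      gram (g x c),
      \<chi> i j k. partial k (components c g [i, j]) (cmap c x),
      \<chi> i j k l. second_partials c g x i j k l)"

text \<open>A 2-jet at \<open>x\<close> is \<open>x\<close> together with an equivalence class of metrics defined near \<open>x\<close>.\<close>

type_synonym ('a, 'n) jet = "'a \<times> ('a, 'n) field set"

definition jet2 ::
  "'a topology \<Rightarrow> ('a, 'n::finite) chart set \<Rightarrow> nat \<times> nat \<Rightarrow> 'a \<Rightarrow> ('a, 'n) field \<Rightarrow> ('a, 'n) jet"
  where
  "jet2 X \<A> \<sigma> x g =
     (x, {h. metric_near X \<A> \<sigma> x h \<and> (\<forall>c\<in>charts_at \<A> x. jet_coords c x h = jet_coords c x g)})"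

definition J2M ::
  "'a topology \<Rightarrow> ('a, 'n::finite) chart set \<Rightarrow> nat \<times> nat \<Rightarrow> ('a, 'n) jet set" where
  "J2M X \<A> \<sigma> = {jet2 X \<A> \<sigma> x g | x g. x \<in> topspace X \<and> metric_near X \<A> \<sigma> x g}"

section \<open>Second-order natural tensors\<close>

text \<open>A bundle morphism from \<open>J\<^sup>2M\<close> to \<open>\<otimes>\<^sup>pTX\<close> over the identity; its values off \<open>J2M\<close> are irrelevant.
  Smoothness: in every chart the components are smooth functions of the jet coordinates.\<close>

definition second_order_tensor ::
  "'a topology \<Rightarrow> ('a, 'n::finite) chart set \<Rightarrow> nat \<times> nat \<Rightarrow> nat \<Rightarrow>
     (('a, 'n) jet \<Rightarrow> ('a, 'n) tensor) \<Rightarrow> bool" where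
  "second_order_tensor X \<A> \<sigma> p T \<longleftrightarrow>
     (\<forall>j\<in>J2M X \<A> \<sigma>. T j \<in> contra_tensors \<A> (fst j) p) \<and>
     (\<forall>c\<in>\<A>. \<forall>I\<in>multi_indices p. \<exists>F :: 'n jet_coordinates \<Rightarrow> real.
        smooth_on_subset {jet_coords c x g | x g. x \<in> cdom c \<and> metric_near X \<A> \<sigma> x g} F \<and>
        (\<forall>x g. x \<in> cdom c \<and> metric_near X \<A> \<sigma> x g \<longrightarrow>
           T (jet2 X \<A> \<sigma> x g) c I = F (jet_coords c x g)))"

definition natural ::
  "'a topology \<Rightarrow> ('a, 'n::finite) chart set \<Rightarrow> nat \<times> nat \<Rightarrow>
     (('a, 'n) jet \<Rightarrow> ('a, 'n) tensor) \<Rightarrow> bool" where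
  "natural X \<A> \<sigma> T \<longleftrightarrow>
     (\<forall>U V \<tau> x g. diffeo X \<A> U V \<tau> \<and> x \<in> U \<and> metric_near X \<A> \<sigma> x g \<longrightarrow>
        T (jet2 X \<A> \<sigma> (\<tau> x) (push_field \<A> U \<tau> g)) =
        push_tensor \<A> U \<tau> x (T (jet2 X \<A> \<sigma> x g)))"

section \<open>Divergence\<close>

text \<open>\<open>christoffel c g x i j k\<close> is \<open>\<Gamma>\<close> with upper index \<open>i\<close> and lower indices \<open>j\<close>, \<open>k\<close>.\<close>

definition christoffel ::
  "('a, 'n::finite) chart \<Rightarrow> ('a, 'n) field \<Rightarrow> 'a \<Rightarrow> 'n \<Rightarrow> 'n \<Rightarrow> 'n \<Rightarrow> real" where
  "christoffel c g x i j k =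
     (\<Sum>l\<in>UNIV. matrix_inv (gram (g x c)) $ i $ l *
        (partial j (components c g [l, k]) (cmap c x) +
         partial k (components c g [l, j]) (cmap c x) -
         partial l (components c g [j, k]) (cmap c x))) / 2"

definition cov_deriv ::
  "('a, 'n::finite) chart \<Rightarrow> ('a, 'n) field \<Rightarrow> ('a, 'n) field \<Rightarrow> 'a \<Rightarrow> 'n \<Rightarrow> 'n list \<Rightarrow> real" where
  "cov_deriv c g S x k J = partial k (components c S J) (cmap c x) +
     (\<Sum>a<length J. \<Sum>l\<in>UNIV. christoffel c g x (J ! a) k l * S x c (J[a := l]))"

definition divergence ::
  "('a, 'n::finite) chart \<Rightarrow> ('a, 'n) field \<Rightarrow> ('a, 'n) field \<Rightarrow> 'a \<Rightarrow> 'n list \<Rightarrow> real" where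
  "divergence c g S x J = (\<Sum>k\<in>UNIV. cov_deriv c g S x k (J @ [k]))"

definition divergence_free ::
  "'a topology \<Rightarrow> ('a, 'n::finite) chart set \<Rightarrow> nat \<times> nat \<Rightarrow> nat \<Rightarrow>
     (('a, 'n) jet \<Rightarrow> ('a, 'n) tensor) \<Rightarrow> bool" where
  "divergence_free X \<A> \<sigma> p T \<longleftrightarrow>
     (\<forall>U g. openin X U \<and> metric_on \<A> \<sigma> U g \<longrightarrow>
        (\<forall>x\<in>U. \<forall>c\<in>charts_at \<A> x. \<forall>J\<in>multi_indices (p - 1).
           divergence c g (\<lambda>z. T (jet2 X \<A> \<sigma> z g)) x J = 0))"

section \<open>Homogeneity in the second derivatives of the metric\<close>

definition geodesic_on ::
  "('a, 'n::finite) chart set \<Rightarrow> ('a, 'n) field \<Rightarrow> real set \<Rightarrow> (real \<Rightarrow> 'a) \<Rightarrow> bool" where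
  "geodesic_on \<A> g I \<gamma> \<longleftrightarrow> (\<forall>t\<in>I. \<forall>c\<in>charts_at \<A> (\<gamma> t). \<exists>w a.
     (\<forall>\<^sub>F s in nhds t. ((\<lambda>s. cmap c (\<gamma> s)) has_vector_derivative w s) (at s)) \<and>
     (w has_vector_derivative a) (at t) \<and>
     (\<forall>i. a $ i +
        (\<Sum>j\<in>UNIV. \<Sum>k\<in>UNIV. christoffel c g (\<gamma> t) i j k * w t $ j * w t $ k) = 0))"

text \<open>Normal coordinates at \<open>x\<close> (inverse of the exponential map followed by an arbitrary linear
  identification of the tangent space with \<open>\<real>\<^sup>n\<close>): \<open>x\<close> is the origin and the lines through the
  origin are geodesics.\<close>

definition normal_chart ::
  "('a, 'n::finite) chart set \<Rightarrow> nat \<times> nat \<Rightarrow> ('a, 'n) field \<Rightarrow> 'a \<Rightarrow> ('a, 'n) chart \<Rightarrow> bool" where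
  "normal_chart \<A> \<sigma> g x c \<longleftrightarrow> c \<in> charts_at \<A> x \<and> metric_on \<A> \<sigma> (cdom c) g \<and>
     cmap c x = 0 \<and> (\<forall>y\<in>cmap c ` cdom c. closed_segment 0 y \<subseteq> cmap c ` cdom c) \<and>
     (\<forall>v. geodesic_on \<A> g {t. t *\<^sub>R v \<in> cmap c ` cdom c} (\<lambda>t. cinv c (t *\<^sub>R v)))"

text \<open>The covariant 4-tensor at \<open>x\<close> whose components in the chart \<open>c\<close> are the second partial
  derivatives of the metric. For a normal chart \<open>c\<close> it is the tensor \<open>g\<^sup>2\<close> at \<open>x\<close>, and does not depend
  on the normal chart.\<close>

definition second_derivative_tensor ::
  "('a, 'n::finite) chart set \<Rightarrow> 'a \<Rightarrow> ('a, 'n) chart \<Rightarrow> ('a, 'n) field \<Rightarrow> ('a, 'n) tensor" where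
  "second_derivative_tensor \<A> x c g =
     (\<lambda>d J. if d \<in> charts_at \<A> x \<and> J \<in> multi_indices 4
        then cov_transform c d x
          (\<lambda>I. second_partials c g x (I ! 0) (I ! 1) (I ! 2) (I ! 3)) J
        else 0)"

definition N2 :: "('a, 'n::finite) chart set \<Rightarrow> 'a \<Rightarrow> ('a, 'n) tensor set" where
  "N2 \<A> x = {h \<in> cov_tensors \<A> x 4. \<forall>c\<in>charts_at \<A> x. \<forall>i j k l.
     h c [i, j, k, l] = h c [j, i, k, l] \<and> h c [i, j, k, l] = h c [i, j, l, k] \<and>
     h c [i, j, k, l] + h c [i, j, l, k] + h c [i, k, j, l] +
     h c [i, k, l, j] + h c [i, l, j, k] + h c [i, l, k, j] = 0}"

text \<open>Homogeneous polynomial maps of degree \<open>k\<close> from \<open>N2\<close> to the \<open>p\<close>-tensors at \<open>x\<close>: the components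
  are linear combinations of products of \<open>k\<close> components of the argument (the coefficients need
  not be unique).\<close>

definition homogeneous_polynomial_map ::
  "('a, 'n::finite) chart set \<Rightarrow> 'a \<Rightarrow> nat \<Rightarrow> nat \<Rightarrow>
     (('a, 'n) tensor \<Rightarrow> ('a, 'n) tensor) \<Rightarrow> bool" where
  "homogeneous_polynomial_map \<A> x p k \<tt> \<longleftrightarrow>
     \<tt> \<in> N2 \<A> x \<rightarrow> contra_tensors \<A> x p \<and>
     (\<forall>c\<in>charts_at \<A> x. \<forall>J\<in>multi_indices p. \<exists>a :: 'n list list \<Rightarrow> real. \<forall>h\<in>N2 \<A> x.
        \<tt> h c J = (\<Sum>K | length K = k \<and> set K \<subseteq> multi_indices 4. a K * (\<Prod>I\<leftarrow>K. h c I)))"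

text \<open>\<open>\<tt>\<close> represents \<open>T\<close> over the metric \<open>b\<close> at \<open>x\<close>. Every element of \<open>N2\<close> arises from some metric
  and normal chart, so \<open>\<tt>\<close> is determined by \<open>T\<close> on \<open>N2\<close>; for natural \<open>T\<close> it is automatically
  equivariant under the orthogonal group of \<open>b\<close>.\<close>

definition represents ::
  "'a topology \<Rightarrow> ('a, 'n::finite) chart set \<Rightarrow> nat \<times> nat \<Rightarrow> 'a \<Rightarrow> ('a, 'n) tensor \<Rightarrow>
     (('a, 'n) tensor \<Rightarrow> ('a, 'n) tensor) \<Rightarrow> (('a, 'n) jet \<Rightarrow> ('a, 'n) tensor) \<Rightarrow> bool" where
  "represents X \<A> \<sigma> x b \<tt> T \<longleftrightarrow>
     (\<forall>g c. metric_near X \<A> \<sigma> x g \<and> g x = b \<and> normal_chart \<A> \<sigma> g x c \<longrightarrow>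
        T (jet2 X \<A> \<sigma> x g) = \<tt> (second_derivative_tensor \<A> x c g))"

definition homogeneous_of_degree ::
  "'a topology \<Rightarrow> ('a, 'n::finite) chart set \<Rightarrow> nat \<times> nat \<Rightarrow> nat \<Rightarrow> nat \<Rightarrow>
     (('a, 'n) jet \<Rightarrow> ('a, 'n) tensor) \<Rightarrow> bool" where
  "homogeneous_of_degree X \<A> \<sigma> p k T \<longleftrightarrow>
     (\<forall>x\<in>topspace X. \<forall>b\<in>metrics_at \<A> \<sigma> x. \<exists>\<tt>.
        homogeneous_polynomial_map \<A> x p k \<tt> \<and> represents X \<A> \<sigma> x b \<tt> T)"

end

theory Submission
  imports Defs
begin

text \<open>In a chart centred at \<open>x\<close>, fix the value of the metric at \<open>x\<close>, let its first derivatives vanish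
  there, and regard the components \<open>T\<^bsup>Jk\<^esup>\<close> as functions of the second derivatives \<open>h\<close> of the
  metric. The divergence at \<open>x\<close> depends on the third derivatives of the metric only through
  \<open>\<Sum>\<^sub>k \<partial>T\<^bsup>Jk\<^esup>/\<partial>h \<cdot> (third derivatives)\<close>. Comparing two metrics whose third derivatives differ by
  \<open>a\<^sup>2 \<otimes> u\<^sup>3\<close>, one finds that \<open>\<Sum>\<^sub>k u\<^sub>k T\<^bsup>Jk\<^esup>(h)\<close> does not change when a multiple of
  \<open>a\<^sup>2 \<otimes> u\<^sup>2\<close> is added to \<open>h\<close>. Hence an \<open>n\<close>-fold iterated difference of \<open>\<Sum>\<^sub>k v\<^sub>k T\<^bsup>Jk\<^esup>\<close> in the
  directions \<open>a\<^sup>2 \<otimes> u\<^sub>i\<^sup>2\<close> is linear in \<open>v\<close> and vanishes for \<open>v = u\<^sub>1, \<dots>, u\<^sub>n\<close>. When these vectors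
  form a basis it is zero, and therefore \<open>T\<close> is polynomial in \<open>h\<close>.

  By naturality under the dilation of the chart by \<open>\<lambda>\<close>, the tensor \<open>T\<close> at the metric \<open>\<lambda>\<^sup>2 g\<close> is
  \<open>\<Sum>\<^sub>k \<lambda>\<^bsup>-p-2k\<^esup> T\<^sub>k\<close>, with \<open>T\<^sub>k\<close> homogeneous of degree \<open>k\<close>. Inverting a Vandermonde matrix expresses
  \<open>T\<^sub>k\<close> as a linear combination of the values of \<open>T\<close> at constant multiples of the metric. These values
  are natural, and divergence-free because \<open>g\<close> and \<open>\<lambda>\<^sup>2 g\<close> have the same Levi-Civita connection. Because
  \<open>\<lambda> = 1\<close> is one of the nodes, \<open>\<Sum>\<^sub>k T\<^sub>k = T\<close> holds at every jet, not only in normal coordinates.\<close>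

section \<open>Calculus of smooth functions\<close>

text \<open>Polynomiality comes from smoothness and the vanishing divergence; naturality enters with
  the dilations and in the passage to normal charts. The directions \<open>direction a u\<close> do
  not in general satisfy the symmetrization condition of \<open>N2\<close>, so the argument runs on
  the larger space \<open>sym4\<close> of second derivatives at a point where the first derivatives
  vanish. There the Christoffel symbols vanish too, and the divergence is a plain sum of partial
  derivatives. The comparison metrics must have a prescribed third-order Taylor expansion and the
  given signature, which is defined by congruence; this dictates the shape of
  \<open>test_matrix\<close>.

  Once the invariance is known, only continuity in \<open>h\<close> is used: vanishing iterated
  differences along a spanning family of directions force a polynomial. The resulting bound on the
  degree is crude, but it depends on the dimension only, and this lets one \<open>m\<close> serve
  all points, metrics and components. Taking the addends as combinations of \<open>T\<close> at
  rescaled metrics, rather than as Taylor coefficients in a chart, makes their smoothness and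
  naturality a formality.\<close>

lemma has_frechet_derivative:
  "f differentiable (at y) \<Longrightarrow> (f has_derivative frechet_derivative f (at y)) (at y)"
  by (rule frechet_derivative_works[THEN iffD1])

lemma frechet_derivative_cong_open:
  assumes "open S" "y \<in> S" "\<And>z. z \<in> S \<Longrightarrow> f z = g z"
  shows "frechet_derivative f (at y) = frechet_derivative g (at y)"
proof -
  have "(f has_derivative D) (at y) \<longleftrightarrow> (g has_derivative D) (at y)" for D
    using has_derivative_transform_within_open[OF _ assms(1,2), of f D UNIV g]
      has_derivative_transform_within_open[OF _ assms(1,2), of g D UNIV f] assms(3) by metis
  then show ?thesis unfolding frechet_derivative_def by simp
qed

lemma differentiable_cong_open:
  assumes "open S" "y \<in> S" "\<And>z. z \<in> S \<Longrightarrow> f z = g z" "f differentiable (at y)"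
  shows "g differentiable (at y)"
  using assms has_derivative_transform_within_open[OF _ assms(1,2), of f _ UNIV g]
  unfolding differentiable_def by metis

lemma partial_cong_open:
  assumes "open S" "y \<in> S" "\<And>z. z \<in> S \<Longrightarrow> f z = g z"
  shows "partial k f y = partial k g y"
  unfolding partial_def by (simp add: frechet_derivative_cong_open[OF assms])

lemma Ck_on_cong:
  assumes "open S" "\<And>z. z \<in> S \<Longrightarrow> f z = g z" "Ck_on k S f"
  shows "Ck_on k S g"
  using assms(2,3)
proof (induction k arbitrary: f g)
  case 0
  then show ?case by (simp cong: continuous_on_cong)
next
  case (Suc k)
  have "Ck_on k S (\<lambda>y. frechet_derivative g (at y) v)" for v
    using Suc.IH[of "\<lambda>y. frechet_derivative f (at y) v" "\<lambda>y. frechet_derivative g (at y) v"]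
      Suc.prems frechet_derivative_cong_open[OF assms(1) _ Suc.prems(1)] by simp
  then show ?case
    using Suc.prems differentiable_cong_open[OF assms(1) _ Suc.prems(1)] by simp
qed

lemma Ck_on_mono: "Ck_on k S f \<Longrightarrow> T \<subseteq> S \<Longrightarrow> Ck_on k T f"
  by (induction k arbitrary: f) (auto intro: continuous_on_subset)

lemma Ck_on_Suc_D: "Ck_on (Suc k) S f \<Longrightarrow> Ck_on k S f"
proof (induction k arbitrary: f)
  case 0
  then show ?case
    by (auto intro!: differentiable_imp_continuous_on differentiable_at_imp_differentiable_on)
qed auto

lemma Ck_on_const [simp]: "Ck_on k S (\<lambda>y. c)"
  by (induction k arbitrary: c) (auto simp: frechet_derivative_const)

lemma Ck_on_linear:
  assumes "bounded_linear f"
  shows "Ck_on k S f"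
proof (cases k)
  case 0
  then show ?thesis using assms by (simp add: linear_continuous_on)
next
  case (Suc m)
  have "(f has_derivative f) (at y)" for y
    using assms by (rule bounded_linear_imp_has_derivative)
  then have "frechet_derivative f (at y) = f" "f differentiable (at y)" for y
    by (auto simp: differentiable_def intro: frechet_derivative_at[symmetric])
  then show ?thesis using Suc by simp
qed

lemma Ck_on_bounded_linear_comp:
  assumes "bounded_linear L" "Ck_on k S f" "open S"
  shows "Ck_on k S (\<lambda>y. L (f y))"
  using assms(2)
proof (induction k arbitrary: f)
  case 0
  then show ?case using assms(1) by (simp add: bounded_linear.continuous_on)
next
  case (Suc k)
  have d: "((\<lambda>y. L (f y)) has_derivative (\<lambda>v. L (frechet_derivative f (at y) v))) (at y)"
    if "y \<in> S" for y
    using Suc.prems that by (intro bounded_linear.has_derivative[OF assms(1)] has_frechet_derivative) simp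
  have "Ck_on k S (\<lambda>y. frechet_derivative (\<lambda>y. L (f y)) (at y) v)" for v
  proof (rule Ck_on_cong[OF assms(3)])
    show "Ck_on k S (\<lambda>y. L (frechet_derivative f (at y) v))"
      using Suc.IH[of "\<lambda>y. frechet_derivative f (at y) v"] Suc.prems by simp
  qed (simp add: frechet_derivative_at[OF d, symmetric])
  then show ?case using d by (auto simp: differentiable_def)
qed

lemma Ck_on_add:
  assumes "Ck_on k S f" "Ck_on k S g" "open S"
  shows "Ck_on k S (\<lambda>y. f y + g y)"
  using assms(1,2)
proof (induction k arbitrary: f g)
  case 0
  then show ?case by (simp add: continuous_on_add)
next
  case (Suc k)
  have d: "((\<lambda>y. f y + g y) has_derivative
      (\<lambda>v. frechet_derivative f (at y) v + frechet_derivative g (at y) v)) (at y)"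
    if "y \<in> S" for y
    using Suc.prems that by (intro has_derivative_add) (auto intro: has_frechet_derivative)
  have "Ck_on k S (\<lambda>y. frechet_derivative (\<lambda>y. f y + g y) (at y) v)" for v
  proof (rule Ck_on_cong[OF assms(3)])
    show "Ck_on k S (\<lambda>y. frechet_derivative f (at y) v + frechet_derivative g (at y) v)"
      using Suc.IH[of "\<lambda>y. frechet_derivative f (at y) v" "\<lambda>y. frechet_derivative g (at y) v"]
        Suc.prems by simp
  qed (simp add: frechet_derivative_at[OF d, symmetric])
  then show ?case using d by (auto simp: differentiable_def)
qed

lemma Ck_on_scaleR:
  fixes f :: "'v::real_normed_vector \<Rightarrow> real" and g :: "'v \<Rightarrow> 'w::real_normed_vector"
  assumes "Ck_on k S f" "Ck_on k S g" "open S"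
  shows "Ck_on k S (\<lambda>y. f y *\<^sub>R g y)"
  using assms(1,2)
proof (induction k arbitrary: f g)
  case 0
  then show ?case by (simp add: continuous_on_scaleR)
next
  case (Suc k)
  have d: "((\<lambda>y. f y *\<^sub>R g y) has_derivative
      (\<lambda>v. f y *\<^sub>R frechet_derivative g (at y) v + frechet_derivative f (at y) v *\<^sub>R g y)) (at y)"
    if "y \<in> S" for y
    using Suc.prems that by (intro has_derivative_scaleR) (auto intro: has_frechet_derivative)
  have "Ck_on k S (\<lambda>y. frechet_derivative (\<lambda>y. f y *\<^sub>R g y) (at y) v)" for v
  proof (rule Ck_on_cong[OF assms(3)])
    show "Ck_on k S (\<lambda>y. f y *\<^sub>R frechet_derivative g (at y) v + frechet_derivative f (at y) v *\<^sub>R g y)"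
      using Suc.prems Suc.IH[of f "\<lambda>y. frechet_derivative g (at y) v"]
        Suc.IH[of "\<lambda>y. frechet_derivative f (at y) v" g] Ck_on_Suc_D[of k S f] Ck_on_Suc_D[of k S g]
      by (intro Ck_on_add assms) auto
  qed (simp add: frechet_derivative_at[OF d, symmetric])
  then show ?case using d by (auto simp: differentiable_def)
qed

lemma Ck_on_sum:
  assumes "\<And>i. i \<in> I \<Longrightarrow> Ck_on k S (f i)" "open S"
  shows "Ck_on k S (\<lambda>y. \<Sum>i\<in>I. f i y)"
  using assms(1)
  by (induction I rule: infinite_finite_induct) (auto intro!: Ck_on_add assms(2))

text \<open>The chain rule produces \<open>frechet_derivative f (at (g y))\<close> applied to a
  vector that itself varies with \<open>y\<close>. Expanding that vector in \<open>Basis\<close>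
  leaves products to which the induction hypothesis and \<open>Ck_on_scaleR\<close> apply; hence the
  Euclidean type of the middle space.\<close>

lemma Ck_on_compose:
  fixes f :: "'v::euclidean_space \<Rightarrow> 'w::real_normed_vector" and g :: "'u::real_normed_vector \<Rightarrow> 'v"
  assumes "Ck_on k R f" "Ck_on k S g" "open S" "g ` S \<subseteq> R"
  shows "Ck_on k S (\<lambda>y. f (g y))"
  using assms(1,2)
proof (induction k arbitrary: f)
  case 0
  then show ?case using continuous_on_compose2[of R f S g] assms(4) by simp
next
  case (Suc k)
  have d: "((\<lambda>y. f (g y)) has_derivative
      (\<lambda>v. frechet_derivative f (at (g y)) (frechet_derivative g (at y) v))) (at y)"
    if "y \<in> S" for y
  proof (rule has_derivative_compose[of g])
    show "(g has_derivative frechet_derivative g (at y)) (at y)"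
      using Suc.prems that by (intro has_frechet_derivative) simp
    show "(f has_derivative frechet_derivative f (at (g y))) (at (g y))"
      using Suc.prems(1) that assms(4) by (intro has_frechet_derivative) auto
  qed
  have eq: "frechet_derivative (\<lambda>y. f (g y)) (at y) v =
      (\<Sum>b\<in>Basis. (frechet_derivative g (at y) v \<bullet> b) *\<^sub>R frechet_derivative f (at (g y)) b)"
    if "y \<in> S" for y v
  proof -
    have l: "linear (frechet_derivative f (at (g y)))"
      using Suc.prems that assms(4) by (intro linear_frechet_derivative) auto
    have "frechet_derivative (\<lambda>y. f (g y)) (at y) v =
        frechet_derivative f (at (g y)) (\<Sum>b\<in>Basis. (frechet_derivative g (at y) v \<bullet> b) *\<^sub>R b)"
      using frechet_derivative_at[OF d[OF that], symmetric] by (simp add: euclidean_representation)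
    then show ?thesis by (simp add: linear_sum[OF l] linear_scale[OF l])
  qed
  have "Ck_on k S (\<lambda>y. frechet_derivative (\<lambda>y. f (g y)) (at y) v)" for v
  proof (rule Ck_on_cong[OF assms(3) eq[symmetric]])
    show "Ck_on k S (\<lambda>y. \<Sum>b\<in>Basis. (frechet_derivative g (at y) v \<bullet> b) *\<^sub>R frechet_derivative f (at (g y)) b)"
      using Suc.prems Suc.IH Ck_on_Suc_D[of k S g]
      by (intro Ck_on_sum Ck_on_scaleR assms(3) Ck_on_bounded_linear_comp[OF bounded_linear_inner_left]) auto
  qed
  then show ?case using d by (auto simp: differentiable_def)
qed

section \<open>Closure properties of smooth functions\<close>

lemma smooth_on_cong: "open S \<Longrightarrow> (\<And>z. z \<in> S \<Longrightarrow> f z = g z) \<Longrightarrow> smooth_on S f \<Longrightarrow> smooth_on S g"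
  unfolding smooth_on_def by (intro allI Ck_on_cong[of S f g]) auto

lemma smooth_on_mono: "smooth_on S f \<Longrightarrow> T \<subseteq> S \<Longrightarrow> smooth_on T f"
  unfolding smooth_on_def by (intro allI Ck_on_mono[of _ S f T]) auto

lemma smooth_on_const [simp]: "smooth_on S (\<lambda>y. c)"
  by (simp add: smooth_on_def)

lemma smooth_on_linear: "bounded_linear f \<Longrightarrow> smooth_on S f"
  by (simp add: smooth_on_def Ck_on_linear)

lemma smooth_on_bounded_linear_comp:
  "bounded_linear L \<Longrightarrow> smooth_on S f \<Longrightarrow> open S \<Longrightarrow> smooth_on S (\<lambda>y. L (f y))"
  by (simp add: smooth_on_def Ck_on_bounded_linear_comp)

lemma smooth_on_vec_nth: "smooth_on S f \<Longrightarrow> open S \<Longrightarrow> smooth_on S (\<lambda>y. f y $ i)"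
  by (rule smooth_on_bounded_linear_comp[OF bounded_linear_vec_nth])

lemma smooth_on_add: "smooth_on S f \<Longrightarrow> smooth_on S g \<Longrightarrow> open S \<Longrightarrow> smooth_on S (\<lambda>y. f y + g y)"
  by (simp add: smooth_on_def Ck_on_add)

lemma smooth_on_mult:
  fixes f g :: "'v::real_normed_vector \<Rightarrow> real"
  shows "smooth_on S f \<Longrightarrow> smooth_on S g \<Longrightarrow> open S \<Longrightarrow> smooth_on S (\<lambda>y. f y * g y)"
  using Ck_on_scaleR[of _ S f g] by (simp add: smooth_on_def)

lemma smooth_on_sum:
  "(\<And>i. i \<in> I \<Longrightarrow> smooth_on S (f i)) \<Longrightarrow> open S \<Longrightarrow> smooth_on S (\<lambda>y. \<Sum>i\<in>I. f i y)"
  by (simp add: smooth_on_def Ck_on_sum)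

lemma smooth_on_compose:
  fixes f :: "'v::euclidean_space \<Rightarrow> 'w::real_normed_vector"
  shows "smooth_on R f \<Longrightarrow> smooth_on S g \<Longrightarrow> open S \<Longrightarrow> g ` S \<subseteq> R \<Longrightarrow> smooth_on S (\<lambda>y. f (g y))"
  unfolding smooth_on_def by (intro allI Ck_on_compose[of _ R f S g]) auto

lemma smooth_on_frechet_derivative:
  "smooth_on S f \<Longrightarrow> smooth_on S (\<lambda>y. frechet_derivative f (at y) v)"
  unfolding smooth_on_def using Ck_on.simps(2)[of _ S f] by simp

lemma smooth_on_partial: "smooth_on S f \<Longrightarrow> smooth_on S (partial k f)"
  unfolding partial_def by (rule smooth_on_frechet_derivative)

lemma smooth_on_differentiable: "smooth_on S f \<Longrightarrow> y \<in> S \<Longrightarrow> f differentiable (at y)"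
  unfolding smooth_on_def using Ck_on.simps(2)[of 0 S f] by blast

lemma smooth_on_continuous_on: "smooth_on S f \<Longrightarrow> continuous_on S f"
  unfolding smooth_on_def using Ck_on.simps(1)[of S f] by blast

lemma smooth_on_has_derivative:
  "smooth_on S f \<Longrightarrow> y \<in> S \<Longrightarrow> (f has_derivative frechet_derivative f (at y)) (at y)"
  by (rule has_frechet_derivative[OF smooth_on_differentiable])

lemma smooth_on_sum_axis:
  fixes f :: "'v::real_normed_vector \<Rightarrow> 'b::euclidean_space"
  assumes "\<And>b. b \<in> Basis \<Longrightarrow> smooth_on S (\<lambda>y. f y \<bullet> b)" "open S"
  shows "smooth_on S f"
proof -
  have "smooth_on S (\<lambda>y. (f y \<bullet> b) *\<^sub>R b)" if "b \<in> Basis" for b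
    using assms that by (intro smooth_on_bounded_linear_comp[OF bounded_linear_scaleR_left]) auto
  then have "smooth_on S (\<lambda>y. \<Sum>b\<in>Basis. (f y \<bullet> b) *\<^sub>R b)" by (intro smooth_on_sum assms)
  then show ?thesis by (simp add: euclidean_representation)
qed

lemma smooth_on_vec_lambda:
  fixes f :: "'i::finite \<Rightarrow> 'v::real_normed_vector \<Rightarrow> 'b::euclidean_space"
  assumes "\<And>i. smooth_on S (f i)" "open S"
  shows "smooth_on S (\<lambda>y. \<chi> i. f i y)"
proof (rule smooth_on_sum_axis[OF _ assms(2)])
  fix b :: "'b^'i" assume "b \<in> Basis"
  then obtain i u where b: "b = axis i u" "u \<in> Basis" unfolding Basis_vec_def by auto
  have "(\<chi> i. f i y) \<bullet> b = f i y \<bullet> u" for y by (simp add: b inner_axis)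
  then show "smooth_on S (\<lambda>y. (\<chi> i. f i y) \<bullet> b)"
    using assms by (simp add: smooth_on_bounded_linear_comp[OF bounded_linear_inner_left])
qed

lemma smooth_on_Pair:
  fixes f :: "'v::real_normed_vector \<Rightarrow> 'a::euclidean_space" and g :: "'v \<Rightarrow> 'b::euclidean_space"
  assumes "smooth_on S f" "smooth_on S g" "open S"
  shows "smooth_on S (\<lambda>y. (f y, g y))"
proof (rule smooth_on_sum_axis[OF _ assms(3)])
  fix b :: "'a \<times> 'b"
  have "smooth_on S (\<lambda>y. f y \<bullet> fst b + g y \<bullet> snd b)"
    using assms by (intro smooth_on_add smooth_on_bounded_linear_comp[OF bounded_linear_inner_left])
  then show "smooth_on S (\<lambda>y. (f y, g y) \<bullet> b)" by (simp add: inner_prod_def)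
qed

section \<open>Rules for partial derivatives\<close>

lemma has_derivative_partial:
  assumes "(f has_derivative D) (at y)"
  shows "partial k f y = D (axis k 1)"
  unfolding partial_def using frechet_derivative_at[OF assms] by simp

lemma partial_const [simp]: "partial k (\<lambda>y. c) y = 0"
  by (rule has_derivative_partial[of _ "\<lambda>_. 0"]) simp

lemma partial_vec_nth [simp]: "partial k (\<lambda>y. y $ i) y = (if i = k then 1 else 0)"
proof -
  have "((\<lambda>y::real^'a. y $ i) has_derivative (\<lambda>v. v $ i)) (at y)"
    by (rule bounded_linear_imp_has_derivative) (rule bounded_linear_vec_nth)
  then show ?thesis by (simp add: has_derivative_partial axis_def)
qed

lemma partial_add:
  assumes "f differentiable (at y)" "g differentiable (at y)"
  shows "partial k (\<lambda>y. f y + g y) y = partial k f y + partial k g y"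
proof -
  have "((\<lambda>y. f y + g y) has_derivative
      (\<lambda>v. frechet_derivative f (at y) v + frechet_derivative g (at y) v)) (at y)"
    using assms by (intro has_derivative_add) (auto intro: has_frechet_derivative)
  from has_derivative_partial[OF this, of k] show ?thesis by (simp add: partial_def)
qed

lemma partial_mult:
  fixes f g :: "real^'n::finite \<Rightarrow> real"
  assumes "f differentiable (at y)" "g differentiable (at y)"
  shows "partial k (\<lambda>y. f y * g y) y = f y * partial k g y + partial k f y * g y"
proof -
  have "((\<lambda>y. f y * g y) has_derivative
      (\<lambda>v. f y * frechet_derivative g (at y) v + frechet_derivative f (at y) v * g y)) (at y)"
    using assms by (intro has_derivative_mult) (auto intro: has_frechet_derivative)
  from has_derivative_partial[OF this, of k] show ?thesis by (simp add: partial_def)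
qed

lemma partial_cmult:
  fixes g :: "real^'n::finite \<Rightarrow> real"
  shows "g differentiable (at y) \<Longrightarrow> partial k (\<lambda>y. c * g y) y = c * partial k g y"
  using partial_mult[of "\<lambda>_. c" y g k] by simp

lemma partial_sum:
  assumes "\<And>i. i \<in> I \<Longrightarrow> f i differentiable (at y)"
  shows "partial k (\<lambda>y. \<Sum>i\<in>I. f i y) y = (\<Sum>i\<in>I. partial k (f i) y)"
proof -
  have "((\<lambda>y. \<Sum>i\<in>I. f i y) has_derivative
      (\<lambda>v. \<Sum>i\<in>I. frechet_derivative (f i) (at y) v)) (at y)"
    using assms by (intro has_derivative_sum) (auto intro: has_frechet_derivative)
  from has_derivative_partial[OF this, of k] show ?thesis by (simp add: partial_def)
qed

lemma has_derivative_eq_sum_partial: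
  fixes f :: "real^'n::finite \<Rightarrow> real"
  assumes "f differentiable (at y)"
  shows "frechet_derivative f (at y) v = (\<Sum>i\<in>UNIV. v $ i * partial i f y)"
proof -
  have l: "linear (frechet_derivative f (at y))" using assms by (rule linear_frechet_derivative)
  have "frechet_derivative f (at y) v = frechet_derivative f (at y) (\<Sum>i\<in>UNIV. v $ i *s axis i 1)"
    by (simp add: basis_expansion)
  then show ?thesis
    by (simp add: linear_sum[OF l] linear_scale[OF l] scalar_mult_eq_scaleR partial_def)
qed

lemma partial_compose:
  fixes f :: "real^'m::finite \<Rightarrow> real" and g :: "real^'n::finite \<Rightarrow> real^'m"
  assumes "f differentiable (at (g y))" "g differentiable (at y)"
  shows "partial k (\<lambda>y. f (g y)) y = (\<Sum>i\<in>UNIV. partial k (\<lambda>y. g y $ i) y * partial i f (g y))"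
proof -
  have g: "(g has_derivative frechet_derivative g (at y)) (at y)"
    using assms(2) by (auto intro: has_frechet_derivative)
  have "((\<lambda>y. f (g y)) has_derivative
      (\<lambda>v. frechet_derivative f (at (g y)) (frechet_derivative g (at y) v))) (at y)"
    using assms(1) by (intro has_derivative_compose[OF g]) (auto intro: has_frechet_derivative)
  then have "partial k (\<lambda>y. f (g y)) y = frechet_derivative f (at (g y)) (frechet_derivative g (at y) (axis k 1))"
    by (rule has_derivative_partial)
  moreover have "partial k (\<lambda>y. g y $ i) y = frechet_derivative g (at y) (axis k 1) $ i" for i
    by (intro has_derivative_partial bounded_linear.has_derivative[OF bounded_linear_vec_nth g])
  ultimately show ?thesis
    using has_derivative_eq_sum_partial[OF assms(1)] by simp
qed

section \<open>Symmetry of mixed second partial derivatives\<close>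

lemma has_real_derivative_along_axis:
  assumes "f differentiable (at (y + t *\<^sub>R axis k 1))"
  shows "((\<lambda>t. f (y + t *\<^sub>R axis k 1)) has_real_derivative partial k f (y + t *\<^sub>R axis k 1)) (at t)"
proof -
  have g: "((\<lambda>t. y + t *\<^sub>R axis k 1) has_derivative (\<lambda>s. s *\<^sub>R axis k 1)) (at t)"
    by (auto intro!: derivative_eq_intros)
  have l: "linear (frechet_derivative f (at (y + t *\<^sub>R axis k 1)))"
    using assms by (rule linear_frechet_derivative)
  have "((\<lambda>t. f (y + t *\<^sub>R axis k 1)) has_derivative
      (\<lambda>s. frechet_derivative f (at (y + t *\<^sub>R axis k 1)) (s *\<^sub>R axis k 1))) (at t)"
    by (rule has_derivative_compose[OF g has_frechet_derivative[OF assms]])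
  then show ?thesis
    unfolding has_field_derivative_def
    by (rule has_derivative_eq_rhs) (simp add: fun_eq_iff linear_scale[OF l] partial_def)
qed

text \<open>The second difference on the left is symmetric in \<open>k\<close> and \<open>l\<close>,
  while the mean value theorem, applied once in each direction, identifies it with a mixed partial
  in a definite order. The point \<open>z\<close> stays within \<open>2 * h\<close> of
  \<open>y\<close>, so that continuity can be used for small \<open>h\<close>.\<close>

lemma second_difference_mvt:
  fixes f :: "real^'n::finite \<Rightarrow> real"
  assumes "smooth_on (ball y r) f" and h: "0 < h" "2 * h < r"
  shows "\<exists>z. dist y z \<le> 2 * h \<and>
    f (y + h *\<^sub>R axis k 1 + h *\<^sub>R axis l 1) - f (y + h *\<^sub>R axis k 1) - f (y + h *\<^sub>R axis l 1) + f y
    = h * h * partial l (partial k f) z"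
proof -
  have near: "dist y (y + s *\<^sub>R axis k 1 + t *\<^sub>R axis l 1) \<le> 2 * h" if "0 \<le> s" "s \<le> h" "0 \<le> t" "t \<le> h" for s t
  proof -
    have "norm (s *\<^sub>R axis k 1 + t *\<^sub>R axis l 1 :: real^'n) \<le> s + t"
      using norm_triangle_ineq[of "s *\<^sub>R axis k 1" "t *\<^sub>R axis l 1 :: real^'n"] that by simp
    moreover have "dist y (y + s *\<^sub>R axis k 1 + t *\<^sub>R axis l 1) = norm (s *\<^sub>R axis k 1 + t *\<^sub>R axis l 1 :: real^'n)"
      by (metis add.assoc add_diff_cancel_left' dist_commute dist_norm)
    ultimately show ?thesis using that by simp
  qed
  have inb: "y + s *\<^sub>R axis k 1 + t *\<^sub>R axis l 1 \<in> ball y r" if "0 \<le> s" "s \<le> h" "0 \<le> t" "t \<le> h" for s t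
    using near[OF that] h by simp
  have d: "f differentiable (at z)" "partial k f differentiable (at z)" if "z \<in> ball y r" for z
    using that smooth_on_differentiable[OF assms(1)] smooth_on_differentiable[OF smooth_on_partial[OF assms(1)]] by auto
  let ?\<phi> = "\<lambda>s. f ((y + h *\<^sub>R axis l 1) + s *\<^sub>R axis k 1) - f (y + s *\<^sub>R axis k 1)"
  have "\<exists>s>0. s < h \<and> ?\<phi> h - ?\<phi> 0 = (h - 0) *
      (partial k f ((y + h *\<^sub>R axis l 1) + s *\<^sub>R axis k 1) - partial k f (y + s *\<^sub>R axis k 1))"
  proof (rule MVT2[OF h(1)])
    fix s assume s: "0 \<le> s" "s \<le> h"
    show "(?\<phi> has_real_derivative (partial k f ((y + h *\<^sub>R axis l 1) + s *\<^sub>R axis k 1) - partial k f (y + s *\<^sub>R axis k 1))) (at s)"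
      using inb[OF s, of h] inb[OF s, of 0] h
      by (intro DERIV_diff has_real_derivative_along_axis d) (auto simp: add_ac)
  qed
  then obtain s where s: "0 < s" "s < h" and es: "?\<phi> h - ?\<phi> 0 = h *
      (partial k f ((y + h *\<^sub>R axis l 1) + s *\<^sub>R axis k 1) - partial k f (y + s *\<^sub>R axis k 1))" by auto
  let ?\<psi> = "\<lambda>t. partial k f ((y + s *\<^sub>R axis k 1) + t *\<^sub>R axis l 1)"
  have "\<exists>t>0. t < h \<and> ?\<psi> h - ?\<psi> 0 = (h - 0) * partial l (partial k f) ((y + s *\<^sub>R axis k 1) + t *\<^sub>R axis l 1)"
  proof (rule MVT2[OF h(1)])
    fix t assume "0 \<le> t" "t \<le> h"
    then show "(?\<psi> has_real_derivative partial l (partial k f) ((y + s *\<^sub>R axis k 1) + t *\<^sub>R axis l 1)) (at t)"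
      using inb[of s t] s by (intro has_real_derivative_along_axis d) auto
  qed
  then obtain t where t: "0 < t" "t < h" and et:
    "?\<psi> h - ?\<psi> 0 = h * partial l (partial k f) ((y + s *\<^sub>R axis k 1) + t *\<^sub>R axis l 1)" by auto
  have "dist y ((y + s *\<^sub>R axis k 1) + t *\<^sub>R axis l 1) \<le> 2 * h" using near[of s t] s t by simp
  moreover have "f (y + h *\<^sub>R axis k 1 + h *\<^sub>R axis l 1) - f (y + h *\<^sub>R axis k 1) - f (y + h *\<^sub>R axis l 1) + f y
      = h * (h * partial l (partial k f) ((y + s *\<^sub>R axis k 1) + t *\<^sub>R axis l 1))"
    unfolding et[symmetric] using es by (simp add: add_ac)
  ultimately show ?thesis by (metis mult.assoc)
qed

lemma partial_commute:
  fixes f :: "real^'n::finite \<Rightarrow> real"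
  assumes "smooth_on S f" "open S" "y \<in> S"
  shows "partial k (partial l f) y = partial l (partial k f) y"
proof (rule ccontr)
  assume ne: "\<not> ?thesis"
  obtain r where r: "r > 0" "ball y r \<subseteq> S" using assms open_contains_ball by blast
  have sm: "smooth_on (ball y r) f" using assms(1) r(2) smooth_on_mono by blast
  let ?d = "\<lambda>k l. partial l (partial k f)"
  \<comment> \<open>Half the gap between the two mixed partials: values that are closer than this to
    their respective limits cannot coincide.\<close>
  define e where "e = \<bar>?d k l y - ?d l k y\<bar> / 2"
  have e: "e > 0" using ne by (simp add: e_def)
  have "isCont (?d k l) y" for k l
    using smooth_on_continuous_on[OF smooth_on_partial[OF smooth_on_partial[OF sm]]] r(1)
    by (simp add: continuous_on_eq_continuous_at)
  then have "\<exists>\<delta>>0. \<forall>z. dist y z < \<delta> \<longrightarrow> dist (?d k l y) (?d k l z) < e" for k l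
    using e unfolding continuous_at_eps_delta by (metis dist_commute)
  then obtain d1 d2 where d: "d1 > 0" "\<And>z. dist y z < d1 \<Longrightarrow> dist (?d k l y) (?d k l z) < e"
    "d2 > 0" "\<And>z. dist y z < d2 \<Longrightarrow> dist (?d l k y) (?d l k z) < e" by metis
  define h where "h = min r (min d1 d2) / 3"
  have h: "0 < h" "2 * h < r" "2 * h < d1" "2 * h < d2" using r d by (auto simp: h_def)
  obtain z where z: "dist y z \<le> 2 * h" "f (y + h *\<^sub>R axis k 1 + h *\<^sub>R axis l 1) - f (y + h *\<^sub>R axis k 1) - f (y + h *\<^sub>R axis l 1) + f y
    = h * h * ?d k l z" using second_difference_mvt[OF sm h(1,2)] by blast
  obtain w where w: "dist y w \<le> 2 * h" "f (y + h *\<^sub>R axis l 1 + h *\<^sub>R axis k 1) - f (y + h *\<^sub>R axis l 1) - f (y + h *\<^sub>R axis k 1) + f y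
    = h * h * ?d l k w" using second_difference_mvt[OF sm h(1,2)] by blast
  have "y + h *\<^sub>R axis l 1 + h *\<^sub>R axis k 1 = y + h *\<^sub>R axis k 1 + h *\<^sub>R axis l 1" by simp
  then have "h * h * ?d k l z = h * h * ?d l k w" unfolding z(2)[symmetric] w(2)[symmetric] by (simp add: add.commute add.left_commute)
  then have "?d k l z = ?d l k w" using h by simp
  moreover have "dist (?d k l y) (?d k l z) < e" "dist (?d l k y) (?d l k w) < e"
    using d z(1) w(1) h by auto
  ultimately show False unfolding e_def dist_real_def by argo
qed

section \<open>Sums over multi-indices\<close>

lemma multi_indices_0 [simp]: "multi_indices 0 = {[]}"
  by (auto simp: multi_indices_def)

lemma multi_indices_Suc: "multi_indices (Suc m) = (\<lambda>(i, I). i # I) ` (UNIV \<times> multi_indices m)"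
  by (auto simp: multi_indices_def length_Suc_conv image_iff)

lemma finite_multi_indices [simp]: "finite (multi_indices m :: 'n::finite list set)"
  by (induction m) (simp_all add: multi_indices_Suc)

lemma sum_multi_indices_Suc:
  "(\<Sum>I\<in>multi_indices (Suc m). f I) = (\<Sum>i::'n::finite\<in>UNIV. \<Sum>I\<in>multi_indices m. f (i # I))"
  unfolding multi_indices_Suc
  by (subst sum.reindex) (auto simp: inj_on_def sum.cartesian_product case_prod_unfold)

text \<open>Both transformation laws are the action of one matrix on every index. The recursion
  \<open>transform_Cons\<close> over the index list then replaces manipulations of sums over
  multi-indices.\<close>

definition transform :: "real^'n::finite^'n \<Rightarrow> ('n list \<Rightarrow> real) \<Rightarrow> 'n list \<Rightarrow> real" where
  "transform M t J = (\<Sum>I\<in>multi_indices (length J). (\<Prod>a<length J. M $ (J ! a) $ (I ! a)) * t I)"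

lemma contra_transform_eq: "contra_transform c d x = transform (jacobian c d x)"
  by (simp add: contra_transform_def transform_def fun_eq_iff)

lemma cov_transform_eq: "cov_transform c d x = transform (transpose (jacobian d c x))"
  by (simp add: cov_transform_def transform_def fun_eq_iff transpose_def)

lemma transform_Nil [simp]: "transform M t [] = t []"
  by (simp add: transform_def)

lemma transform_Cons: "transform M t (j # J) = (\<Sum>i\<in>UNIV. M $ j $ i * transform M (\<lambda>I. t (i # I)) J)"
  by (simp add: transform_def sum_multi_indices_Suc prod.lessThan_Suc_shift sum_distrib_left mult.assoc
      del: prod.lessThan_Suc)

lemma transform_sum:
  "transform M (\<lambda>I. \<Sum>k\<in>A. f k * t k I) J = (\<Sum>k\<in>A. f k * transform M (t k) J)"
  unfolding transform_def sum_distrib_left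
  by (subst sum.swap) (simp add: mult_ac)

lemma transform_cong:
  "(\<And>I. I \<in> multi_indices (length J) \<Longrightarrow> t I = u I) \<Longrightarrow> transform M t J = transform M u J"
  by (simp add: transform_def)

lemma transform_scaled:
  "transform M (\<lambda>I. r * t I) J = r * transform M t J"
  by (simp add: transform_def sum_distrib_left mult_ac)

lemma transform_transform: "transform M (transform N t) J = transform (M ** N) t J"
proof (induction J arbitrary: t)
  case (Cons j J)
  have "transform M (transform N t) (j # J) =
      (\<Sum>i\<in>UNIV. M $ j $ i * (\<Sum>k\<in>UNIV. N $ i $ k * transform (M ** N) (\<lambda>I. t (k # I)) J))"
    by (simp add: transform_Cons transform_sum Cons.IH)
  also have "\<dots> = (\<Sum>k\<in>UNIV. \<Sum>i\<in>UNIV. M $ j $ i * N $ i $ k * transform (M ** N) (\<lambda>I. t (k # I)) J)"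
    by (subst sum.swap) (simp add: sum_distrib_left mult.assoc)
  finally show ?case by (simp add: transform_Cons matrix_matrix_mult_def sum_distrib_right)
qed simp

text \<open>Besides the identity, \<open>r = 1\<close>, the case needed is a dilation: here
  originate the weights \<open>r ^ p\<close> and \<open>(1 / r) ^ 4\<close> in
  \<open>tensor_scaled_metric\<close>.\<close>

lemma transform_mat: "transform (mat r) t J = r ^ length J * t J"
proof (induction J arbitrary: t)
  case (Cons j J)
  have "transform (mat r) t (j # J) = (\<Sum>i\<in>UNIV. if j = i then r * (r ^ length J * t (i # J)) else 0)"
    unfolding transform_Cons Cons.IH by (rule sum.cong) (auto simp: mat_def)
  then show ?case by simp
qed simp

lemma gram_transform: "gram (transform M t) = M ** gram t ** transpose M"
  by (simp add: gram_def vec_eq_iff transform_Cons matrix_matrix_mult_def transpose_def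
      sum_distrib_left sum_distrib_right mult_ac, subst sum.swap, simp)

section \<open>Charts\<close>

lemma multi_indices_length: "J \<in> multi_indices m \<longleftrightarrow> length J = m"
  by (simp add: multi_indices_def)

lemma cov_tensors_iff:
  "t \<in> cov_tensors \<A> x m \<longleftrightarrow> (\<forall>c I. c \<notin> charts_at \<A> x \<or> length I \<noteq> m \<longrightarrow> t c I = 0) \<and>
    (\<forall>c d J. c \<in> charts_at \<A> x \<longrightarrow> d \<in> charts_at \<A> x \<longrightarrow> length J = m \<longrightarrow>
      t d J = transform (transpose (jacobian d c x)) (t c) J)"
  unfolding cov_tensors_def normalised_def cov_transform_eq Ball_def multi_indices_length mem_Collect_eq by metis

lemma contra_tensors_iff:
  "t \<in> contra_tensors \<A> x m \<longleftrightarrow> (\<forall>c I. c \<notin> charts_at \<A> x \<or> length I \<noteq> m \<longrightarrow> t c I = 0) \<and>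
    (\<forall>c d J. c \<in> charts_at \<A> x \<longrightarrow> d \<in> charts_at \<A> x \<longrightarrow> length J = m \<longrightarrow>
      t d J = transform (jacobian c d x) (t c) J)"
  unfolding contra_tensors_def normalised_def contra_transform_eq Ball_def multi_indices_length mem_Collect_eq by metis

lemmas cov_tensorsD = cov_tensors_iff[THEN iffD1, THEN conjunct1, rule_format]
  cov_tensors_iff[THEN iffD1, THEN conjunct2, rule_format]
lemmas contra_tensorsD = contra_tensors_iff[THEN iffD1, THEN conjunct1, rule_format]
  contra_tensors_iff[THEN iffD1, THEN conjunct2, rule_format]

lemma is_chart_open_image:
  assumes "is_chart X c" "openin X U"
  shows "open (cmap c ` (cdom c \<inter> U))"
proof -
  have "open_map (subtopology X (cdom c)) (top_of_set (cmap c ` cdom c)) (cmap c)"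
    using assms(1) homeomorphic_imp_open_map by (auto simp: is_chart_def)
  then have "openin (top_of_set (cmap c ` cdom c)) (cmap c ` (cdom c \<inter> U))"
    using assms(2) unfolding open_map_def by (simp add: openin_subtopology_Int2)
  then show ?thesis
    using assms(1) openin_open_trans by (auto simp: is_chart_def)
qed

locale manifold =
  fixes X :: "'a topology" and \<A> :: "('a, 'n::finite) chart set"
  assumes manifold: "smooth_manifold X \<A>"
begin

lemma atlas_is_chart: "c \<in> \<A> \<Longrightarrow> is_chart X c"
  using manifold by (simp add: smooth_manifold_def)

lemma atlas_compatible: "c \<in> \<A> \<Longrightarrow> d \<in> \<A> \<Longrightarrow> compatible c d"
  using manifold by (simp add: smooth_manifold_def)

lemma atlas_maximal: "is_chart X c \<Longrightarrow> (\<And>d. d \<in> \<A> \<Longrightarrow> compatible c d) \<Longrightarrow> c \<in> \<A>"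
  using manifold unfolding smooth_manifold_def by blast

lemma charts_at_atlas: "c \<in> charts_at \<A> x \<Longrightarrow> c \<in> \<A>" "c \<in> charts_at \<A> x \<Longrightarrow> x \<in> cdom c"
  by (auto simp: charts_at_def)

lemma charts_atI: "c \<in> \<A> \<Longrightarrow> x \<in> cdom c \<Longrightarrow> c \<in> charts_at \<A> x"
  by (auto simp: charts_at_def)

lemma openin_cdom: "c \<in> \<A> \<Longrightarrow> openin X (cdom c)"
  using atlas_is_chart by (auto simp: is_chart_def)

lemma cdom_subset: "c \<in> \<A> \<Longrightarrow> cdom c \<subseteq> topspace X"
  using openin_cdom openin_subset by blast

lemma topspace_cdom: "c \<in> \<A> \<Longrightarrow> topspace (subtopology X (cdom c)) = cdom c"
  using cdom_subset[of c] by auto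

lemma inj_on_cmap: "c \<in> \<A> \<Longrightarrow> inj_on (cmap c) (cdom c)"
  using atlas_is_chart[of c] topspace_cdom[of c]
    homeomorphic_imp_injective_map[of "subtopology X (cdom c)" "top_of_set (cmap c ` cdom c)" "cmap c"]
  by (simp add: is_chart_def)

lemma cinv_cmap [simp]: "c \<in> \<A> \<Longrightarrow> x \<in> cdom c \<Longrightarrow> cinv c (cmap c x) = x"
  by (simp add: cinv_def inj_on_cmap)

lemma cmap_cinv: "c \<in> \<A> \<Longrightarrow> y \<in> cmap c ` cdom c \<Longrightarrow> cmap c (cinv c y) = y"
  by (simp add: cinv_def f_inv_into_f)

lemma cinv_in: "y \<in> cmap c ` cdom c \<Longrightarrow> cinv c y \<in> cdom c"
  by (simp add: cinv_def inv_into_into)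

lemma open_cmap_image: "c \<in> \<A> \<Longrightarrow> openin X U \<Longrightarrow> open (cmap c ` (cdom c \<inter> U))"
  by (rule is_chart_open_image[OF atlas_is_chart])

lemma open_cmap_cdom: "c \<in> \<A> \<Longrightarrow> open (cmap c ` cdom c)"
  using atlas_is_chart by (auto simp: is_chart_def)

lemma smooth_transition:
  "c \<in> \<A> \<Longrightarrow> d \<in> \<A> \<Longrightarrow> smooth_on (cmap c ` (cdom c \<inter> cdom d)) (\<lambda>y. cmap d (cinv c y))"
  using atlas_compatible[of c d] by (simp add: compatible_def comp_def)

lemma open_cmap_Int: "c \<in> \<A> \<Longrightarrow> d \<in> \<A> \<Longrightarrow> open (cmap c ` (cdom c \<inter> cdom d))"
  by (simp add: open_cmap_image openin_cdom)

lemma jacobian_self: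
  assumes "c \<in> charts_at \<A> x"
  shows "jacobian c c x = mat 1"
proof -
  have c: "c \<in> \<A>" "x \<in> cdom c" using assms charts_at_atlas by auto
  have "partial i (\<lambda>y. cmap c (cinv c y) $ j) (cmap c x) = partial i (\<lambda>y. y $ j) (cmap c x)" for i j
    by (rule partial_cong_open[OF open_cmap_cdom[OF c(1)]]) (use c in \<open>auto simp: cmap_cinv\<close>)
  then show ?thesis by (simp add: jacobian_def vec_eq_iff mat_def)
qed

lemma jacobian_chain:
  assumes "c \<in> charts_at \<A> x" "d \<in> charts_at \<A> x" "e \<in> charts_at \<A> x"
  shows "jacobian c e x = jacobian d e x ** jacobian c d x"
proof -
  have A: "c \<in> \<A>" "x \<in> cdom c" "d \<in> \<A>" "x \<in> cdom d" "e \<in> \<A>" "x \<in> cdom e"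
    using assms charts_at_atlas by auto
  let ?S = "cmap c ` (cdom c \<inter> (cdom d \<inter> cdom e))"
  have S: "open ?S" "cmap c x \<in> ?S"
    using A by (auto intro!: open_cmap_image openin_cdom openin_Int)
  have "partial i (\<lambda>y. cmap e (cinv c y) $ j) (cmap c x) =
      partial i (\<lambda>y. cmap e (cinv d (cmap d (cinv c y))) $ j) (cmap c x)" for i j
    by (rule partial_cong_open[OF S]) (use A in auto)
  also have "\<dots> i j = (\<Sum>m\<in>UNIV. partial i (\<lambda>y. cmap d (cinv c y) $ m) (cmap c x) *
      partial m (\<lambda>y. cmap e (cinv d y) $ j) (cmap d (cinv c (cmap c x))))" for i j
  proof (rule partial_compose[where g="\<lambda>y. cmap d (cinv c y)"])
    show "(\<lambda>y. cmap e (cinv d y) $ j) differentiable at (cmap d (cinv c (cmap c x)))"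
      using A by (intro smooth_on_differentiable[OF smooth_on_vec_nth[OF smooth_transition]]
          open_cmap_image openin_cdom) auto
    show "(\<lambda>y. cmap d (cinv c y)) differentiable at (cmap c x)"
      using A by (intro smooth_on_differentiable[OF smooth_transition]) auto
  qed
  finally show ?thesis
    using A by (simp add: jacobian_def vec_eq_iff matrix_matrix_mult_def mult.commute)
qed

lemma jacobian_inverse:
  assumes "c \<in> charts_at \<A> x" "d \<in> charts_at \<A> x"
  shows "jacobian d c x ** jacobian c d x = mat 1"
  using jacobian_chain[OF assms(1,2,1)] jacobian_self[OF assms(1)] by simp

lemma smooth_on_jacobian:
  assumes "c \<in> \<A>" "d \<in> \<A>"
  shows "smooth_on (cmap c ` (cdom c \<inter> cdom d)) (\<lambda>y. jacobian c d (cinv c y) $ j $ i)"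
proof -
  have o: "open (cmap c ` (cdom c \<inter> cdom d))" by (rule open_cmap_Int[OF assms])
  have "smooth_on (cmap c ` (cdom c \<inter> cdom d)) (partial i (\<lambda>y. cmap d (cinv c y) $ j))"
    by (intro smooth_on_partial smooth_on_vec_nth smooth_transition assms o)
  then show ?thesis
    by (rule smooth_on_cong[OF o, rotated]) (use assms in \<open>auto simp: jacobian_def\<close>)
qed

end

section \<open>Diffeomorphisms\<close>

lemma fst_pull_chart [simp]: "cdom (pull_chart U \<tau> d) = U \<inter> \<tau> -` cdom d"
  and snd_pull_chart [simp]: "cmap (pull_chart U \<tau> d) = cmap d \<circ> \<tau>"
  by (simp_all add: pull_chart_def)

context manifold
begin

lemma diffeo_bij:
  assumes "diffeo X \<A> U V \<tau>"
  shows "inj_on \<tau> U" "\<tau> ` U = V" "U \<subseteq> topspace X" "V \<subseteq> topspace X" "openin X U" "openin X V"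
proof -
  show o: "openin X U" "openin X V" using assms by (auto simp: diffeo_def)
  show s: "U \<subseteq> topspace X" "V \<subseteq> topspace X" using o openin_subset by auto
  have h: "homeomorphic_map (subtopology X U) (subtopology X V) \<tau>" using assms by (simp add: diffeo_def)
  have t: "topspace (subtopology X U) = U" "topspace (subtopology X V) = V" using s by auto
  show "inj_on \<tau> U" using homeomorphic_imp_injective_map[OF h] t by simp
  show "\<tau> ` U = V" using homeomorphic_imp_surjective_map[OF h] t by simp
qed

lemma diffeo_openin_image:
  assumes "diffeo X \<A> U V \<tau>" "openin X W" "W \<subseteq> U"
  shows "openin X (\<tau> ` W)"
proof -
  have "open_map (subtopology X U) (subtopology X V) \<tau>"
    using assms(1) homeomorphic_imp_open_map by (auto simp: diffeo_def)
  moreover have "openin (subtopology X U) W"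
    using assms by (simp add: openin_open_subtopology diffeo_bij(5)[OF assms(1)])
  ultimately have "openin (subtopology X V) (\<tau> ` W)" by (simp add: open_map_def)
  then show ?thesis using diffeo_bij(6)[OF assms(1)] openin_open_subtopology by blast
qed

lemma diffeo_openin_vimage:
  assumes "diffeo X \<A> U V \<tau>" "openin X W"
  shows "openin X (U \<inter> \<tau> -` W)"
proof -
  note b = diffeo_bij[OF assms(1)]
  have "continuous_map (subtopology X U) (subtopology X V) \<tau>"
    using assms(1) homeomorphic_imp_continuous_map by (auto simp: diffeo_def)
  moreover have "openin (subtopology X V) (V \<inter> W)"
    using assms(2) b(6) openin_Int[of X V W] by (simp add: openin_open_subtopology)
  ultimately have "openin (subtopology X U) {x \<in> topspace (subtopology X U). \<tau> x \<in> V \<inter> W}"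
    by (rule openin_continuous_map_preimage)
  moreover have "{x \<in> topspace (subtopology X U). \<tau> x \<in> V \<inter> W} = U \<inter> \<tau> -` W"
    using b(2,3) by auto
  ultimately show ?thesis using b(5) openin_open_subtopology by force
qed

section \<open>Charts, tensors and jets transported by a diffeomorphism\<close>

lemma pull_chart_image:
  assumes "diffeo X \<A> U V \<tau>"
  shows "cmap (pull_chart U \<tau> d) ` (cdom (pull_chart U \<tau> d) \<inter> W) = cmap d ` (cdom d \<inter> \<tau> ` (U \<inter> W))"
  by (auto simp: image_iff)

lemma cinv_pull_chart:
  assumes "diffeo X \<A> U V \<tau>" "d \<in> \<A>" "x \<in> U" "\<tau> x \<in> cdom d"
  shows "cinv (pull_chart U \<tau> d) (cmap d (\<tau> x)) = x"
proof -
  have "inj_on (cmap d \<circ> \<tau>) (U \<inter> \<tau> -` cdom d)"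
    using diffeo_bij(1)[OF assms(1)] inj_on_cmap[OF assms(2)] by (auto simp: inj_on_def)
  then show ?thesis
    using assms inv_into_f_f[of "cmap d \<circ> \<tau>" "U \<inter> \<tau> -` cdom d" x] by (simp add: cinv_def)
qed

lemma is_chart_pull_chart:
  assumes D: "diffeo X \<A> U V \<tau>" and d: "d \<in> \<A>"
  shows "is_chart X (pull_chart U \<tau> d)"
proof -
  note b = diffeo_bij[OF D]
  let ?e = "pull_chart U \<tau> d"
  have im: "cmap ?e ` cdom ?e = cmap d ` (cdom d \<inter> V)"
    using pull_chart_image[OF D, of d UNIV] b(2) by simp
  have "homeomorphic_map (subtopology (subtopology X U) (cdom ?e)) (subtopology (subtopology X V) (cdom d \<inter> V)) \<tau>"
    using D b by (rule_tac homeomorphic_map_subtopologies) (auto simp: diffeo_def)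
  then have 1: "homeomorphic_map (subtopology X (cdom ?e)) (subtopology X (cdom d \<inter> V)) \<tau>"
    by (simp add: subtopology_subtopology Int_ac)
  have "homeomorphic_map (subtopology (subtopology X (cdom d)) (cdom d \<inter> V))
      (subtopology (top_of_set (cmap d ` cdom d)) (cmap d ` (cdom d \<inter> V))) (cmap d)"
    using atlas_is_chart[OF d] cdom_subset[OF d]
    by (rule_tac homeomorphic_map_subtopologies) (auto simp: is_chart_def)
  then have 2: "homeomorphic_map (subtopology X (cdom d \<inter> V)) (top_of_set (cmap d ` (cdom d \<inter> V))) (cmap d)"
    by (simp add: subtopology_subtopology Int_ac image_Int_subset inf.absorb2 image_mono)
  have "homeomorphic_map (subtopology X (cdom ?e)) (top_of_set (cmap d ` (cdom d \<inter> V))) (cmap d \<circ> \<tau>)"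
    by (rule homeomorphic_map_compose[OF 1 2])
  moreover have "openin X (cdom ?e)" using diffeo_openin_vimage[OF D openin_cdom[OF d]] by simp
  moreover have "open (cmap d ` (cdom d \<inter> V))" using open_cmap_image[OF d b(6)] .
  ultimately show ?thesis unfolding is_chart_def im by simp
qed

text \<open>\<open>push_tensor\<close> reads a tensor in the pulled-back chart, and a normalised
  tensor has only zero components in a chart outside the atlas. Compatibility with the other charts
  is exactly smoothness of \<tau> and of its inverse; maximality of the atlas does the rest.\<close>

lemma pull_chart_in_atlas:
  assumes D: "diffeo X \<A> U V \<tau>" and d: "d \<in> \<A>"
  shows "pull_chart U \<tau> d \<in> \<A>"
proof (rule atlas_maximal[OF is_chart_pull_chart[OF assms]])
  note b = diffeo_bij[OF D]
  let ?e = "pull_chart U \<tau> d"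
  fix c assume c: "c \<in> \<A>"
  show "compatible ?e c"
    unfolding compatible_def
  proof
    have eq: "cmap ?e ` (cdom ?e \<inter> cdom c) = cmap d ` (cdom d \<inter> V \<inter> inv_into U \<tau> -` cdom c)"
      unfolding pull_chart_image[OF D] using b(1,2) by (auto intro!: imageI)
    have "smooth_on (cmap ?e ` (cdom ?e \<inter> cdom c)) (cmap c \<circ> inv_into U \<tau> \<circ> cinv d)"
      unfolding eq using D c d by (auto simp: diffeo_def smooth_between_def)
    then show "smooth_on (cmap ?e ` (cdom ?e \<inter> cdom c)) (cmap c \<circ> cinv ?e)"
    proof (rule smooth_on_cong[rotated 2])
      show "open (cmap ?e ` (cdom ?e \<inter> cdom c))"
        by (rule is_chart_open_image[OF is_chart_pull_chart[OF assms] openin_cdom[OF c]])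
      fix y assume "y \<in> cmap ?e ` (cdom ?e \<inter> cdom c)"
      then obtain x where "y = cmap d (\<tau> x)" "x \<in> U" "\<tau> x \<in> cdom d" by auto
      then show "(cmap c \<circ> inv_into U \<tau> \<circ> cinv d) y = (cmap c \<circ> cinv ?e) y"
        using cinv_pull_chart[OF D d] d b(1) by simp
    qed
    have "smooth_on (cmap c ` (cdom c \<inter> U \<inter> \<tau> -` cdom d)) (cmap d \<circ> \<tau> \<circ> cinv c)"
      using D c d by (auto simp: diffeo_def smooth_between_def)
    then show "smooth_on (cmap c ` (cdom ?e \<inter> cdom c)) (cmap ?e \<circ> cinv c)"
      by (simp add: Int_ac)
  qed
qed

lemma pull_chart_charts_at:
  assumes "diffeo X \<A> U V \<tau>" "x \<in> U" "d \<in> charts_at \<A> (\<tau> x)"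
  shows "pull_chart U \<tau> d \<in> charts_at \<A> x"
  using assms pull_chart_in_atlas by (auto simp: charts_at_def)

lemma jacobian_pull_chart:
  assumes D: "diffeo X \<A> U V \<tau>" and x: "x \<in> U" and c: "c \<in> charts_at \<A> (\<tau> x)" and d: "d \<in> charts_at \<A> (\<tau> x)"
  shows "jacobian (pull_chart U \<tau> c) (pull_chart U \<tau> d) x = jacobian c d (\<tau> x)"
proof -
  let ?e = "pull_chart U \<tau> c"
  have c': "c \<in> \<A>" "\<tau> x \<in> cdom c" using c charts_at_atlas by auto
  have "open (cmap ?e ` cdom ?e)" using pull_chart_in_atlas[OF D c'(1)] open_cmap_cdom by blast
  moreover have "cmap c (\<tau> x) \<in> cmap ?e ` cdom ?e" using x c' by auto
  moreover have "cmap d (\<tau> (cinv ?e y)) = cmap d (cinv c y)" if "y \<in> cmap ?e ` cdom ?e" for y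
    using that cinv_pull_chart[OF D c'(1)] c'(1) by auto
  ultimately have "partial i (\<lambda>y. cmap d (\<tau> (cinv ?e y)) $ j) (cmap c (\<tau> x)) =
      partial i (\<lambda>y. cmap d (cinv c y) $ j) (cmap c (\<tau> x))" for i j
    by (intro partial_cong_open) auto
  then show ?thesis by (simp add: jacobian_def)
qed

lemma push_tensor_cov:
  assumes D: "diffeo X \<A> U V \<tau>" and x: "x \<in> U" and t: "t \<in> cov_tensors \<A> x m"
  shows "push_tensor \<A> U \<tau> x t \<in> cov_tensors \<A> (\<tau> x) m"
  unfolding cov_tensors_iff
proof (intro conjI allI impI)
  fix c and I :: "'n list" assume "c \<notin> charts_at \<A> (\<tau> x) \<or> length I \<noteq> m"
  then show "push_tensor \<A> U \<tau> x t c I = 0"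
    using cov_tensorsD(1)[OF t, of "pull_chart U \<tau> c" I] by (auto simp: push_tensor_def)
next
  fix c d and J :: "'n list" assume A: "c \<in> charts_at \<A> (\<tau> x)" "d \<in> charts_at \<A> (\<tau> x)" "length J = m"
  show "push_tensor \<A> U \<tau> x t d J =
      transform (transpose (jacobian d c (\<tau> x))) (push_tensor \<A> U \<tau> x t c) J"
    using cov_tensorsD(2)[OF t pull_chart_charts_at[OF D x A(1)] pull_chart_charts_at[OF D x A(2)] A(3)] A
    by (simp add: push_tensor_def jacobian_pull_chart[OF D x])
qed

lemma push_tensor_metric:
  assumes D: "diffeo X \<A> U V \<tau>" and x: "x \<in> U" and t: "t \<in> metrics_at \<A> \<sigma> x"
  shows "push_tensor \<A> U \<tau> x t \<in> metrics_at \<A> \<sigma> (\<tau> x)"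
proof -
  have "(\<forall>i j. push_tensor \<A> U \<tau> x t c [i, j] = push_tensor \<A> U \<tau> x t c [j, i]) \<and>
      has_signature \<sigma> (gram (push_tensor \<A> U \<tau> x t c))" if c: "c \<in> charts_at \<A> (\<tau> x)" for c
  proof -
    have "push_tensor \<A> U \<tau> x t c = t (pull_chart U \<tau> c)"
      using c by (simp add: push_tensor_def fun_eq_iff)
    then show ?thesis using t pull_chart_charts_at[OF D x c] by (simp add: metrics_at_def)
  qed
  then show ?thesis using t push_tensor_cov[OF D x] by (simp add: metrics_at_def)
qed

lemma push_field_at:
  assumes "diffeo X \<A> U V \<tau>" "x \<in> U"
  shows "push_field \<A> U \<tau> g (\<tau> x) = push_tensor \<A> U \<tau> x (g x)"
  using diffeo_bij(1)[OF assms(1)] assms(2) by (simp add: push_field_def)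

lemma components_push_field:
  assumes D: "diffeo X \<A> U V \<tau>" and d: "d \<in> \<A>" and y: "y \<in> cmap d ` (cdom d \<inter> V)"
  shows "components d (push_field \<A> U \<tau> g) I y = components (pull_chart U \<tau> d) g I y"
proof -
  obtain x where x: "x \<in> U" "y = cmap d (\<tau> x)" "\<tau> x \<in> cdom d" using y diffeo_bij(2)[OF D] by auto
  then show ?thesis
    using d push_field_at[OF D x(1)] cinv_pull_chart[OF D d x(1,3)]
    by (simp add: components_def push_tensor_def charts_at_def)
qed

lemma metric_on_push_field:
  assumes D: "diffeo X \<A> U V \<tau>" and W: "W \<subseteq> U" "openin X W" and g: "metric_on \<A> \<sigma> W g"
  shows "metric_on \<A> \<sigma> (\<tau> ` W) (push_field \<A> U \<tau> g)"
  unfolding metric_on_def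
proof (intro conjI ballI allI)
  fix z assume "z \<in> \<tau> ` W"
  then obtain x where x: "x \<in> W" "x \<in> U" "z = \<tau> x" using W by auto
  then show "push_field \<A> U \<tau> g z \<in> metrics_at \<A> \<sigma> z"
    using g push_field_at[OF D x(2)] push_tensor_metric[OF D x(2)] by (simp add: metric_on_def)
next
  fix d i j assume d: "d \<in> \<A>"
  let ?e = "pull_chart U \<tau> d"
  have eq: "cmap ?e ` (cdom ?e \<inter> W) = cmap d ` (cdom d \<inter> \<tau> ` W)"
    using pull_chart_image[OF D, of d W] W by (simp add: Int_absorb1)
  have "smooth_on (cmap ?e ` (cdom ?e \<inter> W)) (components ?e g [i, j])"
    using g pull_chart_in_atlas[OF D d] by (simp only: metric_on_def)
  then show "smooth_on (cmap d ` (cdom d \<inter> \<tau> ` W)) (components d (push_field \<A> U \<tau> g) [i, j])"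
    unfolding eq
  proof (rule smooth_on_cong[rotated 2])
    show "open (cmap d ` (cdom d \<inter> \<tau> ` W))"
      by (rule open_cmap_image[OF d diffeo_openin_image[OF D W(2,1)]])
    fix y assume "y \<in> cmap d ` (cdom d \<inter> \<tau> ` W)"
    then show "components ?e g [i, j] y = components d (push_field \<A> U \<tau> g) [i, j] y"
      using W(1) diffeo_bij(2)[OF D] by (intro components_push_field[OF D d, symmetric]) auto
  qed
qed

lemma metric_on_mono:
  assumes "metric_on \<A> \<sigma> U g" "W \<subseteq> U"
  shows "metric_on \<A> \<sigma> W g"
proof -
  have "smooth_on (cmap c ` (cdom c \<inter> W)) (components c g [i, j])" if "c \<in> \<A>" for c i j
  proof (rule smooth_on_mono)
    show "smooth_on (cmap c ` (cdom c \<inter> U)) (components c g [i, j])"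
      using assms(1) that by (simp only: metric_on_def)
  qed (use assms(2) in auto)
  moreover have "g x \<in> metrics_at \<A> \<sigma> x" if "x \<in> W" for x
    using assms that unfolding metric_on_def by (meson subsetD)
  ultimately show ?thesis unfolding metric_on_def by meson
qed

lemma metric_near_push_field:
  assumes D: "diffeo X \<A> U V \<tau>" and x: "x \<in> U" and g: "metric_near X \<A> \<sigma> x g"
  shows "metric_near X \<A> \<sigma> (\<tau> x) (push_field \<A> U \<tau> g)"
proof -
  obtain W where W: "openin X W" "x \<in> W" "metric_on \<A> \<sigma> W g" using g by (auto simp: metric_near_def)
  have "openin X (W \<inter> U)" using W(1) diffeo_bij(5)[OF D] by (rule openin_Int)
  then show ?thesis unfolding metric_near_def
    using W(2) x
    by (intro exI[of _ "\<tau> ` (W \<inter> U)"] conjI diffeo_openin_image[OF D] metric_on_push_field[OF D]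
        metric_on_mono[OF W(3)]) auto
qed

lemma second_partials_cong:
  assumes "open S" "cmap c x \<in> S" "cmap c x = cmap d x'"
    and "\<And>y. y \<in> S \<Longrightarrow> components c g [i, j] y = components d h [i, j] y"
  shows "partial k (components c g [i, j]) (cmap c x) = partial k (components d h [i, j]) (cmap d x')"
    and "second_partials c g x i j k l = second_partials d h x' i j k l"
proof -
  have 1: "partial k (components c g [i, j]) y = partial k (components d h [i, j]) y" if "y \<in> S" for y
    by (rule partial_cong_open[OF assms(1) that assms(4)])
  then show "partial k (components c g [i, j]) (cmap c x) = partial k (components d h [i, j]) (cmap d x')"
    using assms(2,3) by simp
  show "second_partials c g x i j k l = second_partials d h x' i j k l"
    unfolding second_partials_def assms(3)[symmetric]
    by (rule partial_cong_open[OF assms(1,2) 1])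
qed

text \<open>No Jacobian appears: near \<open>cmap d (\<tau> x)\<close> the components of the
  push-forward in \<open>d\<close> are literally the same functions as those of \<open>g\<close> in
  the pulled-back chart (\<open>components_push_field\<close>), so all their derivatives
  agree.\<close>

lemma jet_coords_push_field:
  assumes D: "diffeo X \<A> U V \<tau>" and x: "x \<in> U" and d: "d \<in> charts_at \<A> (\<tau> x)"
  shows "jet_coords d (\<tau> x) (push_field \<A> U \<tau> g) = jet_coords (pull_chart U \<tau> d) x g"
proof -
  have d': "d \<in> \<A>" "\<tau> x \<in> cdom d" using d charts_at_atlas by auto
  have S: "open (cmap d ` (cdom d \<inter> V))" "cmap d (\<tau> x) \<in> cmap d ` (cdom d \<inter> V)"
    using open_cmap_image[OF d'(1)] d' x diffeo_bij[OF D] by auto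
  note E = second_partials_cong[OF S, of "pull_chart U \<tau> d" x, OF _ components_push_field[OF D d'(1)]]
  have "push_field \<A> U \<tau> g (\<tau> x) d = g x (pull_chart U \<tau> d)"
    using d by (simp add: push_field_at[OF D x] push_tensor_def fun_eq_iff)
  then show ?thesis using E by (simp add: jet_coords_def)
qed

section \<open>Diffeomorphisms that are linear in charts\<close>

lemma homeomorphic_maps_chart:
  assumes "c \<in> \<A>"
  shows "homeomorphic_maps (subtopology X (cdom c)) (top_of_set (cmap c ` cdom c)) (cmap c) (cinv c)"
proof -
  obtain g where g: "homeomorphic_maps (subtopology X (cdom c)) (top_of_set (cmap c ` cdom c)) (cmap c) g"
    using atlas_is_chart[OF assms] by (auto simp: is_chart_def homeomorphic_map_maps)
  have "g (cmap c x) = x" if "x \<in> cdom c" for x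
    using g that topspace_cdom[OF assms] by (simp add: homeomorphic_maps_def)
  then show ?thesis
    using assms by (intro homeomorphic_maps_eq[OF g]) auto
qed

lemma continuous_map_cmap: "c \<in> \<A> \<Longrightarrow> continuous_map (subtopology X (cdom c)) euclidean (cmap c)"
  using homeomorphic_maps_chart[of c] continuous_map_into_fulltopology
  by (auto simp: homeomorphic_maps_def)

lemma continuous_map_cinv: "c \<in> \<A> \<Longrightarrow> continuous_map (top_of_set (cmap c ` cdom c)) X (cinv c)"
  using homeomorphic_maps_chart[of c] continuous_map_into_fulltopology
  by (auto simp: homeomorphic_maps_def)

text \<open>The domain of the map that reads as \<psi> from \<open>c\<close> to \<open>d\<close>. It
  is the whole part of \<open>cdom c\<close> that \<psi> sends into the image of \<open>d\<close>,
  so no small neighbourhood has to be chosen, and the reverse link has the corresponding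
  domain.\<close>

definition link_dom :: "('a, 'n) chart \<Rightarrow> ('a, 'n) chart \<Rightarrow> (real^'n \<Rightarrow> real^'n) \<Rightarrow> 'a set" where
  "link_dom c d \<psi> = {z \<in> cdom c. \<psi> (cmap c z) \<in> cmap d ` cdom d}"

definition link :: "('a, 'n) chart \<Rightarrow> ('a, 'n) chart \<Rightarrow> (real^'n \<Rightarrow> real^'n) \<Rightarrow> 'a \<Rightarrow> 'a" where
  "link c d \<psi> z = cinv d (\<psi> (cmap c z))"

lemma openin_link_dom:
  assumes "c \<in> \<A>" "d \<in> \<A>" "bounded_linear \<psi>"
  shows "openin X (link_dom c d \<psi>)"
proof -
  have "continuous_map (subtopology X (cdom c)) euclidean (\<psi> \<circ> cmap c)"
    by (rule continuous_map_compose[OF continuous_map_cmap[OF assms(1)]])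
      (use assms(3) in \<open>simp add: linear_continuous_on\<close>)
  then have "openin (subtopology X (cdom c)) {z \<in> topspace (subtopology X (cdom c)). (\<psi> \<circ> cmap c) z \<in> cmap d ` cdom d}"
    by (rule openin_continuous_map_preimage) (simp add: open_cmap_cdom assms)
  then show ?thesis
    unfolding topspace_cdom[OF assms(1)] link_dom_def
    using openin_open_subtopology[OF openin_cdom[OF assms(1)]] by simp
qed

lemma continuous_map_link:
  assumes "c \<in> \<A>" "d \<in> \<A>" "bounded_linear \<psi>"
  shows "continuous_map (subtopology X (link_dom c d \<psi>)) X (link c d \<psi>)"
proof -
  have "continuous_map (subtopology X (cdom c)) euclidean (\<psi> \<circ> cmap c)"
    by (rule continuous_map_compose[OF continuous_map_cmap[OF assms(1)]])
      (use assms(3) in \<open>simp add: linear_continuous_on\<close>)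
  then have "continuous_map (subtopology X (link_dom c d \<psi>)) euclidean (\<psi> \<circ> cmap c)"
    by (rule continuous_map_from_subtopology_mono) (auto simp: link_dom_def)
  then have "continuous_map (subtopology X (link_dom c d \<psi>)) (top_of_set (cmap d ` cdom d)) (\<psi> \<circ> cmap c)"
    by (auto simp: continuous_map_in_subtopology link_dom_def)
  from continuous_map_compose[OF this continuous_map_cinv[OF assms(2)]]
  show ?thesis by (simp add: comp_def link_def[abs_def])
qed

text \<open>Agreement of \<tau> with the link is asked on its domain only, so that the lemma also
  covers \<open>inv_into\<close> of a link, which is known to equal the reverse link merely
  there.\<close>

lemma smooth_between_link:
  assumes "c \<in> \<A>" "d \<in> \<A>" "bounded_linear \<psi>" and eq: "\<And>z. z \<in> link_dom c d \<psi> \<Longrightarrow> \<tau> z = link c d \<psi> z"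
  shows "smooth_between \<A> (link_dom c d \<psi>) \<tau>"
  unfolding smooth_between_def
proof (intro ballI)
  fix a b assume ab: "a \<in> \<A>" "b \<in> \<A>"
  let ?U = "link_dom c d \<psi>"
  let ?S = "cmap a ` (cdom a \<inter> ?U \<inter> \<tau> -` cdom b)"
  have U: "openin X ?U" by (rule openin_link_dom[OF assms(1-3)])
  have "openin (subtopology X ?U) {z \<in> topspace (subtopology X ?U). link c d \<psi> z \<in> cdom b}"
    by (rule openin_continuous_map_preimage[OF continuous_map_link[OF assms(1-3)] openin_cdom[OF ab(2)]])
  then have "openin X {z \<in> topspace (subtopology X ?U). link c d \<psi> z \<in> cdom b}"
    using openin_open_subtopology[OF U] by blast
  moreover have "{z \<in> topspace (subtopology X ?U). link c d \<psi> z \<in> cdom b} = ?U \<inter> \<tau> -` cdom b"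
    using openin_subset[OF U] eq by auto
  ultimately have S: "open ?S" using open_cmap_image[OF ab(1)] by (simp add: Int_assoc)
  have fact: "z \<in> cdom c" "\<psi> (cmap c z) \<in> cmap d ` (cdom d \<inter> cdom b)" "cinv d (\<psi> (cmap c z)) = \<tau> z"
    if z: "z \<in> ?U" "\<tau> z \<in> cdom b" for z
  proof -
    obtain w where w: "w \<in> cdom d" "\<psi> (cmap c z) = cmap d w" using z(1) unfolding link_dom_def by blast
    then have "\<tau> z = w" using eq[OF z(1)] assms(2) by (simp add: link_def)
    then show "\<psi> (cmap c z) \<in> cmap d ` (cdom d \<inter> cdom b)" "cinv d (\<psi> (cmap c z)) = \<tau> z" using w z assms(2) by auto
    show "z \<in> cdom c" using z by (simp add: link_dom_def)
  qed
  have "smooth_on ?S (\<lambda>y. cmap c (cinv a y))"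
    by (rule smooth_on_mono[OF smooth_transition[OF ab(1) assms(1)]]) (use fact in blast)
  then have "smooth_on ?S (\<lambda>y. \<psi> (cmap c (cinv a y)))"
    by (rule smooth_on_bounded_linear_comp[OF assms(3) _ S])
  then have "smooth_on ?S (\<lambda>y. cmap b (cinv d (\<psi> (cmap c (cinv a y)))))"
    by (rule smooth_on_compose[OF smooth_transition[OF assms(2) ab(2)] _ S]) (use fact ab in auto)
  then show "smooth_on ?S (cmap b \<circ> \<tau> \<circ> cinv a)"
    by (rule smooth_on_cong[OF S, rotated]) (use fact ab in auto)
qed

lemma link_inverse:
  assumes "c \<in> \<A>" "d \<in> \<A>" "\<And>v. \<psi>' (\<psi> v) = v" "z \<in> link_dom c d \<psi>"
  shows "link c d \<psi> z \<in> link_dom d c \<psi>'" "link d c \<psi>' (link c d \<psi> z) = z"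
    "cmap d (link c d \<psi> z) = \<psi> (cmap c z)" "link c d \<psi> z \<in> cdom d"
proof -
  have z: "z \<in> cdom c" "\<psi> (cmap c z) \<in> cmap d ` cdom d" using assms(4) by (auto simp: link_dom_def)
  show 1: "link c d \<psi> z \<in> cdom d" using cinv_in[OF z(2)] by (simp add: link_def)
  show 2: "cmap d (link c d \<psi> z) = \<psi> (cmap c z)" using cmap_cinv[OF assms(2) z(2)] by (simp add: link_def)
  show "link c d \<psi> z \<in> link_dom d c \<psi>'" "link d c \<psi>' (link c d \<psi> z) = z"
    using 1 z(1) assms(1,3) by (simp_all add: link_dom_def link_def[of d c] 2)
qed

lemma diffeo_link:
  assumes cd: "c \<in> \<A>" "d \<in> \<A>" and l: "bounded_linear \<psi>" "bounded_linear \<psi>'"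
    and inv: "\<And>v. \<psi>' (\<psi> v) = v" "\<And>v. \<psi> (\<psi>' v) = v"
  shows "diffeo X \<A> (link_dom c d \<psi>) (link_dom d c \<psi>') (link c d \<psi>)"
proof -
  let ?U = "link_dom c d \<psi>" and ?V = "link_dom d c \<psi>'" and ?\<tau> = "link c d \<psi>" and ?\<sigma> = "link d c \<psi>'"
  note 1 = link_inverse[where \<psi>=\<psi> and \<psi>'=\<psi>', OF cd inv(1)]
    and 2 = link_inverse[where \<psi>=\<psi>' and \<psi>'=\<psi>, OF cd(2,1) inv(2)]
  have U: "openin X ?U" "openin X ?V" using cd l openin_link_dom by auto
  have top: "topspace (subtopology X ?U) = ?U" "topspace (subtopology X ?V) = ?V"
    using openin_subset[OF U(1)] openin_subset[OF U(2)] by auto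
  have "homeomorphic_maps (subtopology X ?U) (subtopology X ?V) ?\<tau> ?\<sigma>"
    unfolding homeomorphic_maps_def top
    using 1 2 continuous_map_link[OF cd l(1)] continuous_map_link[OF cd(2,1) l(2)] top
    by (auto simp: continuous_map_in_subtopology)
  then have hom: "homeomorphic_map (subtopology X ?U) (subtopology X ?V) ?\<tau>"
    by (rule homeomorphic_maps_imp_map)
  have "inj_on ?\<tau> ?U" using 1(2) by (metis inj_onI)
  then have "inv_into ?U ?\<tau> z = ?\<sigma> z" if "z \<in> ?V" for z
    using inv_into_f_f[of ?\<tau> ?U "?\<sigma> z"] 2[OF that] by simp
  then show ?thesis
    unfolding diffeo_def
    by (intro conjI U hom smooth_between_link[OF cd l(1)] smooth_between_link[OF cd(2,1) l(2)]) auto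
qed

lemma metric_on_cov_tensor: "metric_on \<A> \<sigma> U g \<Longrightarrow> z \<in> U \<Longrightarrow> g z \<in> cov_tensors \<A> z 2"
  by (simp add: metric_on_def metrics_at_def)

lemma metric_near_openin:
  assumes "metric_near X \<A> \<sigma> x g" "c \<in> charts_at \<A> x"
  obtains W where "openin X W" "x \<in> W" "W \<subseteq> cdom c" "metric_on \<A> \<sigma> W g"
proof -
  obtain W where W: "openin X W" "x \<in> W" "metric_on \<A> \<sigma> W g" using assms(1) by (auto simp: metric_near_def)
  have c: "c \<in> \<A>" "x \<in> cdom c" using assms(2) charts_at_atlas by auto
  show thesis
    by (rule that[of "W \<inter> cdom c"])
      (use W c openin_cdom[OF c(1)] in \<open>auto intro: metric_on_mono[OF W(3)]\<close>)
qed

end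

lemma differentiable_matrix_vector:
  fixes N :: "real^'n::finite^'n"
  shows "(\<lambda>y. N *v y) differentiable (at y)"
  by (intro bounded_linear_imp_differentiable matrix_vector_mul_bounded_linear)

lemma partial_matrix_compose:
  fixes N :: "real^'n::finite^'n"
  assumes "f differentiable (at (N *v y))"
  shows "partial k (\<lambda>y. f (N *v y)) y = (\<Sum>a\<in>UNIV. N $ a $ k * partial a f (N *v y))"
proof -
  have "partial k (\<lambda>y. (N *v y) $ a) y = N $ a $ k" for a
  proof -
    have "((\<lambda>y. (N *v y) $ a) has_derivative (\<lambda>y. (N *v y) $ a)) (at y)"
      by (intro bounded_linear_imp_has_derivative bounded_linear_compose[OF bounded_linear_vec_nth] matrix_vector_mul_bounded_linear)
    then show ?thesis by (simp add: has_derivative_partial matrix_vector_mult_basis column_def)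
  qed
  then show ?thesis using partial_compose[OF assms differentiable_matrix_vector] by simp
qed

lemma jacobian_linear:
  assumes "open S" "cmap c z \<in> S" and "\<And>y. y \<in> S \<Longrightarrow> cmap d (cinv c y) = N *v y"
  shows "jacobian c d z = N"
proof -
  have "partial i (\<lambda>y. cmap d (cinv c y) $ j) (cmap c z) = partial i (\<lambda>y. (N *v y) $ j) (cmap c z)" for i j
    by (rule partial_cong_open[OF assms(1,2)]) (simp add: assms(3))
  also have "\<dots> i j = N $ j $ i" for i j
    using partial_matrix_compose[of "\<lambda>y. y $ j" N "cmap c z" i]
    by (simp add: bounded_linear_imp_differentiable[OF bounded_linear_vec_nth] if_distrib cong: if_cong)
  finally show ?thesis by (simp add: jacobian_def vec_eq_iff)
qed

context manifold
begin

text \<open>Naturality for a diffeomorphism that is linear in charts centred at its fixed point \<open>x\<close>.\<close>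

lemma link_metric:
  fixes L L' :: "real^'n^'n"
  assumes c: "c \<in> charts_at \<A> x" "cmap c x = 0" and d: "d \<in> charts_at \<A> x" "cmap d x = 0"
    and L: "L ** L' = mat 1" "L' ** L = mat 1"
    and g: "metric_near X \<A> \<sigma> x g"
    and flat: "\<And>i j k. partial k (components c g [i, j]) 0 = 0"
  shows "\<exists>h. metric_near X \<A> \<sigma> x h \<and>
    jet_coords d x h = (0, transpose L' ** gram (g x c) ** L', 0,
      \<chi> i j k l. transform (transpose L') (\<lambda>I. second_partials c g x (I!0) (I!1) (I!2) (I!3)) [i, j, k, l]) \<and>
    (\<forall>T m J. natural X \<A> \<sigma> T \<longrightarrow> T (jet2 X \<A> \<sigma> x g) \<in> contra_tensors \<A> x m \<longrightarrow> length J = m \<longrightarrow>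
      T (jet2 X \<A> \<sigma> x h) d J = transform L (T (jet2 X \<A> \<sigma> x g) c) J)"
proof -
  define U where "U = link_dom c d ((*v) L)"
  define \<tau> where "\<tau> = link c d ((*v) L)"
  \<comment> \<open>By definition of the push-forward, its components in \<open>d\<close> are those
    of \<open>g\<close> in \<open>e\<close>, and on \<open>U\<close> the chart \<open>e\<close> is
    \<open>c\<close> followed by \<open>L\<close>. The claim becomes a comparison of
    \<open>g\<close> in \<open>c\<close> and in \<open>e\<close>.\<close>
  define e where "e = pull_chart U \<tau> d"
  have c': "c \<in> \<A>" "x \<in> cdom c" and d': "d \<in> \<A>" "x \<in> cdom d" using c d charts_at_atlas by auto
  have inv: "L' *v (L *v v) = v" "L *v (L' *v v) = v" for v
    by (simp_all add: matrix_vector_mul_assoc L)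
  have D: "diffeo X \<A> U (link_dom d c ((*v) L')) \<tau>"
    unfolding U_def \<tau>_def by (rule diffeo_link[OF c'(1) d'(1)]) (simp_all add: inv)
  have x: "x \<in> U" using c' d' c d by (auto simp: U_def link_dom_def image_iff intro!: bexI[of _ x])
  have \<tau>x: "\<tau> x = x" using c(2) d d' cinv_cmap[OF d'] by (simp add: \<tau>_def link_def)
  have Ud: "\<tau> z \<in> cdom d" "cmap d (\<tau> z) = L *v cmap c z" "z \<in> cdom c" if "z \<in> U" for z
    using that d' by (auto simp: U_def \<tau>_def link_dom_def link_def)
  have e: "e \<in> charts_at \<A> x" unfolding e_def using pull_chart_charts_at[OF D x] d \<tau>x by simp
  have e': "e \<in> \<A>" using e charts_at_atlas by auto
  have dome: "cdom e = U" unfolding e_def using Ud by auto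
  have cmape: "cmap e z = L *v cmap c z" if "z \<in> U" for z
    unfolding e_def using Ud that by simp
  have cme: "cmap c z = L' *v cmap e z" if "z \<in> U" for z using cmape[OF that] inv by simp
  let ?h = "push_field \<A> U \<tau> g"
  have h: "metric_near X \<A> \<sigma> x ?h" using metric_near_push_field[OF D x g] \<tau>x by simp
  have jac: "jacobian e c z = L'" "jacobian c e z = L" if z: "z \<in> U" for z
  proof -
    have zc: "z \<in> cdom c" "e \<in> charts_at \<A> z" "c \<in> charts_at \<A> z"
      using Ud(3)[OF z] z e' c' dome by (auto simp: charts_at_def)
    show "jacobian e c z = L'"
      by (rule jacobian_linear[OF open_cmap_cdom[OF e']]) (use z cme dome e' in \<open>auto simp: cinv_cmap\<close>)
    then show "jacobian c e z = L"
      using jacobian_inverse[OF zc(3,2)] L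
      by (metis matrix_mul_assoc matrix_mul_lid matrix_mul_rid)
  qed
  obtain W where W: "openin X W" "x \<in> W" "W \<subseteq> U" "metric_on \<A> \<sigma> W g"
    using metric_near_openin[OF g e] dome by auto
  have gc: "smooth_on (cmap c ` (cdom c \<inter> W)) (components c g [a, b])" for a b
    using W(4) c' by (simp only: metric_on_def)
  let ?S = "cmap e ` (cdom e \<inter> W)"
  have S: "open ?S" "0 \<in> ?S"
    using open_cmap_image[OF e' W(1)] cmape[OF x] c(2) x W dome by (auto simp: image_iff intro!: bexI[of _ x])
  have SL: "L' *v y \<in> cmap c ` (cdom c \<inter> W)" if y: "y \<in> ?S" for y
  proof -
    obtain z where z: "z \<in> W" "z \<in> U" "y = cmap e z" using y W(3) by auto
    then have "L' *v y = cmap c z" using cme by simp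
    then show ?thesis using z Ud(3) by blast
  qed
  have comp: "components e g [i, j] y =
      (\<Sum>a\<in>UNIV. \<Sum>b\<in>UNIV. (L' $ a $ i * L' $ b $ j) * components c g [a, b] (L' *v y))" if y: "y \<in> ?S" for i j y
  proof -
    obtain z where z: "z \<in> W" "z \<in> U" "y = cmap e z" using y W(3) by auto
    have "g z e [i, j] = transform (transpose (jacobian e c z)) (g z c) [i, j]"
      by (rule cov_tensorsD(2)[of _ _ _ 2])
        (use z metric_on_cov_tensor[OF W(4) z(1)] c' e' Ud(3) dome in \<open>auto simp: charts_at_def\<close>)
    then show ?thesis
      using z jac[OF z(2)] e' c' dome Ud(3)[OF z(2)]
      by (simp add: components_def transform_Cons transpose_def cme[symmetric] sum_distrib_left mult.assoc)
  qed
  have diff: "components c g [a, b] differentiable (at (L' *v y))"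
     "partial k (components c g [a, b]) differentiable (at (L' *v y))" if "y \<in> ?S" for a b k y
    using smooth_on_differentiable[OF gc SL[OF that]]
      smooth_on_differentiable[OF smooth_on_partial[OF gc] SL[OF that]] by auto
  have dcomp: "(\<lambda>y. f (L' *v y)) differentiable (at y)"
    if "f differentiable (at (L' *v y))" for f :: "real^'n \<Rightarrow> real" and y
    using differentiable_chain_at[OF differentiable_matrix_vector that] by (simp add: comp_def)
  have p1: "partial k (components e g [i, j]) y =
      (\<Sum>a\<in>UNIV. \<Sum>b\<in>UNIV. (L' $ a $ i * L' $ b $ j) *
        (\<Sum>c'\<in>UNIV. L' $ c' $ k * partial c' (components c g [a, b]) (L' *v y)))" if y: "y \<in> ?S" for i j k y
  proof -
    have "partial k (components e g [i, j]) y = partial k (\<lambda>y. \<Sum>a\<in>UNIV. \<Sum>b\<in>UNIV.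
        (L' $ a $ i * L' $ b $ j) * components c g [a, b] (L' *v y)) y"
      by (rule partial_cong_open[OF S(1) y comp])
    then show ?thesis using diff[OF y]
      by (simp add: partial_sum partial_cmult partial_matrix_compose dcomp differentiable_sum differentiable_mult)
  qed
  \<comment> \<open>The Jacobian is constant, so differentiating the transformation law creates no
    derivatives of the coordinate change, and the second partials transform like a tensor with four
    indices.\<close>
  have p2: "second_partials e g x i j k l =
      (\<Sum>a\<in>UNIV. \<Sum>b\<in>UNIV. (L' $ a $ i * L' $ b $ j) * (\<Sum>c'\<in>UNIV. L' $ c' $ k *
        (\<Sum>d'\<in>UNIV. L' $ d' $ l * partial d' (partial c' (components c g [a, b])) 0)))" for i j k l
  proof -
    have ex: "cmap e x = 0" using cmape[OF x] c(2) by simp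
    have "partial l (partial k (components e g [i, j])) 0 = partial l (\<lambda>y. \<Sum>a\<in>UNIV. \<Sum>b\<in>UNIV.
        (L' $ a $ i * L' $ b $ j) *
        (\<Sum>c'\<in>UNIV. L' $ c' $ k * partial c' (components c g [a, b]) (L' *v y))) 0"
      by (rule partial_cong_open[OF S p1])
    then show ?thesis unfolding second_partials_def ex using diff[OF S(2)]
      by (simp add: partial_sum partial_cmult partial_matrix_compose dcomp differentiable_sum differentiable_mult)
  qed
  show ?thesis
  proof (intro exI[of _ ?h] conjI h allI impI)
    have ex: "cmap e x = 0" using cmape[OF x] c(2) by simp
    have "g x e J = transform (transpose L') (g x c) J" if "length J = 2" for J
      using cov_tensorsD(2)[OF metric_on_cov_tensor[OF W(4,2)] c(1) e that] jac[OF x] by simp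
    then have "gram (g x e) = gram (transform (transpose L') (g x c))" by (simp add: gram_def)
    moreover have "jet_coords d x ?h = jet_coords e x g"
      using jet_coords_push_field[OF D x, of d g] d(1) \<tau>x by (simp add: e_def)
    moreover have "second_partials e g x i j k l =
      transform (transpose L') (\<lambda>I. second_partials c g x (I!0) (I!1) (I!2) (I!3)) [i, j, k, l]" for i j k l
      unfolding p2 second_partials_def[of c] c(2)
      by (simp add: transform_Cons transpose_def sum_distrib_left mult.assoc)
    ultimately show "jet_coords d x ?h = (0, transpose L' ** gram (g x c) ** L', 0,
      \<chi> i j k l. transform (transpose L') (\<lambda>I. second_partials c g x (I!0) (I!1) (I!2) (I!3)) [i, j, k, l])"
      using p1[OF S(2)] flat ex by (simp add: jet_coords_def gram_transform vec_eq_iff)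
  next
    fix T m and J :: "'n list"
    assume T: "natural X \<A> \<sigma> T" and t: "T (jet2 X \<A> \<sigma> x g) \<in> contra_tensors \<A> x m" and J: "length J = m"
    have "T (jet2 X \<A> \<sigma> (\<tau> x) ?h) = push_tensor \<A> U \<tau> x (T (jet2 X \<A> \<sigma> x g))"
      using T D x g unfolding natural_def by blast
    then have "T (jet2 X \<A> \<sigma> x ?h) d J = T (jet2 X \<A> \<sigma> x g) e J"
      using d(1) \<tau>x by (simp add: push_tensor_def e_def)
    also have "\<dots> = transform (jacobian c e x) (T (jet2 X \<A> \<sigma> x g) c) J"
      by (rule contra_tensorsD(2)[OF t c(1) e J])
    finally show "T (jet2 X \<A> \<sigma> x ?h) d J = transform L (T (jet2 X \<A> \<sigma> x g) c) J"
      using jac[OF x] by simp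
  qed
qed

end

section \<open>Scaling metrics and jets\<close>

definition scale_field :: "real \<Rightarrow> ('a, 'n) field \<Rightarrow> ('a, 'n) field" where
  "scale_field \<mu> g = (\<lambda>z c I. \<mu> * g z c I)"

text \<open>A jet carries the whole set of metrics that represent it, so scaling acts on all
  representatives; for positive factors \<open>jet2_scale\<close> confirms that the result is again
  a full equivalence class.\<close>

definition scale_jet :: "real \<Rightarrow> ('a, 'n) jet \<Rightarrow> ('a, 'n) jet" where
  "scale_jet \<mu> j = (fst j, scale_field \<mu> ` snd j)"

definition scale_coords :: "real \<Rightarrow> 'n::finite jet_coordinates \<Rightarrow> 'n jet_coordinates" where
  "scale_coords \<mu> = (\<lambda>(y, b, d1, d2). (y, \<mu> *\<^sub>R b, \<mu> *\<^sub>R d1, \<mu> *\<^sub>R d2))"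

lemma fst_scale_jet [simp]: "fst (scale_jet \<mu> j) = fst j"
  by (simp add: scale_jet_def)

lemma components_scale_field: "components c (scale_field \<mu> g) I = (\<lambda>y. \<mu> * components c g I y)"
  by (simp add: components_def scale_field_def)

section \<open>Signature and inverse under scaling and congruence\<close>

lemma has_signature_scale:
  assumes "has_signature \<sigma> G" "\<mu> > 0"
  shows "has_signature \<sigma> (\<mu> *\<^sub>R G)"
proof -
  obtain P :: "real^'a^'a" and N where P: "invertible P" "card N = fst \<sigma>" "card (- N) = snd \<sigma>"
    "transpose P ** G ** P = (\<chi> i j. if i = j then (if i \<in> N then 1 else - 1) else 0)"
    using assms(1) unfolding has_signature_def by blast
  let ?s = "1 / sqrt \<mu>"
  have "transpose (?s *\<^sub>R P) ** (\<mu> *\<^sub>R G) ** (?s *\<^sub>R P) = (?s * \<mu> * ?s) *\<^sub>R (transpose P ** G ** P)"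
    by (simp add: vec_eq_iff matrix_matrix_mult_def transpose_def sum_distrib_left sum_distrib_right
        mult_ac)
  also have "?s * \<mu> * ?s = 1" using assms(2) by (simp add: field_simps)
  finally have "transpose (?s *\<^sub>R P) ** (\<mu> *\<^sub>R G) ** (?s *\<^sub>R P) = (\<chi> i j. if i = j then (if i \<in> N then 1 else - 1) else 0)"
    using P(4) by simp
  moreover have "invertible (?s *\<^sub>R P)"
    using P(1) assms(2) scalar_invertible[of ?s P] by simp
  ultimately show ?thesis
    using P(2,3) unfolding has_signature_def by (intro exI[of _ "?s *\<^sub>R P"] exI[of _ N] conjI)
qed

lemma has_signature_congruence:
  fixes G N N' :: "real^'a::finite^'a"
  assumes "has_signature \<sigma> G" "N ** N' = mat 1" "N' ** N = mat 1"
  shows "has_signature \<sigma> (N ** G ** transpose N)"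
proof -
  obtain P :: "real^'a^'a" and M where P: "invertible P" "card M = fst \<sigma>" "card (- M) = snd \<sigma>"
    "transpose P ** G ** P = (\<chi> i j. if i = j then (if i \<in> M then 1 else - 1) else 0)"
    using assms(1) unfolding has_signature_def by blast
  let ?Q = "transpose N' ** P"
  have 1: "transpose N ** transpose N' = mat 1" "transpose N' ** transpose N = mat 1"
    using assms by (simp_all flip: matrix_transpose_mul)
  have "transpose ?Q ** (N ** G ** transpose N) ** ?Q =
      transpose P ** (N' ** N) ** G ** (transpose N ** transpose N') ** P"
    by (simp add: matrix_transpose_mul matrix_mul_assoc)
  also have "\<dots> = transpose P ** G ** P" by (simp add: assms 1)
  finally have "transpose ?Q ** (N ** G ** transpose N) ** ?Q =
    (\<chi> i j. if i = j then (if i \<in> M then 1 else - 1) else 0)" using P(4) by simp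
  moreover have "invertible (transpose N')" unfolding invertible_def using 1 by blast
  then have "invertible ?Q" using P(1) by (rule invertible_mult)
  ultimately show ?thesis
    using P(2,3) unfolding has_signature_def by (intro exI[of _ ?Q] exI[of _ M] conjI)
qed

lemma has_signature_invertible:
  assumes "has_signature \<sigma> (G :: real^'n::finite^'n)"
  shows "invertible G"
proof -
  obtain P :: "real^'n^'n" and M :: "'n set" where P: "invertible P"
    "transpose P ** G ** P = (\<chi> i j. if i = j then (if i \<in> M then 1 else - 1) else 0)"
    using assms unfolding has_signature_def by blast
  define D :: "real^'n^'n" where "D = (\<chi> i j. if i = j then (if i \<in> M then 1 else - 1) else 0)"
  have "D ** D = mat 1"
  proof -
    have "(D ** D) $ i $ j = (\<Sum>k\<in>UNIV. if k = i then (if i = j then 1 else 0) else 0)" for i j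
      unfolding matrix_matrix_mult_def vec_lambda_beta by (rule sum.cong) (auto simp: D_def)
    then show ?thesis by (simp add: vec_eq_iff mat_def)
  qed
  then have "det D * det D = 1" by (simp only: det_mul[symmetric] det_I)
  then have "det D \<noteq> 0" by auto
  then have "det G \<noteq> 0" using P(2) unfolding D_def[symmetric] by (auto simp: det_mul)
  then show ?thesis by (simp add: invertible_det_nz)
qed

lemma
  assumes "invertible (A :: real^'n::finite^'n)"
  shows matrix_inv_right: "A ** matrix_inv A = mat 1" and matrix_inv_left: "matrix_inv A ** A = mat 1"
proof -
  have "A ** matrix_inv A = mat 1 \<and> matrix_inv A ** A = mat 1"
    unfolding matrix_inv_def using assms unfolding invertible_def by (rule someI_ex)
  then show "A ** matrix_inv A = mat 1" "matrix_inv A ** A = mat 1" by auto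
qed

lemma transpose_component: "transpose A $ i $ j = A $ j $ i"
  by (simp add: transpose_def)

lemma matrix_inv_scale:
  assumes "invertible (G :: real^'n::finite^'n)" "\<mu> \<noteq> 0"
  shows "matrix_inv (\<mu> *\<^sub>R G) = (1 / \<mu>) *\<^sub>R matrix_inv G"
proof -
  let ?B = "(1 / \<mu>) *\<^sub>R matrix_inv G"
  have B: "\<mu> *\<^sub>R G ** ?B = mat 1"
    using assms by (simp add: scalar_matrix_assoc[symmetric] matrix_scalar_ac matrix_inv_right)
  have "invertible (\<mu> *\<^sub>R G)" using assms scalar_invertible by blast
  then have "matrix_inv (\<mu> *\<^sub>R G) ** (\<mu> *\<^sub>R G ** ?B) = ?B"
    by (simp only: matrix_mul_assoc matrix_inv_left matrix_mul_lid)
  then show ?thesis unfolding B by simp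
qed

context manifold
begin

section \<open>Push-forward, jets and connection of a rescaled metric\<close>

lemma push_field_scale: "push_field \<A> U \<tau> (scale_field \<mu> g) = scale_field \<mu> (push_field \<A> U \<tau> g)"
  by (auto simp: push_field_def scale_field_def push_tensor_def Let_def fun_eq_iff)

lemma metric_on_scale:
  assumes "metric_on \<A> \<sigma> U g" "\<mu> > 0" "openin X U"
  shows "metric_on \<A> \<sigma> U (scale_field \<mu> g)"
  unfolding metric_on_def
proof (intro conjI ballI allI)
  fix z assume "z \<in> U"
  then have g: "g z \<in> metrics_at \<A> \<sigma> z" using assms(1) by (simp add: metric_on_def)
  have "scale_field \<mu> g z \<in> cov_tensors \<A> z 2"
    using g unfolding metrics_at_def cov_tensors_iff scale_field_def mem_Collect_eq transform_scaled
    by (metis mult_zero_right)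
  moreover have "(\<forall>i j. scale_field \<mu> g z c [i, j] = scale_field \<mu> g z c [j, i]) \<and> has_signature \<sigma> (gram (scale_field \<mu> g z c))"
    if c: "c \<in> charts_at \<A> z" for c
  proof -
    have "gram (scale_field \<mu> g z c) = \<mu> *\<^sub>R gram (g z c)" by (simp add: gram_def scale_field_def vec_eq_iff)
    then show ?thesis using g c has_signature_scale[of \<sigma> "gram (g z c)", OF _ assms(2)] by (simp add: metrics_at_def scale_field_def)
  qed
  ultimately show "scale_field \<mu> g z \<in> metrics_at \<A> \<sigma> z" by (simp add: metrics_at_def)
next
  fix c i j assume c: "c \<in> \<A>"
  then have "smooth_on (cmap c ` (cdom c \<inter> U)) (components c g [i, j])"
    using assms(1) by (simp only: metric_on_def)
  then show "smooth_on (cmap c ` (cdom c \<inter> U)) (components c (scale_field \<mu> g) [i, j])"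
    unfolding components_scale_field by (intro smooth_on_mult open_cmap_image c assms(3)) auto
qed

lemma metric_near_scale: "metric_near X \<A> \<sigma> x g \<Longrightarrow> \<mu> > 0 \<Longrightarrow> metric_near X \<A> \<sigma> x (scale_field \<mu> g)"
  using metric_on_scale unfolding metric_near_def by meson

lemma metric_near_smooth:
  assumes "metric_near X \<A> \<sigma> x g" "c \<in> charts_at \<A> x"
  obtains W where "openin X W" "x \<in> W" "W \<subseteq> cdom c" "metric_on \<A> \<sigma> W g"
    "open (cmap c ` W)" "\<And>i j. smooth_on (cmap c ` W) (components c g [i, j])"
proof -
  have c: "c \<in> \<A>" using assms charts_at_atlas by auto
  obtain W where W: "openin X W" "x \<in> W" "W \<subseteq> cdom c" "metric_on \<A> \<sigma> W g"
    using metric_near_openin[OF assms] by blast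
  have "cdom c \<inter> W = W" using W by auto
  then have "open (cmap c ` W)" "smooth_on (cmap c ` W) (components c g [i, j])" for i j
    using open_cmap_image[OF c W(1)] W(4) c unfolding metric_on_def by force+
  then show thesis using that W by blast
qed

lemma jet_coords_scale:
  assumes "metric_near X \<A> \<sigma> x g" "c \<in> charts_at \<A> x"
  shows "jet_coords c x (scale_field \<mu> g) = scale_coords \<mu> (jet_coords c x g)"
proof -
  obtain W where W: "x \<in> W" "open (cmap c ` W)" "\<And>i j. smooth_on (cmap c ` W) (components c g [i, j])"
    using metric_near_smooth[OF assms] by metis
  have x: "cmap c x \<in> cmap c ` W" using W by auto
  have 1: "partial k (components c (scale_field \<mu> g) [i, j]) y = \<mu> * partial k (components c g [i, j]) y"
    if "y \<in> cmap c ` W" for i j k y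
    unfolding components_scale_field by (rule partial_cmult[OF smooth_on_differentiable[OF W(3) that]])
  have 2: "second_partials c (scale_field \<mu> g) x i j k l = \<mu> * second_partials c g x i j k l" for i j k l
    unfolding second_partials_def
    by (rule trans[OF partial_cong_open[OF W(2) x 1]
          partial_cmult[OF smooth_on_differentiable[OF smooth_on_partial[OF W(3)] x]]])
  show ?thesis
    by (simp add: jet_coords_def scale_coords_def vec_eq_iff 1[OF x] 2 gram_def) (simp add: scale_field_def)
qed

lemma scale_coords_scale_coords: "scale_coords a (scale_coords b q) = scale_coords (a * b) q"
  by (simp add: scale_coords_def split_beta)

lemma scale_coords_1: "scale_coords 1 q = q"
  by (simp add: scale_coords_def split_beta)

text \<open>Scaling by \<open>1 / \<mu>\<close> inverts scaling by \<mu>, both on metrics near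
  \<open>x\<close> and on jet coordinates. This gives the inclusion that is not immediate: every
  representative of the scaled jet is itself a scaled representative.\<close>

lemma jet2_scale:
  assumes g: "metric_near X \<A> \<sigma> x g" and mu: "\<mu> > 0"
  shows "jet2 X \<A> \<sigma> x (scale_field \<mu> g) = scale_jet \<mu> (jet2 X \<A> \<sigma> x g)"
proof -
  let ?S = "\<lambda>g. {h. metric_near X \<A> \<sigma> x h \<and> (\<forall>c\<in>charts_at \<A> x. jet_coords c x h = jet_coords c x g)}"
  have "h \<in> scale_field \<mu> ` ?S g" if h: "h \<in> ?S (scale_field \<mu> g)" for h
  proof (rule image_eqI)
    show "h = scale_field \<mu> (scale_field (1 / \<mu>) h)" using mu by (simp add: scale_field_def)
    show "scale_field (1 / \<mu>) h \<in> ?S g"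
      using h mu jet_coords_scale[OF g] jet_coords_scale[of \<sigma> x h]
      by (simp add: metric_near_scale scale_coords_scale_coords scale_coords_1)
  qed
  moreover have "scale_field \<mu> h \<in> ?S (scale_field \<mu> g)" if h: "h \<in> ?S g" for h
    using h mu jet_coords_scale[OF g] jet_coords_scale[of \<sigma> x h] by (simp add: metric_near_scale)
  ultimately show ?thesis by (auto simp: jet2_def scale_jet_def)
qed

lemma metric_on_invertible:
  assumes "metric_on \<A> \<sigma> W g" "z \<in> W" "c \<in> charts_at \<A> z"
  shows "invertible (gram (g z c))"
  by (rule has_signature_invertible[of \<sigma>]) (use assms in \<open>simp add: metric_on_def metrics_at_def\<close>)

lemma christoffel_scale:
  assumes "metric_near X \<A> \<sigma> x g" "c \<in> charts_at \<A> x" "\<mu> > 0"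
  shows "christoffel c (scale_field \<mu> g) x i j k = christoffel c g x i j k"
proof -
  obtain W where W: "x \<in> W" "metric_on \<A> \<sigma> W g" "\<And>i j. smooth_on (cmap c ` W) (components c g [i, j])"
    using metric_near_smooth[OF assms(1,2)] by metis
  have x: "cmap c x \<in> cmap c ` W" using W by auto
  have 1: "partial k (components c (scale_field \<mu> g) [i, j]) (cmap c x) = \<mu> * partial k (components c g [i, j]) (cmap c x)" for i j k
    unfolding components_scale_field by (rule partial_cmult[OF smooth_on_differentiable[OF W(3) x]])
  have "invertible (gram (g x c))"
    by (rule metric_on_invertible[OF W(2,1) assms(2)])
  moreover have "gram (scale_field \<mu> g x c) = \<mu> *\<^sub>R gram (g x c)"
    by (simp add: gram_def scale_field_def vec_eq_iff)
  ultimately have 2: "matrix_inv (gram (scale_field \<mu> g x c)) $ i $ l = matrix_inv (gram (g x c)) $ i $ l / \<mu>" for l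
    using assms(3) by (simp add: matrix_inv_scale)
  have "matrix_inv (gram (scale_field \<mu> g x c)) $ i $ l * (\<mu> * p + \<mu> * q - \<mu> * r) = matrix_inv (gram (g x c)) $ i $ l * (p + q - r)" for l p q r
    unfolding 2 using assms(3) by (simp add: field_simps)
  then show ?thesis unfolding christoffel_def 1 by simp
qed

lemma divergence_scale:
  assumes "metric_near X \<A> \<sigma> x g" "c \<in> charts_at \<A> x" "\<mu> > 0"
  shows "divergence c (scale_field \<mu> g) S x J = divergence c g S x J"
  by (simp add: divergence_def cov_deriv_def christoffel_scale[OF assms])

section \<open>Metrics prescribed in a chart\<close>

definition chart_metric :: "('a, 'n) chart \<Rightarrow> (real^'n \<Rightarrow> real^'n^'n) \<Rightarrow> ('a, 'n) field" where
  "chart_metric c G = (\<lambda>z d I. if c \<in> charts_at \<A> z \<and> d \<in> charts_at \<A> z \<and> length I = 2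
     then transform (transpose (jacobian d c z)) (\<lambda>I. G (cmap c z) $ (I ! 0) $ (I ! 1)) I else 0)"

lemma chart_metric_self:
  assumes "c \<in> charts_at \<A> z"
  shows "chart_metric c G z c [i, j] = G (cmap c z) $ i $ j"
  using assms by (simp add: chart_metric_def jacobian_self transform_mat)

lemma components_chart_metric:
  assumes "c \<in> \<A>" "y \<in> cmap c ` cdom c"
  shows "components c (chart_metric c G) [i, j] y = G y $ i $ j"
  using assms chart_metric_self[of c "cinv c y"] by (auto simp: components_def charts_at_def)

lemma chart_metric_cov:
  assumes c: "c \<in> charts_at \<A> z"
  shows "chart_metric c G z \<in> cov_tensors \<A> z 2"
  unfolding cov_tensors_iff
proof (intro conjI allI impI)
  fix d e and J :: "'n list"
  assume A: "d \<in> charts_at \<A> z" "e \<in> charts_at \<A> z" "length J = 2"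
  let ?G = "\<lambda>I. G (cmap c z) $ (I ! 0) $ (I ! 1)"
  have "chart_metric c G z e J = transform (transpose (jacobian d c z ** jacobian e d z)) ?G J"
    using A c by (simp add: chart_metric_def jacobian_chain[of e z d c])
  also have "\<dots> = transform (transpose (jacobian e d z)) (transform (transpose (jacobian d c z)) ?G) J"
    by (simp add: transform_transform matrix_transpose_mul)
  also have "\<dots> = transform (transpose (jacobian e d z)) (chart_metric c G z d) J"
    by (rule transform_cong) (use A c in \<open>simp add: chart_metric_def multi_indices_length\<close>)
  finally show "chart_metric c G z e J = transform (transpose (jacobian e d z)) (chart_metric c G z d) J" .
qed (auto simp: chart_metric_def)

lemma metric_on_chart_metric:
  assumes c: "c \<in> \<A>" and W: "openin X W" "W \<subseteq> cdom c"
    and G: "\<And>y. y \<in> cmap c ` W \<Longrightarrow> transpose (G y) = G y" "\<And>y. y \<in> cmap c ` W \<Longrightarrow> has_signature \<sigma> (G y)"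
    and sm: "\<And>i j. smooth_on (cmap c ` W) (\<lambda>y. G y $ i $ j)"
  shows "metric_on \<A> \<sigma> W (chart_metric c G)"
  unfolding metric_on_def
proof (intro conjI ballI allI)
  fix z assume z: "z \<in> W"
  have cz: "c \<in> charts_at \<A> z" using c z W by (auto simp: charts_at_def)
  have "(\<forall>i j. chart_metric c G z d [i, j] = chart_metric c G z d [j, i]) \<and>
      has_signature \<sigma> (gram (chart_metric c G z d))" if d: "d \<in> charts_at \<A> z" for d
  proof -
    let ?N = "transpose (jacobian d c z)"
    have eq: "gram (chart_metric c G z d) = ?N ** G (cmap c z) ** transpose ?N"
    proof -
      have "gram (chart_metric c G z d) = gram (transform ?N (\<lambda>I. G (cmap c z) $ (I ! 0) $ (I ! 1)))"
        using cz d by (simp add: gram_def chart_metric_def)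
      also have "\<dots> = ?N ** gram (\<lambda>I. G (cmap c z) $ (I ! 0) $ (I ! 1)) ** transpose ?N"
        by (rule gram_transform)
      finally show ?thesis by (simp add: gram_def vec_eq_iff)
    qed
    have "transpose (gram (chart_metric c G z d)) = gram (chart_metric c G z d)"
      unfolding eq using G(1) z by (simp add: matrix_transpose_mul matrix_mul_assoc)
    then have "gram (chart_metric c G z d) $ i $ j = gram (chart_metric c G z d) $ j $ i" for i j
      using transpose_component[of "gram (chart_metric c G z d)" j i] by simp
    moreover have "has_signature \<sigma> (gram (chart_metric c G z d))"
      unfolding eq
    proof (rule has_signature_congruence)
      show "has_signature \<sigma> (G (cmap c z))" using G(2) z by auto
      show "?N ** transpose (jacobian c d z) = mat 1" "transpose (jacobian c d z) ** ?N = mat 1"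
        using jacobian_inverse[OF cz d] jacobian_inverse[OF d cz] by (simp_all flip: matrix_transpose_mul)
    qed
    ultimately show ?thesis by (simp add: gram_def)
  qed
  then show "chart_metric c G z \<in> metrics_at \<A> \<sigma> z" using chart_metric_cov[OF cz] by (simp add: metrics_at_def)
next
  fix d i j assume d: "d \<in> \<A>"
  let ?S = "cmap d ` (cdom d \<inter> W)"
  have S: "open ?S" by (rule open_cmap_image[OF d W(1)])
  have sub: "?S \<subseteq> cmap d ` (cdom d \<inter> cdom c)" using W by auto
  have 1: "smooth_on ?S (\<lambda>y. jacobian d c (cinv d y) $ a $ b)" for a b
    by (rule smooth_on_mono[OF smooth_on_jacobian[OF d c] sub])
  have 2: "smooth_on ?S (\<lambda>y. G (cmap c (cinv d y)) $ a $ b)" for a b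
    by (rule smooth_on_compose[OF sm smooth_on_mono[OF smooth_transition[OF d c] sub] S]) (use d W in auto)
  have "smooth_on ?S (\<lambda>y. \<Sum>a\<in>UNIV. jacobian d c (cinv d y) $ a $ i *
      (\<Sum>b\<in>UNIV. jacobian d c (cinv d y) $ b $ j * G (cmap c (cinv d y)) $ a $ b))"
    by (intro smooth_on_sum smooth_on_mult 1 2 S)
  then show "smooth_on ?S (components d (chart_metric c G) [i, j])"
  proof (rule smooth_on_cong[OF S, rotated])
    fix y assume "y \<in> ?S"
    then obtain z where z: "z \<in> cdom d" "z \<in> W" "y = cmap d z" by auto
    then have "c \<in> charts_at \<A> z" "d \<in> charts_at \<A> z" using c d W by (auto simp: charts_at_def)
    then show "(\<Sum>a\<in>UNIV. jacobian d c (cinv d y) $ a $ i *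
      (\<Sum>b\<in>UNIV. jacobian d c (cinv d y) $ b $ j * G (cmap c (cinv d y)) $ a $ b)) = components d (chart_metric c G) [i, j] y"
      using z d by (simp add: components_def chart_metric_def transform_Cons transpose_def)
  qed
qed

end

section \<open>Normal coordinates\<close>

lemma symmetric_form_zero:
  fixes A :: "'n::finite \<Rightarrow> 'n \<Rightarrow> real"
  assumes "\<And>v :: real^'n. (\<Sum>j\<in>UNIV. \<Sum>k\<in>UNIV. A j k * v $ j * v $ k) = 0" "\<And>j k. A j k = A k j"
  shows "A j k = 0"
proof -
  let ?Q = "\<lambda>v w :: real^'n. \<Sum>j\<in>UNIV. \<Sum>k\<in>UNIV. A j k * v $ j * w $ k"
  have pick: "(\<Sum>k\<in>UNIV. f k * axis q (1::real) $ k) = f q" for f :: "'n \<Rightarrow> real" and q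
  proof -
    have "(\<Sum>k\<in>UNIV. f k * axis q (1::real) $ k) = (\<Sum>k\<in>UNIV. if k = q then f k else 0)"
      by (rule sum.cong) (auto simp: axis_def)
    then show ?thesis by simp
  qed
  have ax: "?Q (axis p 1) (axis q 1) = A p q" for p q
    unfolding pick pick[of "\<lambda>j. A j q"] ..
  have add: "?Q (v + v') (w + w') = ?Q v w + ?Q v w' + ?Q v' w + ?Q v' w'" for v v' w w'
    by (simp add: distrib_left distrib_right sum.distrib)
  have "A j j = 0" "A k k = 0" using assms(1)[of "axis j 1"] assms(1)[of "axis k 1"] ax by auto
  then have "A j k + A k j = 0"
    using assms(1)[of "axis j 1 + axis k 1"] unfolding add ax by simp
  then show ?thesis using assms(2)[of j k] by simp
qed

context manifold
begin

text \<open>Because the lines through the origin are geodesics, the Christoffel symbols at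
  \<open>x\<close>, as quadratic forms, vanish on every velocity. Polarization and lowering the
  index kill the individual symbols, and two of these recover each first derivative of the
  metric.\<close>

lemma normal_chart_flat:
  assumes N: "normal_chart \<A> \<sigma> g x c"
  shows "partial k (components c g [i, j]) 0 = 0"
proof -
  let ?\<Omega> = "cmap c ` cdom c"
  have c: "c \<in> charts_at \<A> x" "metric_on \<A> \<sigma> (cdom c) g" "cmap c x = 0"
    and geo: "\<And>v. geodesic_on \<A> g {t. t *\<^sub>R v \<in> ?\<Omega>} (\<lambda>t. cinv c (t *\<^sub>R v))"
    using N by (auto simp: normal_chart_def)
  have c': "c \<in> \<A>" "x \<in> cdom c" using c charts_at_atlas by auto
  have \<Omega>: "open ?\<Omega>" "0 \<in> ?\<Omega>" using open_cmap_cdom[OF c'(1)] c' c(3) by (auto simp: image_iff intro!: bexI[of _ x])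
  have x: "cinv c 0 = x" using cinv_cmap[OF c'] c(3) by simp
  have comp_sym: "components c g [a, b] y = components c g [b, a] y" if "y \<in> ?\<Omega>" for a b y
  proof -
    have "cinv c y \<in> cdom c" using cinv_in[OF that] .
    then have "g (cinv c y) \<in> metrics_at \<A> \<sigma> (cinv c y)" "c \<in> charts_at \<A> (cinv c y)"
      using c(2) c' by (auto simp: metric_on_def charts_at_def)
    then show ?thesis by (simp add: components_def metrics_at_def)
  qed
  define p where "p = (\<lambda>a b k. partial k (components c g [a, b]) 0)"
  have psym: "p a b k = p b a k" for a b k
    unfolding p_def by (rule partial_cong_open[OF \<Omega> comp_sym])
  define \<Gamma> where "\<Gamma> = christoffel c g x"
  have \<Gamma>: "\<Gamma> i j k = (\<Sum>l\<in>UNIV. matrix_inv (gram (g x c)) $ i $ l * (p l k j + p l j k - p j k l)) / 2" for i j k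
    by (simp add: \<Gamma>_def christoffel_def p_def c(3))
  have "(\<Sum>j\<in>UNIV. \<Sum>k\<in>UNIV. \<Gamma> i j k * v $ j * v $ k) = 0" for i v
  proof -
    let ?O = "{t. t *\<^sub>R v \<in> ?\<Omega>}"
    have O: "open ?O" "0 \<in> ?O"
      using \<Omega> continuous_open_vimage[of ?\<Omega> "\<lambda>t. t *\<^sub>R v"]
      by (auto simp: vimage_def intro!: continuous_intros)
    obtain w a where w: "\<forall>\<^sub>F s in nhds 0. ((\<lambda>s. cmap c (cinv c (s *\<^sub>R v))) has_vector_derivative w s) (at s)"
      and a: "(w has_vector_derivative a) (at 0)"
      and eq: "\<forall>i. a $ i + (\<Sum>j\<in>UNIV. \<Sum>k\<in>UNIV. \<Gamma> i j k * w 0 $ j * w 0 $ k) = 0"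
    proof -
      have "c \<in> charts_at \<A> (cinv c (0 *\<^sub>R v))" using c(1) x by simp
      from bspec[OF bspec[OF geo[of v, unfolded geodesic_on_def] O(2)] this] show thesis
        using that x unfolding \<Gamma>_def by auto
    qed
    \<comment> \<open>\<open>geodesic_on\<close> only asserts that some velocity \<open>w\<close>
      exists; uniqueness of derivatives identifies it near 0 with the constant \<open>v\<close>, and
      the acceleration with zero.\<close>
    have hv: "((\<lambda>s. cmap c (cinv c (s *\<^sub>R v))) has_vector_derivative v) (at s)" if "s \<in> ?O" for s
    proof (rule has_vector_derivative_transform_within_open[OF _ O(1) that])
      show "((\<lambda>s. s *\<^sub>R v) has_vector_derivative v) (at s)" by (auto intro!: derivative_eq_intros)
    qed (use c' in \<open>auto simp: cmap_cinv\<close>)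
    have "\<forall>\<^sub>F s in nhds 0. s \<in> ?O" using O by (rule eventually_nhds_in_open)
    with w have wv: "\<forall>\<^sub>F s in nhds 0. w s = v"
      by eventually_elim (use hv vector_derivative_unique_at in blast)
    have "w 0 = v" using eventually_nhds_x_imp_x[OF wv] .
    obtain O' where O': "open O'" "0 \<in> O'" "\<And>s. s \<in> O' \<Longrightarrow> w s = v" using wv unfolding eventually_nhds by blast
    have "((\<lambda>s. v) has_vector_derivative a) (at 0)"
      using a by (rule has_vector_derivative_transform_within_open[OF _ O'(1,2)]) (simp add: O')
    then have "a = 0" by (metis has_vector_derivative_const vector_derivative_unique_at)
    then show ?thesis using eq \<open>w 0 = v\<close> by simp
  qed
  then have \<Gamma>0: "\<Gamma> i j k = 0" for i j k
    by (rule symmetric_form_zero) (simp add: \<Gamma> psym add.commute)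
  have inv: "invertible (gram (g x c))"
    by (rule metric_on_invertible[OF c(2) c'(2) c(1)])
  have low: "p l k j + p l j k - p j k l = 0" for l j k
  proof -
    let ?w = "\<chi> l. p l k j + p l j k - p j k l"
    have "matrix_inv (gram (g x c)) *v ?w = 0"
      using \<Gamma>0[of _ j k] unfolding \<Gamma> by (simp add: vec_eq_iff matrix_vector_mult_def)
    then have "(gram (g x c) ** matrix_inv (gram (g x c))) *v ?w = 0"
      by (simp add: matrix_vector_mul_assoc[symmetric])
    then have "?w = 0" using inv by (simp add: matrix_inv_right)
    then show ?thesis by (simp add: vec_eq_iff)
  qed
  \<comment> \<open>In the sum of the two relations everything but \<open>2 * p i j k\<close>
    cancels.\<close>
  have "p i j k = 0" using low[of i j k] low[of j k i] psym by (simp add: algebra_simps)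
  then show ?thesis by (simp add: p_def)
qed

lemma second_partials_symmetric:
  assumes g: "metric_near X \<A> \<sigma> x g" and c: "c \<in> charts_at \<A> x"
  shows "second_partials c g x i j k l = second_partials c g x j i k l"
    "second_partials c g x i j k l = second_partials c g x i j l k"
proof -
  obtain W where W: "x \<in> W" "W \<subseteq> cdom c" "metric_on \<A> \<sigma> W g" "open (cmap c ` W)"
     "\<And>i j. smooth_on (cmap c ` W) (components c g [i, j])"
    using metric_near_smooth[OF g c] by metis
  have c': "c \<in> \<A>" using c charts_at_atlas by auto
  have x: "cmap c x \<in> cmap c ` W" using W by auto
  show "second_partials c g x i j k l = second_partials c g x i j l k"
    unfolding second_partials_def by (rule partial_commute[OF W(5) W(4) x])
  have "components c g [i, j] y = components c g [j, i] y" if y: "y \<in> cmap c ` W" for y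
  proof -
    obtain z where z: "z \<in> W" "y = cmap c z" using y by auto
    then have "g z \<in> metrics_at \<A> \<sigma> z" "c \<in> charts_at \<A> z" "cinv c y = z"
      using W c' by (auto simp: metric_on_def charts_at_def)
    then show ?thesis by (simp add: components_def metrics_at_def)
  qed
  then have "partial k (components c g [i, j]) y = partial k (components c g [j, i]) y" if "y \<in> cmap c ` W" for y
    using partial_cong_open[OF W(4) that] by blast
  then show "second_partials c g x i j k l = second_partials c g x j i k l"
    unfolding second_partials_def using partial_cong_open[OF W(4) x] by blast
qed

end

section \<open>Iterated differences\<close>

primrec dif :: "'v::real_vector list \<Rightarrow> ('v \<Rightarrow> real) \<Rightarrow> 'v \<Rightarrow> real" where
  "dif [] f h = f h"
| "dif (d # ds) f h = dif ds f (h + d) - dif ds f h"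

lemma dif_linear: "dif ds (\<lambda>h. \<Sum>k\<in>A. v k * f k h) h = (\<Sum>k\<in>A. v k * dif ds (f k) h)"
  by (induction ds arbitrary: h) (simp_all add: sum_subtractf right_diff_distrib)

lemma dif_shift: "dif ds (\<lambda>x. f (x + d)) h = dif ds f (h + d)"
  by (induction ds arbitrary: h) (simp_all add: add_ac)

lemma dif_diff: "dif ds (\<lambda>x. f x - g x) h = dif ds f h - dif ds g h"
  by (induction ds arbitrary: h) simp_all

lemma dif_cong:
  assumes "subspace H" "set ds \<subseteq> H" "h \<in> H" "\<And>x. x \<in> H \<Longrightarrow> f x = g x"
  shows "dif ds f h = dif ds g h"
  using assms(2,3) by (induction ds arbitrary: h) (auto simp: assms subspace_add)

text \<open>By \<open>dif_shift\<close> the step \<open>d\<close> can be moved onto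
  \<open>f\<close>, where the invariance annihilates it; the remaining differences preserve zero.
  The invariance is known on \<open>H\<close> only, so directions and base point have to stay in
  \<open>H\<close>.\<close>

lemma dif_invariant:
  assumes H: "subspace H" and inv: "\<And>x. x \<in> H \<Longrightarrow> f (x + d) = f x"
    and "d \<in> set ds" "set ds \<subseteq> H" "h \<in> H"
  shows "dif ds f h = 0"
  using assms(3-)
proof (induction ds arbitrary: h)
  case (Cons e ds)
  show ?case
  proof (cases "d = e")
    case True
    have "dif ds f (h + d) = dif ds f h"
      unfolding dif_shift[symmetric] by (rule dif_cong[OF H]) (use Cons.prems inv in auto)
    then show ?thesis using True by simp
  next
    case False
    then show ?thesis using Cons by (simp add: subspace_add[OF H])
  qed
qed simp

text \<open>The directions may vary with a parameter; this permits the limit in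
  \<open>dif_direction_zero\<close>.\<close>

lemma continuous_on_dif:
  fixes f :: "'v::real_normed_vector \<Rightarrow> real"
  assumes H: "subspace H" and f: "continuous_on H f"
    and d: "\<And>i. continuous_on UNIV (\<lambda>e::real. d i e)" "\<And>i e. d i e \<in> H"
    and "continuous_on UNIV h" "\<And>e. h e \<in> H"
  shows "continuous_on UNIV (\<lambda>e::real. dif (map (\<lambda>i. d i e) L) f (h e))"
  using assms(5,6)
proof (induction L arbitrary: h)
  case Nil
  then show ?case using continuous_on_compose2[OF f, of UNIV h] by auto
next
  case (Cons i L)
  have "continuous_on UNIV (\<lambda>e. dif (map (\<lambda>i. d i e) L) f (h e + d i e))"
    using Cons.prems d by (intro Cons.IH continuous_on_add) (auto simp: subspace_add[OF H])
  then show ?case using Cons by (simp add: continuous_on_diff)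
qed

section \<open>Newton interpolation and functions with vanishing differences\<close>

lemma dif_replicate_Suc: "dif (replicate (Suc j) w) f h = dif (replicate j w) (\<lambda>x. f (x + w) - f x) h"
  by (simp add: dif_diff dif_shift)

lemma sum_choose: "(\<Sum>i<k. real (i choose j)) = real (k choose Suc j)"
  by (induction k) simp_all

text \<open>Newton's forward formula. The induction hypothesis is applied to the first difference of
  \<open>f\<close>, which needs one difference less to vanish; telescoping and
  \<open>sum_choose\<close> then raise the lower entry of each binomial coefficient by one.\<close>

lemma newton_nat:
  assumes "\<And>k::nat. dif (replicate n w) f (h + real k *\<^sub>R w) = 0"
  shows "f (h + real k *\<^sub>R w) = (\<Sum>j<n. real (k choose j) * dif (replicate j w) f h)"
  using assms
proof (induction n arbitrary: f k)
  case (Suc n)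
  let ?g = "\<lambda>x. f (x + w) - f x"
  have "?g (h + real i *\<^sub>R w) = (\<Sum>j<n. real (i choose j) * dif (replicate (Suc j) w) f h)" for i
    using Suc.IH[of ?g i] Suc.prems unfolding dif_replicate_Suc by blast
  then have g: "f (h + real (Suc i) *\<^sub>R w) - f (h + real i *\<^sub>R w) =
      (\<Sum>j<n. real (i choose j) * dif (replicate (Suc j) w) f h)" for i
    by (simp add: algebra_simps)
  have "f (h + real k *\<^sub>R w) - f (h + real 0 *\<^sub>R w) = (\<Sum>i<k. f (h + real (Suc i) *\<^sub>R w) - f (h + real i *\<^sub>R w))"
    by (rule sum_lessThan_telescope[symmetric])
  also have "\<dots> = (\<Sum>j<n. \<Sum>i<k. real (i choose j) * dif (replicate (Suc j) w) f h)"
    unfolding g by (rule sum.swap)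
  also have "\<dots> = (\<Sum>j<n. real (k choose Suc j) * dif (replicate (Suc j) w) f h)"
    by (simp only: sum_choose[symmetric] sum_distrib_right)
  finally show ?case by (simp add: sum.lessThan_Suc_shift del: sum.lessThan_Suc replicate.simps(2))
qed simp

lemma gbinomial_poly: "\<exists>P. \<forall>s::real. poly P s = s gchoose j"
  by (rule exI[of _ "smult (1 / fact j) (\<Prod>i<j. [:- of_nat i, 1:])"])
     (simp add: poly_prod gbinomial_prod_rev atLeast0LessThan)

lemma poly_eq_infinite:
  fixes P Q :: "real poly"
  assumes "infinite S" "\<And>s. s \<in> S \<Longrightarrow> poly P s = poly Q s"
  shows "P = Q"
proof (rule ccontr)
  assume "P \<noteq> Q"
  then have "finite {s. poly (P - Q) s = 0}" by (intro poly_roots_finite) simp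
  moreover have "S \<subseteq> {s. poly (P - Q) s = 0}" using assms(2) by auto
  ultimately show False using assms(1) finite_subset by blast
qed

lemma newton_poly:
  "\<exists>P. \<forall>s::real. poly P s = (\<Sum>j<n. (q * s gchoose j) * D j)"
proof -
  obtain B where B: "\<And>j s. poly (B j) s = (s::real) gchoose j" using gbinomial_poly by metis
  show ?thesis
    by (rule exI[of _ "\<Sum>j<n. smult (D j) (pcompose (B j) [:0, q:])"])
       (simp add: poly_sum poly_pcompose B mult.commute)
qed

text \<open>Frechet: a continuous function on a line all of whose \<open>n\<close>-th differences vanish is a
  polynomial. Interpolation on the grids of mesh \<open>1/q\<close> always gives the same polynomial, because
  all these grids contain the natural numbers.\<close>

lemma newton_real:
  fixes f :: "'v::real_normed_vector \<Rightarrow> real"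
  assumes H: "subspace H" and f: "continuous_on H f" and w: "w \<in> H"
    and zero: "\<And>t h. h \<in> H \<Longrightarrow> dif (replicate n (t *\<^sub>R w)) f h = 0" and h: "h \<in> H"
  shows "f (h + s *\<^sub>R w) = (\<Sum>j<n. (s gchoose j) * dif (replicate j w) f h)"
proof -
  have memb: "x + t *\<^sub>R w \<in> H" if "x \<in> H" for x t
    using that w by (intro subspace_add[OF H] subspace_scale[OF H])
  have "\<exists>P. \<forall>q x s. poly (P q x) s = (\<Sum>j<n. (q * s gchoose j) * dif (replicate j ((1 / q) *\<^sub>R w)) f x)"
    by (rule exI[of _ "\<lambda>q x. SOME P. \<forall>s. poly P s = (\<Sum>j<n. (q * s gchoose j) * dif (replicate j ((1 / q) *\<^sub>R w)) f x)"])
       (intro allI, rule someI_ex[OF newton_poly, rule_format])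
  \<comment> \<open>\<open>P q x\<close> is the Newton polynomial for the base point
    \<open>x\<close> and the mesh \<open>1 / q\<close>, in the parameter \<open>s\<close> along
    \<open>w\<close>.\<close>
  then obtain P where P: "\<And>q x s. poly (P q x) s = (\<Sum>j<n. (q * s gchoose j) * dif (replicate j ((1 / q) *\<^sub>R w)) f x)"
    by blast
  have grid: "f (x + (real k / real q) *\<^sub>R w) = poly (P (real q) x) (real k / real q)" if "x \<in> H" "q > 0" for x k q
    using newton_nat[of n "(1 / real q) *\<^sub>R w" f x k] zero[OF memb[OF that(1)]] that(2)
    by (simp add: P binomial_gbinomial)
  have Peq: "P (real q) x = P 1 x" if x: "x \<in> H" and q: "q > 0" for x q
  proof (rule poly_eq_infinite)
    show "infinite (range real)" by (rule range_inj_infinite) (rule inj_of_nat)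
    fix s assume "s \<in> range real"
    then obtain k where k: "s = real k" by auto
    have "f (x + s *\<^sub>R w) = poly (P (real q) x) s" using grid[OF x q, of "k * q"] q k by simp
    moreover have "f (x + s *\<^sub>R w) = poly (P 1 x) s" using grid[OF x, of 1 k] k by simp
    ultimately show "poly (P (real q) x) s = poly (P 1 x) s" by simp
  qed
  have pos: "f (x + (real k / real q) *\<^sub>R w) = poly (P 1 x) (real k / real q)" if "x \<in> H" "q > 0" for x k q
    using grid[OF that] Peq[OF that] by simp
  \<comment> \<open>Forward interpolation reaches nonnegative parameters only. Interpolation from
    the earlier base point \<open>?x\<close> covers the parameter \<open>- ?r\<close> as well, and
    its polynomial, shifted by \<open>?r\<close>, agrees with that of \<open>h\<close> on infinitely
    many grid points.\<close>
  have neg: "f (h - (real k / real q) *\<^sub>R w) = poly (P 1 h) (- (real k / real q))" if q: "q > 0" for k q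
  proof -
    let ?r = "real k / real q"
    let ?x = "h - ?r *\<^sub>R w"
    have x: "?x \<in> H" using memb[OF h, of "- ?r"] by simp
    have "P 1 h = pcompose (P 1 ?x) [:?r, 1:]"
    proof (rule poly_eq_infinite)
      have "inj (\<lambda>i. real i / real q)" using q by (auto simp: inj_def)
      then show "infinite (range (\<lambda>i. real i / real q))" by (rule range_inj_infinite)
      fix s assume "s \<in> range (\<lambda>i. real i / real q)"
      then obtain i where i: "s = real i / real q" by auto
      have "?x + (real (k + i) / real q) *\<^sub>R w = h + s *\<^sub>R w"
        by (simp add: i add_divide_distrib scaleR_add_left)
      then have "poly (P 1 ?x) (real (k + i) / real q) = poly (P 1 h) s"
        using pos[OF x q, of "k + i"] pos[OF h q, of i] unfolding i by metis
      then show "poly (P 1 h) s = poly (pcompose (P 1 ?x) [:?r, 1:]) s"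
        by (simp add: poly_pcompose i add_divide_distrib add.commute)
    qed
    then have "poly (P 1 h) (- ?r) = poly (P 1 ?x) 0" by (simp add: poly_pcompose)
    then show ?thesis using pos[OF x, of 1 0] by simp
  qed
  have rat: "f (h + r *\<^sub>R w) = poly (P 1 h) r" if r: "r \<in> \<rat>" for r
  proof -
    obtain i q where iq: "q > 0" "\<bar>r\<bar> = real i / real q"
    proof -
      from Rats_abs_nat_div_natE[OF r] obtain m n where "n \<noteq> 0" "\<bar>r\<bar> = real m / real n" by metis
      then show thesis using that by auto
    qed
    show ?thesis
    proof (cases "r \<ge> 0")
      case True
      then show ?thesis using pos[OF h iq(1), of i] iq(2) by simp
    next
      case False
      then have "r = - (real i / real q)" using iq(2) by simp
      then show ?thesis using neg[OF iq(1), of i] by simp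
    qed
  qed
  let ?g = "\<lambda>s. f (h + s *\<^sub>R w) - poly (P 1 h) s"
  have "continuous_on UNIV (\<lambda>s. f (h + s *\<^sub>R w))"
    by (rule continuous_on_compose2[OF f]) (auto intro!: continuous_intros memb h)
  then have cont: "continuous_on UNIV ?g" by (intro continuous_intros)
  have "?g s = 0"
  proof (rule ccontr)
    assume "?g s \<noteq> 0"
    moreover have "isCont ?g s" using cont by (simp add: continuous_on_eq_continuous_at)
    ultimately obtain d where d: "d > 0" "\<And>y. dist s y < d \<Longrightarrow> ?g y \<noteq> 0"
      using continuous_at_avoid[of s ?g 0] by auto
    obtain r where "r \<in> \<rat>" "s < r" "r < s + d" using Rats_dense_in_real[of s "s + d"] d by auto
    then show False using d(2)[of r] rat by (simp add: dist_real_def)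
  qed
  then show ?thesis using P[of 1 h s] by simp
qed

section \<open>Polynomial functions of finitely many coordinates\<close>

text \<open>The shape is that of \<open>homogeneous_polynomial_map\<close>: lists serve as monomials
  and coefficients need not be unique. The argument is an arbitrary family of reals, so linear
  changes of coordinates can be substituted without regard to symmetries of tensors.\<close>

definition hpoly :: "'i set \<Rightarrow> nat \<Rightarrow> (('i \<Rightarrow> real) \<Rightarrow> real) \<Rightarrow> bool" where
  "hpoly A k f \<longleftrightarrow> (\<exists>a. \<forall>x. f x = (\<Sum>K | length K = k \<and> set K \<subseteq> A. a K * (\<Prod>I\<leftarrow>K. x I)))"

definition poly_upto :: "'i set \<Rightarrow> nat \<Rightarrow> (('i \<Rightarrow> real) \<Rightarrow> real) \<Rightarrow> bool" where
  "poly_upto A m f \<longleftrightarrow> (\<exists>q. (\<forall>k. hpoly A k (q k)) \<and> (\<forall>x. f x = (\<Sum>k\<le>m. q k x)))"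

lemma finite_lists_length:
  "finite A \<Longrightarrow> finite {K. length K = k \<and> set K \<subseteq> A}"
  using finite_lists_length_eq[of A k] by (simp add: conj_commute)

lemma hpoly_zero: "hpoly A k (\<lambda>x. 0)"
  unfolding hpoly_def by (rule exI[of _ "\<lambda>_. 0"]) simp

lemma hpoly_const: "hpoly A 0 (\<lambda>x. r)"
  unfolding hpoly_def by (rule exI[of _ "\<lambda>_. r"]) (simp add: conj_commute cong: conj_cong)

lemma hpoly_coord:
  assumes "finite A" "I \<in> A"
  shows "hpoly A 1 (\<lambda>x. x I)"
  unfolding hpoly_def
proof (intro exI allI)
  fix x :: "'a \<Rightarrow> real"
  have "(\<Sum>K | length K = 1 \<and> set K \<subseteq> A. (if K = [I] then 1 else 0) * (\<Prod>I\<leftarrow>K. x I)) =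
      (\<Sum>K | length K = 1 \<and> set K \<subseteq> A. if K = [I] then x I else 0)"
    by (rule sum.cong) auto
  then show "x I = (\<Sum>K | length K = 1 \<and> set K \<subseteq> A. (if K = [I] then 1 else 0) * (\<Prod>I\<leftarrow>K. x I))"
    using assms finite_lists_length[of A 1] by simp
qed

lemma hpoly_add: "hpoly A k f \<Longrightarrow> hpoly A k g \<Longrightarrow> hpoly A k (\<lambda>x. f x + g x)"
  unfolding hpoly_def
  by (elim exE, rule_tac x="\<lambda>K. a K + aa K" in exI) (simp add: distrib_right sum.distrib)

lemma hpoly_cmult: "hpoly A k f \<Longrightarrow> hpoly A k (\<lambda>x. r * f x)"
  unfolding hpoly_def
  by (elim exE, rule_tac x="\<lambda>K. r * a K" in exI) (simp add: sum_distrib_left mult.assoc)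

lemma hpoly_sum: "(\<And>i. i \<in> S \<Longrightarrow> hpoly A k (f i)) \<Longrightarrow> hpoly A k (\<lambda>x. \<Sum>i\<in>S. f i x)"
  by (induction S rule: infinite_finite_induct) (auto intro: hpoly_zero hpoly_add)

lemma hpoly_mult:
  assumes "hpoly A k f" "hpoly A l g"
  shows "hpoly A (k + l) (\<lambda>x. f x * g x)"
proof -
  obtain a b where f: "\<And>x. f x = (\<Sum>K | length K = k \<and> set K \<subseteq> A. a K * (\<Prod>I\<leftarrow>K. x I))"
    and g: "\<And>x. g x = (\<Sum>K | length K = l \<and> set K \<subseteq> A. b K * (\<Prod>I\<leftarrow>K. x I))"
    using assms unfolding hpoly_def by blast
  let ?S = "\<lambda>k. {K. length K = k \<and> set K \<subseteq> A}"
  have "f x * g x = (\<Sum>K\<in>?S (k + l). (a (take k K) * b (drop k K)) * (\<Prod>I\<leftarrow>K. x I))" for x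
  proof -
    have "f x * g x = (\<Sum>(K, K')\<in>?S k \<times> ?S l. (a K * b K') * (\<Prod>I\<leftarrow>K @ K'. x I))"
      unfolding f g sum_product sum.cartesian_product by (rule sum.cong) (auto simp: mult_ac)
    also have "\<dots> = (\<Sum>K\<in>?S (k + l). (a (take k K) * b (drop k K)) * (\<Prod>I\<leftarrow>K. x I))"
      by (rule sum.reindex_bij_witness[of _ "\<lambda>K. (take k K, drop k K)" "\<lambda>(K, K'). K @ K'"])
         (auto dest: in_set_takeD in_set_dropD)
    finally show ?thesis .
  qed
  then show ?thesis
    unfolding hpoly_def by (intro exI[of _ "\<lambda>K. a (take k K) * b (drop k K)"] allI)
qed

lemma hpoly_prod_list:
  assumes "\<And>I. I \<in> set K \<Longrightarrow> hpoly A 1 (\<lambda>x. s x I)"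
  shows "hpoly A (length K) (\<lambda>x. \<Prod>I\<leftarrow>K. s x I)"
  using assms
proof (induction K)
  case (Cons I K)
  have "hpoly A (1 + length K) (\<lambda>x. s x I * (\<Prod>I\<leftarrow>K. s x I))"
    using Cons by (intro hpoly_mult) auto
  then show ?case by simp
qed (simp add: hpoly_const)

lemma hpoly_substitute:
  assumes "hpoly B k f" "\<And>I. I \<in> B \<Longrightarrow> hpoly A 1 (\<lambda>x. s x I)"
  shows "hpoly A k (\<lambda>x. f (s x))"
proof -
  obtain a where f: "\<And>x. f x = (\<Sum>K | length K = k \<and> set K \<subseteq> B. a K * (\<Prod>I\<leftarrow>K. x I))"
    using assms(1) unfolding hpoly_def by blast
  have "hpoly A k (\<lambda>x. \<Sum>K | length K = k \<and> set K \<subseteq> B. a K * (\<Prod>I\<leftarrow>K. s x I))"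
  proof (intro hpoly_sum hpoly_cmult)
    fix K assume "K \<in> {K. length K = k \<and> set K \<subseteq> B}"
    then show "hpoly A k (\<lambda>x. \<Prod>I\<leftarrow>K. s x I)" using hpoly_prod_list[of K A s] assms(2) by auto
  qed
  then show ?thesis by (simp add: f)
qed

lemma hpoly_homogeneous:
  assumes "hpoly A k f"
  shows "f (\<lambda>I. r * x I) = r ^ k * f x"
proof -
  obtain a where f: "\<And>x. f x = (\<Sum>K | length K = k \<and> set K \<subseteq> A. a K * (\<Prod>I\<leftarrow>K. x I))"
    using assms unfolding hpoly_def by blast
  have "(\<Prod>I\<leftarrow>K. r * x I) = r ^ length K * (\<Prod>I\<leftarrow>K. x I)" for K :: "'a list"
    by (induction K) (simp_all add: mult_ac)
  then show ?thesis unfolding f sum_distrib_left by (intro sum.cong) (auto simp: mult_ac)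
qed

section \<open>Polynomials of bounded degree\<close>

lemma poly_upto_mono:
  assumes "poly_upto A m f" "m \<le> m'"
  shows "poly_upto A m' f"
proof -
  obtain q where q: "\<And>k. hpoly A k (q k)" "\<And>x. f x = (\<Sum>k\<le>m. q k x)"
    using assms(1) unfolding poly_upto_def by blast
  have "(\<Sum>k\<le>m'. if k \<le> m then q k x else 0) = (\<Sum>k\<le>m. q k x)" for x
    using assms(2) by (intro sum.mono_neutral_cong_right) auto
  moreover have "hpoly A k (\<lambda>x. if k \<le> m then q k x else 0)" for k
    using q(1) hpoly_zero by (cases "k \<le> m") auto
  ultimately show ?thesis
    unfolding poly_upto_def q(2) by (intro exI[of _ "\<lambda>k x. if k \<le> m then q k x else 0"]) auto
qed

lemma poly_upto_hpoly:
  assumes "hpoly A k f"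
  shows "poly_upto A k f"
proof -
  have "hpoly A j (\<lambda>x. if j = k then f x else 0)" for j
    using assms hpoly_zero by (cases "j = k") auto
  then show ?thesis unfolding poly_upto_def by (intro exI[of _ "\<lambda>j x. if j = k then f x else 0"]) auto
qed

lemma poly_upto_const: "poly_upto A m (\<lambda>x. r)"
  by (rule poly_upto_mono[OF poly_upto_hpoly[OF hpoly_const]]) simp

lemma poly_upto_add:
  assumes "poly_upto A m f" "poly_upto A m g"
  shows "poly_upto A m (\<lambda>x. f x + g x)"
proof -
  obtain q p where "\<And>k. hpoly A k (q k)" "\<And>x. f x = (\<Sum>k\<le>m. q k x)"
    "\<And>k. hpoly A k (p k)" "\<And>x. g x = (\<Sum>k\<le>m. p k x)"
    using assms unfolding poly_upto_def by metis
  then show ?thesis unfolding poly_upto_def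
    by (intro exI[of _ "\<lambda>k x. q k x + p k x"]) (simp add: hpoly_add sum.distrib)
qed

lemma poly_upto_mult:
  assumes "poly_upto A m f" "poly_upto A m' g"
  shows "poly_upto A (m + m') (\<lambda>x. f x * g x)"
proof -
  obtain q p where q: "\<And>k. hpoly A k (q k)" "\<And>x. f x = (\<Sum>k\<le>m. q k x)"
    and p: "\<And>k. hpoly A k (p k)" "\<And>x. g x = (\<Sum>k\<le>m'. p k x)"
    using assms unfolding poly_upto_def by metis
  let ?r = "\<lambda>k x. \<Sum>i\<le>m. \<Sum>j\<le>m'. if i + j = k then q i x * p j x else 0"
  have "hpoly A k (?r k)" for k
  proof (intro hpoly_sum)
    fix i j
    show "hpoly A k (\<lambda>x. if i + j = k then q i x * p j x else 0)"
      using hpoly_mult[OF q(1) p(1), of i j] hpoly_zero by (cases "i + j = k") auto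
  qed
  moreover have "f x * g x = (\<Sum>k\<le>m + m'. ?r k x)" for x
  proof -
    have "(\<Sum>k\<le>m + m'. ?r k x) = (\<Sum>i\<le>m. \<Sum>k\<le>m + m'. \<Sum>j\<le>m'. if i + j = k then q i x * p j x else 0)"
      by (rule sum.swap)
    also have "\<dots> = (\<Sum>i\<le>m. \<Sum>j\<le>m'. \<Sum>k\<le>m + m'. if i + j = k then q i x * p j x else 0)"
      by (rule sum.cong[OF refl]) (rule sum.swap)
    also have "\<dots> = (\<Sum>i\<le>m. \<Sum>j\<le>m'. q i x * p j x)"
      by (intro sum.cong refl) simp
    finally show ?thesis unfolding q(2) p(2) by (simp add: sum_product)
  qed
  ultimately show ?thesis unfolding poly_upto_def by (intro exI[of _ ?r] conjI allI)
qed

lemma poly_upto_cmult: "poly_upto A m f \<Longrightarrow> poly_upto A m (\<lambda>x. r * f x)"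
  using poly_upto_mult[OF poly_upto_const[of A 0 r], of m f] by simp

lemma poly_upto_sum: "(\<And>i. i \<in> S \<Longrightarrow> poly_upto A m (f i)) \<Longrightarrow> poly_upto A m (\<lambda>x. \<Sum>i\<in>S. f i x)"
  by (induction S rule: infinite_finite_induct) (auto intro: poly_upto_const poly_upto_add)

lemma poly_upto_gbinomial:
  assumes "hpoly A 1 t"
  shows "poly_upto A j (\<lambda>x. t x gchoose j)"
proof -
  have "poly_upto A j (\<lambda>x. \<Prod>i<j. (t x - of_nat i))"
  proof (induction j)
    case (Suc j)
    have "poly_upto A 1 (\<lambda>x. t x + - of_nat j)"
      by (intro poly_upto_add poly_upto_const poly_upto_hpoly assms)
    from poly_upto_mult[OF Suc this] show ?case by simp
  qed (simp add: poly_upto_const)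
  then have "poly_upto A j (\<lambda>x. (1 / fact j) * (\<Prod>i<j. (t x - of_nat i)))" by (rule poly_upto_cmult)
  then show ?thesis by (simp add: gbinomial_prod_rev atLeast0LessThan)
qed

text \<open>The Newton coefficients in one direction are finite differences of \<open>f\<close>,
  hence combinations of values of \<open>f\<close> at shifted base points, and by induction these
  are polynomial in the remaining parameters. For this the base point \<open>b\<close> has to be
  arbitrary. Each direction adds at most \<open>n\<close> to the degree.\<close>

lemma poly_upto_along_directions:
  fixes f :: "'v::real_normed_vector \<Rightarrow> real"
  assumes H: "subspace H" and f: "continuous_on H f"
    and Q: "finite Q" "\<And>q. q \<in> Q \<Longrightarrow> w q \<in> H"
    and zero: "\<And>q t h. q \<in> Q \<Longrightarrow> h \<in> H \<Longrightarrow> dif (replicate n (t *\<^sub>R w q)) f h = 0"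
    and t: "\<And>q. q \<in> Q \<Longrightarrow> hpoly A 1 (t q)"
    and b: "b \<in> H"
  shows "poly_upto A (card Q * n) (\<lambda>x. f (b + (\<Sum>q\<in>Q. t q x *\<^sub>R w q)))"
  using Q zero t b
proof (induction Q arbitrary: b rule: finite_induct)
  case empty
  then show ?case by (simp add: poly_upto_const)
next
  case (insert p Q)
  have wH: "w q \<in> H" if "q \<in> insert p Q" for q using insert.prems(1) that .
  have IH: "poly_upto A (card Q * n) (\<lambda>x. f (c + (\<Sum>q\<in>Q. t q x *\<^sub>R w q)))" if "c \<in> H" for c
    using insert.IH[OF _ _ _ that] insert.prems by auto
  have dif: "poly_upto A (card Q * n) (\<lambda>x. dif (replicate j (w p)) f (c + (\<Sum>q\<in>Q. t q x *\<^sub>R w q)))"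
    if "c \<in> H" for c j
    using that
  proof (induction j arbitrary: c)
    case 0
    then show ?case using IH by simp
  next
    case (Suc j)
    have "poly_upto A (card Q * n) (\<lambda>x. dif (replicate j (w p)) f ((c + w p) + (\<Sum>q\<in>Q. t q x *\<^sub>R w q))
        + (-1) * dif (replicate j (w p)) f (c + (\<Sum>q\<in>Q. t q x *\<^sub>R w q)))"
      using Suc wH by (intro poly_upto_add poly_upto_cmult Suc.IH) (auto intro: subspace_add[OF H])
    then show ?case by (simp add: add_ac)
  qed
  have "poly_upto A (card (insert p Q) * n)
      (\<lambda>x. \<Sum>j<n. (t p x gchoose j) * dif (replicate j (w p)) f (b + (\<Sum>q\<in>Q. t q x *\<^sub>R w q)))"
  proof (rule poly_upto_sum)
    fix j assume "j \<in> {..<n}"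
    then show "poly_upto A (card (insert p Q) * n)
      (\<lambda>x. (t p x gchoose j) * dif (replicate j (w p)) f (b + (\<Sum>q\<in>Q. t q x *\<^sub>R w q)))"
      using insert.hyps insert.prems
      by (intro poly_upto_mono[OF poly_upto_mult[OF poly_upto_gbinomial dif]]) auto
  qed
  moreover have "f (b + (\<Sum>q\<in>insert p Q. t q x *\<^sub>R w q)) =
      (\<Sum>j<n. (t p x gchoose j) * dif (replicate j (w p)) f (b + (\<Sum>q\<in>Q. t q x *\<^sub>R w q)))" for x
  proof -
    have c: "b + (\<Sum>q\<in>Q. t q x *\<^sub>R w q) \<in> H"
      using insert.prems(4) wH by (intro subspace_add[OF H] subspace_sum[OF H] subspace_scale[OF H]) auto
    have "f (b + (\<Sum>q\<in>Q. t q x *\<^sub>R w q) + t p x *\<^sub>R w p) =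
      (\<Sum>j<n. (t p x gchoose j) * dif (replicate j (w p)) f (b + (\<Sum>q\<in>Q. t q x *\<^sub>R w q)))"
      by (rule newton_real[OF H f wH _ c]) (auto intro: insert.prems(2))
    then show ?thesis using insert.hyps by (simp add: add_ac)
  qed
  ultimately show ?case by simp
qed

section \<open>Functions of the second derivatives\<close>

text \<open>The symmetries that second derivatives of a metric have in every chart. The
  symmetrization condition of \<open>N2\<close> is left out because \<open>direction a u\<close>
  does not satisfy it in general.\<close>

definition sym4 :: "(real^'n::finite^'n^'n^'n) set" where
  "sym4 = {h. \<forall>i j k l. h $ i $ j $ k $ l = h $ j $ i $ k $ l \<and> h $ i $ j $ k $ l = h $ i $ j $ l $ k}"

definition direction :: "real^'n \<Rightarrow> real^'n \<Rightarrow> real^'n::finite^'n^'n^'n" where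
  "direction a u = (\<chi> i j k l. a $ i * a $ j * u $ k * u $ l)"

lemma subspace_sym4: "subspace (sym4 :: (real^'n::finite^'n^'n^'n) set)"
  by (auto simp: subspace_def sym4_def)

lemma direction_sym4: "direction a u \<in> sym4"
  by (simp add: sym4_def direction_def)

text \<open>An iterated difference in the directions \<open>a\<^sup>2 \<otimes> (u + \<epsilon> e\<^sub>i)\<^sup>2\<close> of the functional
  \<open>v \<mapsto> \<Sum>\<^sub>k v\<^sub>k \<phi>\<^sub>k\<close> is linear in \<open>v\<close> and vanishes on the vectors \<open>u + \<epsilon> e\<^sub>i\<close>, which form a basis for
  generic \<open>\<epsilon>\<close>. Then \<open>\<epsilon> \<rightarrow> 0\<close>.\<close>

lemma dif_direction_zero:
  fixes \<phi> :: "'n::finite \<Rightarrow> real^'n^'n^'n^'n \<Rightarrow> real"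
  assumes cont: "\<And>k. continuous_on sym4 (\<phi> k)"
    and inv: "\<And>h a u t. h \<in> sym4 \<Longrightarrow>
      (\<Sum>k\<in>UNIV. u $ k * \<phi> k (h + t *\<^sub>R direction a u)) = (\<Sum>k\<in>UNIV. u $ k * \<phi> k h)"
    and h: "h \<in> sym4"
  shows "dif (replicate CARD('n) (t *\<^sub>R direction a u)) (\<phi> k) h = 0"
proof -
  obtain L :: "'n list" where L: "set L = UNIV" "distinct L" using finite_distinct_list[of "UNIV :: 'n set"] by auto
  have len: "length L = CARD('n)" using distinct_card[OF L(2)] L(1) by simp
  define d where "d = (\<lambda>i \<epsilon>. t *\<^sub>R direction a (u + \<epsilon> *\<^sub>R axis i 1))"
  have dH: "d i \<epsilon> \<in> sym4" for i \<epsilon>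
    unfolding d_def by (rule subspace_scale[OF subspace_sym4 direction_sym4])
  define c where "c = (\<lambda>k \<epsilon>. dif (map (\<lambda>i. d i \<epsilon>) L) (\<phi> k) h)"
  \<comment> \<open>The vectors \<open>u + \<epsilon> *\<^sub>R axis i 1\<close> are the rows of a
    matrix with determinant \<epsilon>^(n-1) (\<epsilon> + \<Sum> u_i), where n is the dimension.
    The two excluded values of \<epsilon> are its possible zeros.\<close>
  have zero: "c k \<epsilon> = 0" if e: "\<epsilon> \<noteq> 0" "\<epsilon> \<noteq> - (\<Sum>i\<in>UNIV. u $ i)" for k \<epsilon>
  proof -
    have "(\<Sum>k\<in>UNIV. (u + \<epsilon> *\<^sub>R axis i 1) $ k * c k \<epsilon>) = 0" for i
      unfolding c_def dif_linear[symmetric]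
    proof (rule dif_invariant[OF subspace_sym4])
      show "d i \<epsilon> \<in> set (map (\<lambda>i. d i \<epsilon>) L)" using L(1) by simp
      show "set (map (\<lambda>i. d i \<epsilon>) L) \<subseteq> sym4" using dH by auto
    qed (simp_all only: d_def inv h)
    moreover have "(\<Sum>k\<in>UNIV. (u + \<epsilon> *\<^sub>R axis i 1) $ k * c k \<epsilon>) = (\<Sum>k\<in>UNIV. u $ k * c k \<epsilon>) + \<epsilon> * c i \<epsilon>" for i
    proof -
      have "(\<Sum>k\<in>UNIV. (u + \<epsilon> *\<^sub>R axis i 1) $ k * c k \<epsilon>) =
          (\<Sum>k\<in>UNIV. u $ k * c k \<epsilon> + (if k = i then \<epsilon> * c k \<epsilon> else 0))"
        by (rule sum.cong) (auto simp: axis_def algebra_simps)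
      then show ?thesis by (simp add: sum.distrib)
    qed
    ultimately have sum0: "(\<Sum>k\<in>UNIV. u $ k * c k \<epsilon>) + \<epsilon> * c i \<epsilon> = 0" for i by metis
    define S where "S = (\<Sum>k\<in>UNIV. u $ k * c k \<epsilon>)"
    have "\<epsilon> * c i \<epsilon> = - S" for i using sum0[of i] unfolding S_def by linarith
    then have ci: "c i \<epsilon> = - S / \<epsilon>" for i using e(1) by (metis nonzero_mult_div_cancel_left)
    have "S = (\<Sum>k\<in>UNIV. u $ k * (- S / \<epsilon>))" unfolding S_def[symmetric] by (subst S_def) (simp only: ci)
    also have "\<dots> = (\<Sum>k\<in>UNIV. u $ k) * (- S / \<epsilon>)" by (simp only: sum_distrib_right)
    finally have "S * (\<epsilon> + (\<Sum>k\<in>UNIV. u $ k)) = 0" using e(1) by (simp add: field_simps)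
    then have "S = 0" using e(2) by (simp add: add_eq_0_iff2)
    then show ?thesis using ci by simp
  qed
  have "continuous_on UNIV (d i)" for i
    unfolding d_def direction_def by (intro continuous_intros)
  then have "continuous_on UNIV (c k)"
    unfolding c_def by (intro continuous_on_dif[OF subspace_sym4 cont]) (use dH h in auto)
  then have cc: "isCont (c k) 0" by (simp add: continuous_on_eq_continuous_at)
  have "c k 0 = 0"
  proof (rule ccontr)
    assume "c k 0 \<noteq> 0"
    then obtain r where r: "r > 0" "\<And>y. dist 0 y < r \<Longrightarrow> c k y \<noteq> 0"
      using continuous_at_avoid[OF cc, of 0] by auto
    \<comment> \<open>Two distinct small values of \<epsilon>, because one of them could be the
      exceptional one.\<close>
    have "r / 2 = - (\<Sum>i\<in>UNIV. u $ i)" "r / 3 = - (\<Sum>i\<in>UNIV. u $ i)"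
      using zero[of "r / 2" k] zero[of "r / 3" k] r(1) r(2)[of "r / 2"] r(2)[of "r / 3"] by auto
    then show False using r(1) by simp
  qed
  \<comment> \<open>At \<epsilon> = 0 all directions coincide, and the list of directions becomes a
    \<open>replicate\<close>.\<close>
  then show ?thesis by (simp add: c_def d_def map_replicate_const len)
qed

section \<open>Polarization and polynomiality on the space of second derivatives\<close>

lemma sum_prod_UNIV: "(\<Sum>q\<in>UNIV. F q) = (\<Sum>a\<in>UNIV. \<Sum>b\<in>UNIV. F (a :: 'a::finite, b :: 'b::finite))"
  by (simp add: sum.cartesian_product flip: UNIV_Times_UNIV)

definition sgb :: "bool \<Rightarrow> real" where
  "sgb s = (if s then 1 else -1)"

text \<open>The symmetric product of e_i and e_j is ((e_i + e_j)^2 - (e_i - e_j)^2) / 4, and summing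
  it against a symmetric \<open>S\<close> reproduces \<open>S\<close>. The Boolean \<open>s\<close>
  runs over the two signs.\<close>

lemma polarization:
  fixes S :: "'n::finite \<Rightarrow> 'n \<Rightarrow> real"
  assumes "\<And>i j. S i j = S j i"
  shows "(\<Sum>i\<in>UNIV. \<Sum>j\<in>UNIV. \<Sum>s\<in>UNIV. sgb s / 4 * S i j *
    ((axis i 1 + sgb s *\<^sub>R axis j 1 :: real^'n) $ a * (axis i 1 + sgb s *\<^sub>R axis j 1 :: real^'n) $ b)) = S a b"
proof -
  have "(\<Sum>i\<in>UNIV. \<Sum>j\<in>UNIV. \<Sum>s\<in>UNIV. sgb s / 4 * S i j *
    ((axis i 1 + sgb s *\<^sub>R axis j 1 :: real^'n) $ a * (axis i 1 + sgb s *\<^sub>R axis j 1 :: real^'n) $ b)) =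
    (\<Sum>i\<in>UNIV. \<Sum>j\<in>UNIV. (if i = a then if j = b then S i j / 2 else 0 else 0) +
      (if i = b then if j = a then S i j / 2 else 0 else 0))"
    by (intro sum.cong refl) (auto simp: axis_def UNIV_bool sgb_def)
  also have "\<dots> = (\<Sum>i\<in>UNIV. (if i = a then S i b / 2 else 0) + (if i = b then S i a / 2 else 0))"
    by (rule sum.cong) (auto simp: sum.distrib)
  also have "\<dots> = S a b" using assms[of a b] by (simp add: sum.distrib)
  finally show ?thesis .
qed

text \<open>Polarization in each pair of indices shows that the tensors \<open>direction a u\<close>
  span \<open>sym4\<close>. The family is redundant, but its vectors are fixed and the coefficients
  are linear in the coordinates of \<open>h\<close>, as \<open>poly_upto_along_directions\<close>
  requires.\<close>

lemma sym4_polarization: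
  fixes h :: "real^'n::finite^'n^'n^'n"
  assumes h: "h \<in> sym4"
  shows "(\<Sum>(i, j, s, k, l, s')\<in>UNIV. (sgb s / 4 * (sgb s' / 4) * h $ i $ j $ k $ l) *\<^sub>R
    direction (axis i 1 + sgb s *\<^sub>R axis j 1) (axis k 1 + sgb s' *\<^sub>R axis l 1)) = h"
proof -
  let ?E = "\<lambda>i j s. axis i 1 + sgb s *\<^sub>R axis j 1 :: real^'n"
  have hs: "h $ i $ j $ k $ l = h $ j $ i $ k $ l" "h $ i $ j $ k $ l = h $ i $ j $ l $ k" for i j k l
    using h unfolding sym4_def mem_Collect_eq by blast+
  have "(\<Sum>(i, j, s, k, l, s')\<in>UNIV. (sgb s / 4 * (sgb s' / 4) * h $ i $ j $ k $ l) *\<^sub>R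
    direction (?E i j s) (?E k l s')) $ a $ b $ c $ d = h $ a $ b $ c $ d" for a b c d
  proof -
    have "(\<Sum>(i, j, s, k, l, s')\<in>UNIV. (sgb s / 4 * (sgb s' / 4) * h $ i $ j $ k $ l) *\<^sub>R
      direction (?E i j s) (?E k l s')) $ a $ b $ c $ d =
      (\<Sum>(i, j, s, k, l, s')\<in>UNIV. (sgb s / 4 * (sgb s' / 4) * h $ i $ j $ k $ l) *
        (?E i j s $ a * ?E i j s $ b * ?E k l s' $ c * ?E k l s' $ d))"
      unfolding sum_component by (rule sum.cong) (auto simp: direction_def)
    also have "\<dots> = (\<Sum>i\<in>UNIV. \<Sum>j\<in>UNIV. \<Sum>s\<in>UNIV. sgb s / 4 * (\<Sum>k\<in>UNIV. \<Sum>l\<in>UNIV. \<Sum>s'\<in>UNIV.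
        sgb s' / 4 * h $ i $ j $ k $ l * (?E k l s' $ c * ?E k l s' $ d)) * (?E i j s $ a * ?E i j s $ b))"
      unfolding sum_prod_UNIV prod.case sum_distrib_left sum_distrib_right
      by (intro sum.cong refl) (simp only: mult_ac)
    also have "\<dots> = (\<Sum>i\<in>UNIV. \<Sum>j\<in>UNIV. \<Sum>s\<in>UNIV. sgb s / 4 * h $ i $ j $ c $ d * (?E i j s $ a * ?E i j s $ b))"
      by (subst polarization) (use hs in auto)
    also have "\<dots> = h $ a $ b $ c $ d"
      by (rule polarization) (use hs in auto)
    finally show ?thesis .
  qed
  then show ?thesis by (simp only: vec_eq_iff) blast
qed

definition coords4 :: "real^'n::finite^'n^'n^'n \<Rightarrow> 'n list \<Rightarrow> real" where
  "coords4 h I = h $ (I ! 0) $ (I ! 1) $ (I ! 2) $ (I ! 3)"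

lemma multi_indices_4: "[i, j, k, l] \<in> multi_indices 4"
  by (simp add: multi_indices_def)

text \<open>The degree is the size of the spanning family of \<open>sym4_polarization\<close> times
  \<open>CARD('n)\<close>, the number of differences that suffice to annihilate \<phi> along one
  direction.\<close>

lemma invariant_imp_polynomial:
  fixes \<phi> :: "'n::finite \<Rightarrow> real^'n^'n^'n^'n \<Rightarrow> real"
  assumes "\<And>k. continuous_on sym4 (\<phi> k)"
    and "\<And>h a u t. h \<in> sym4 \<Longrightarrow>
      (\<Sum>k\<in>UNIV. u $ k * \<phi> k (h + t *\<^sub>R direction a u)) = (\<Sum>k\<in>UNIV. u $ k * \<phi> k h)"
  shows "\<exists>f. poly_upto (multi_indices 4) (CARD('n \<times> 'n \<times> bool \<times> 'n \<times> 'n \<times> bool) * CARD('n)) f \<and>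
    (\<forall>h\<in>sym4. \<phi> k h = f (coords4 h))"
proof -
  let ?t = "\<lambda>(i, j, s, k, l, s') x. sgb s / 4 * (sgb s' / 4) * x [i :: 'n, j, k, l]"
  let ?w = "\<lambda>(i, j, s, k, l, s'). direction (axis i 1 + sgb s *\<^sub>R axis j 1) (axis k 1 + sgb s' *\<^sub>R axis l 1)
    :: real^'n^'n^'n^'n"
  have "poly_upto (multi_indices 4) (CARD('n \<times> 'n \<times> bool \<times> 'n \<times> 'n \<times> bool) * CARD('n))
      (\<lambda>x. \<phi> k (0 + (\<Sum>q\<in>UNIV. ?t q x *\<^sub>R ?w q)))"
  proof (rule poly_upto_along_directions[OF subspace_sym4 assms(1)])
    show "?w q \<in> sym4" for q by (simp add: split_beta direction_sym4)
    show "dif (replicate CARD('n) (t *\<^sub>R ?w q)) (\<phi> k) h = 0" if "h \<in> sym4" for q t h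
      using dif_direction_zero[OF assms that] by (simp only: split_beta)
    show "hpoly (multi_indices 4) 1 (?t q)" for q
      by (simp only: split_beta) (intro hpoly_cmult hpoly_coord finite_multi_indices multi_indices_4)
  qed (auto simp: subspace_0[OF subspace_sym4])
  moreover have "(\<Sum>q\<in>UNIV. ?t q (coords4 h) *\<^sub>R ?w q) = h" if "h \<in> sym4" for h
    using sym4_polarization[OF that] by (simp add: split_beta coords4_def numeral_nat)
  ultimately show ?thesis by (intro exI[of _ "\<lambda>x. \<phi> k (0 + (\<Sum>q\<in>UNIV. ?t q x *\<^sub>R ?w q))"]) auto
qed

section \<open>Test metrics with prescribed Taylor expansion\<close>

lemma partial_add_smooth:
  fixes f g :: "real^'n::finite \<Rightarrow> real"
  assumes "smooth_on UNIV f" "smooth_on UNIV g"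
  shows "partial k (\<lambda>y. f y + g y) = (\<lambda>y. partial k f y + partial k g y)"
  using assms by (simp add: fun_eq_iff partial_add smooth_on_differentiable)

lemma partial_mult_smooth:
  fixes f g :: "real^'n::finite \<Rightarrow> real"
  assumes "smooth_on UNIV f" "smooth_on UNIV g"
  shows "partial k (\<lambda>y. f y * g y) = (\<lambda>y. f y * partial k g y + partial k f y * g y)"
  using assms by (simp add: fun_eq_iff partial_mult smooth_on_differentiable)

lemma partial_cmult_smooth:
  fixes f :: "real^'n::finite \<Rightarrow> real"
  assumes "smooth_on UNIV f"
  shows "partial k (\<lambda>y. c * f y) = (\<lambda>y. c * partial k f y)"
  using assms by (simp add: fun_eq_iff partial_cmult smooth_on_differentiable)

lemma partial_sum_smooth:
  fixes f :: "'i \<Rightarrow> real^'n::finite \<Rightarrow> real"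
  assumes "\<And>i. i \<in> S \<Longrightarrow> smooth_on UNIV (f i)"
  shows "partial k (\<lambda>y. \<Sum>i\<in>S. f i y) = (\<lambda>y. \<Sum>i\<in>S. partial k (f i) y)"
  by (intro ext partial_sum smooth_on_differentiable[OF assms]) auto

lemma smooth_on_inner: "smooth_on S (\<lambda>y. v \<bullet> y)"
  by (intro smooth_on_linear bounded_linear_inner_right)

lemma smooth_on_coord: "smooth_on S (\<lambda>y. y $ k)"
  by (intro smooth_on_linear bounded_linear_vec_nth)

lemma partial_inner: "partial k (\<lambda>y. v \<bullet> y) = (\<lambda>y. v $ k)"
proof
  fix y
  have "((\<lambda>y. v \<bullet> y) has_derivative (\<lambda>y. v \<bullet> y)) (at y)"
    by (rule bounded_linear_imp_has_derivative[OF bounded_linear_inner_right])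
  then show "partial k (\<lambda>y. v \<bullet> y) y = v $ k" by (simp add: has_derivative_partial inner_axis)
qed

definition flat1 :: "(real^'n::finite \<Rightarrow> real) \<Rightarrow> bool" where
  "flat1 f \<longleftrightarrow> smooth_on UNIV f \<and> f 0 = 0 \<and> (\<forall>k. partial k f 0 = 0)"

definition flat3 :: "(real^'n::finite \<Rightarrow> real) \<Rightarrow> bool" where
  "flat3 f \<longleftrightarrow> flat1 f \<and> (\<forall>k l. partial l (partial k f) 0 = 0) \<and>
    (\<forall>k l m. partial m (partial l (partial k f)) 0 = 0)"

lemma flat3_cmult: "flat3 f \<Longrightarrow> flat3 (\<lambda>y. c * f y)"
  by (simp add: flat3_def flat1_def partial_cmult_smooth smooth_on_partial smooth_on_mult)

lemma flat3_sum: "(\<And>i. i \<in> S \<Longrightarrow> flat3 (f i)) \<Longrightarrow> flat3 (\<lambda>y. \<Sum>i\<in>S. f i y)"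
  by (simp add: flat3_def flat1_def partial_sum_smooth smooth_on_partial smooth_on_sum)

text \<open>Orders of vanishing at the origin add: two factors vanishing to order 2 leave only terms
  of order at least 4. This makes the quadratic correction in \<open>test_matrix\<close> invisible
  to derivatives up to the third.\<close>

lemma flat3_mult: "flat1 f \<Longrightarrow> flat1 g \<Longrightarrow> flat3 (\<lambda>y. f y * g y)"
  by (simp add: flat3_def flat1_def partial_mult_smooth partial_add_smooth smooth_on_partial
      smooth_on_mult smooth_on_add)

lemma partials_flat_perturbation:
  assumes f: "smooth_on UNIV f" and r: "flat3 r"
  shows "smooth_on UNIV (\<lambda>y. c + (f y + r y))"
    and "partial k (\<lambda>y. c + (f y + r y)) 0 = partial k f 0"
    and "partial l (partial k (\<lambda>y. c + (f y + r y))) 0 = partial l (partial k f) 0"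
    and "partial m (partial l (partial k (\<lambda>y. c + (f y + r y)))) 0 = partial m (partial l (partial k f)) 0"
proof -
  have r': "smooth_on UNIV r" using r by (simp add: flat3_def flat1_def)
  show "smooth_on UNIV (\<lambda>y. c + (f y + r y))" by (intro smooth_on_add f r') auto
  have 1: "partial k (\<lambda>y. c + (f y + r y)) = (\<lambda>y. partial k f y + partial k r y)" for k
    using f r' by (simp add: partial_add_smooth smooth_on_add)
  show "partial k (\<lambda>y. c + (f y + r y)) 0 = partial k f 0"
    "partial l (partial k (\<lambda>y. c + (f y + r y))) 0 = partial l (partial k f) 0"
    "partial m (partial l (partial k (\<lambda>y. c + (f y + r y)))) 0 = partial m (partial l (partial k f)) 0"
    using r unfolding 1
    by (simp_all add: partial_add_smooth smooth_on_partial f r') (simp_all add: flat3_def flat1_def)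
qed

definition taylor :: "real^'n::finite^'n \<Rightarrow> real \<Rightarrow> real^'n \<Rightarrow> real^'n \<Rightarrow> real" where
  "taylor H \<kappa> u y = 1 / 2 * (\<Sum>k\<in>UNIV. y $ k * (H $ k \<bullet> y)) + \<kappa> / 6 * ((u \<bullet> y) * ((u \<bullet> y) * (u \<bullet> y)))"

lemma
  assumes H: "transpose H = H"
  shows smooth_taylor: "smooth_on UNIV (taylor H \<kappa> u)"
    and partial_taylor: "partial m (taylor H \<kappa> u) = (\<lambda>y. H $ m \<bullet> y + \<kappa> * u $ m / 2 * ((u \<bullet> y) * (u \<bullet> y)))"
    and partial2_taylor: "partial l (partial m (taylor H \<kappa> u)) = (\<lambda>y. H $ m $ l + \<kappa> * u $ m * u $ l * (u \<bullet> y))"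
    and partial3_taylor: "partial p (partial l (partial m (taylor H \<kappa> u))) = (\<lambda>y. \<kappa> * u $ m * u $ l * u $ p)"
proof -
  note S = smooth_on_inner smooth_on_coord smooth_on_mult smooth_on_add smooth_on_sum
  show sm: "smooth_on UNIV (taylor H \<kappa> u)"
    unfolding taylor_def[abs_def] by (intro S smooth_on_const) auto
  have Hs: "H $ k $ m = H $ m $ k" for k m using transpose_component[of H m k] H by simp
  have quad: "partial m (\<lambda>y. \<Sum>k\<in>UNIV. y $ k * (H $ k \<bullet> y)) = (\<lambda>y. 2 * (H $ m \<bullet> y))" for m
  proof
    fix y
    have "partial m (\<lambda>y. \<Sum>k\<in>UNIV. y $ k * (H $ k \<bullet> y)) y =
        (\<Sum>k\<in>UNIV. y $ k * H $ k $ m + (if k = m then H $ k \<bullet> y else 0))"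
      by (subst partial_sum_smooth) (auto intro!: S sum.cong simp: partial_mult_smooth S partial_inner)
    also have "\<dots> = 2 * (H $ m \<bullet> y)"
      by (simp add: sum.distrib inner_vec_def Hs[of _ m] mult.commute)
    finally show "partial m (\<lambda>y. \<Sum>k\<in>UNIV. y $ k * (H $ k \<bullet> y)) y = 2 * (H $ m \<bullet> y)" .
  qed
  have sq: "partial m (\<lambda>y. (u \<bullet> y) * (u \<bullet> y)) = (\<lambda>y. 2 * u $ m * (u \<bullet> y))" for m
    by (simp add: partial_mult_smooth S partial_inner fun_eq_iff)
  have cube: "partial m (\<lambda>y. (u \<bullet> y) * ((u \<bullet> y) * (u \<bullet> y))) = (\<lambda>y. 3 * u $ m * ((u \<bullet> y) * (u \<bullet> y)))" for m
    by (simp add: partial_mult_smooth[of "\<lambda>y. u \<bullet> y" "\<lambda>y. (u \<bullet> y) * (u \<bullet> y)"] S sq partial_inner fun_eq_iff)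
  show 1: "partial m (taylor H \<kappa> u) = (\<lambda>y. H $ m \<bullet> y + \<kappa> * u $ m / 2 * ((u \<bullet> y) * (u \<bullet> y)))" for m
    unfolding taylor_def[abs_def]
    by (subst partial_add_smooth, (intro S smooth_on_const; simp)+, subst partial_cmult_smooth,
        (intro S; simp)+, subst partial_cmult_smooth, (intro S; simp)+) (simp add: quad cube fun_eq_iff)
  show 2: "partial l (partial m (taylor H \<kappa> u)) = (\<lambda>y. H $ m $ l + \<kappa> * u $ m * u $ l * (u \<bullet> y))" for l m
    unfolding 1
    by (subst partial_add_smooth, (intro S smooth_on_const; simp)+, subst partial_cmult_smooth,
        (intro S; simp)+) (simp add: sq partial_inner fun_eq_iff)
  show "partial p (partial l (partial m (taylor H \<kappa> u))) = (\<lambda>y. \<kappa> * u $ m * u $ l * u $ p)"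
    unfolding 2
    by (subst partial_add_smooth, (intro S smooth_on_const; simp)+, subst partial_cmult_smooth,
        (intro S; simp)+) (simp add: partial_inner fun_eq_iff)
qed

definition taylor_matrix :: "real^'n::finite^'n^'n^'n \<Rightarrow> real \<Rightarrow> real^'n \<Rightarrow> real^'n \<Rightarrow> real^'n \<Rightarrow> real^'n^'n" where
  "taylor_matrix h s a u y = (\<chi> i j. taylor (h $ i $ j) (s * a $ i * a $ j) u y)"

text \<open>The quadratic correction makes this matrix congruent to \<open>b\<close>, see \<open>test_matrix_congruent\<close>.\<close>

definition test_matrix :: "real^'n::finite^'n \<Rightarrow> real^'n^'n^'n^'n \<Rightarrow> real \<Rightarrow> real^'n \<Rightarrow> real^'n \<Rightarrow> real^'n \<Rightarrow> real^'n^'n" where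
  "test_matrix b h s a u y = b + taylor_matrix h s a u y +
     (1 / 4) *\<^sub>R (taylor_matrix h s a u y ** matrix_inv b ** taylor_matrix h s a u y)"

lemma matrix_add_rdistrib: "((B + C) :: real^'n::finite^'m::finite) ** A = (B ** A) + (C ** A)"
  by (simp add: vec_eq_iff matrix_matrix_mult_def sum.distrib distrib_right)

text \<open>Completing the square. As \<open>has_signature\<close> is defined by congruence, this
  controls the signature through the invertibility of one explicit factor, with no appeal to the
  stability of the signature under small perturbations.\<close>

lemma test_matrix_congruent:
  fixes b K :: "real^'n::finite^'n"
  assumes b: "invertible b" "transpose b = b" and K: "transpose K = K"
  shows "b + K + (1 / 4) *\<^sub>R (K ** matrix_inv b ** K) =
    (mat 1 + (1 / 2) *\<^sub>R (K ** matrix_inv b)) ** b ** transpose (mat 1 + (1 / 2) *\<^sub>R (K ** matrix_inv b))"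
proof -
  let ?B = "matrix_inv b"
  have "transpose ?B ** b = mat 1"
    using matrix_inv_right[OF b(1)] b(2) by (metis matrix_transpose_mul transpose_mat)
  then have B: "transpose ?B = ?B"
    using matrix_inv_right[OF b(1)] by (metis matrix_mul_assoc matrix_mul_lid matrix_mul_rid)
  have "transpose (mat 1 + (1 / 2) *\<^sub>R (K ** ?B)) = mat 1 + (1 / 2) *\<^sub>R (?B ** K)"
    by (simp add: vec_eq_iff transpose_def mat_def) (metis B K matrix_transpose_mul transpose_component)
  then have "(mat 1 + (1 / 2) *\<^sub>R (K ** ?B)) ** b ** transpose (mat 1 + (1 / 2) *\<^sub>R (K ** ?B)) =
      (b + (1 / 2) *\<^sub>R (K ** (?B ** b))) ** (mat 1 + (1 / 2) *\<^sub>R (?B ** K))"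
    by (simp add: matrix_add_rdistrib scalar_matrix_assoc[symmetric] matrix_mul_assoc)
  also have "\<dots> = b + (1 / 2) *\<^sub>R ((b ** ?B) ** K) + (1 / 2) *\<^sub>R K + (1 / 4) *\<^sub>R (K ** ?B ** K)"
    using b(1) by (simp add: matrix_inv_left matrix_add_rdistrib matrix_add_ldistrib
        scalar_matrix_assoc[symmetric] matrix_scalar_ac matrix_mul_assoc scaleR_add_right)
  also have "\<dots> = b + K + (1 / 4) *\<^sub>R (K ** ?B ** K)"
    using b(1) by (simp add: matrix_inv_right vec_eq_iff)
  finally show ?thesis by simp
qed

lemma transpose_slice: "h \<in> sym4 \<Longrightarrow> transpose (h $ i $ j) = h $ i $ j"
  by (simp add: sym4_def vec_eq_iff transpose_def)

lemma transpose_taylor_matrix: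
  assumes "h \<in> sym4"
  shows "transpose (taylor_matrix h s a u y) = taylor_matrix h s a u y"
proof -
  have "h $ j $ i = h $ i $ j" for i j using assms by (simp add: sym4_def vec_eq_iff)
  then have "taylor (h $ j $ i) (s * a $ j * a $ i) u y = taylor (h $ i $ j) (s * a $ i * a $ j) u y" for i j
    by (metis mult.assoc mult.commute)
  then show ?thesis by (simp add: taylor_matrix_def transpose_def vec_eq_iff)
qed

lemma flat1_taylor: "transpose H = H \<Longrightarrow> flat1 (taylor H \<kappa> u)"
  by (simp add: flat1_def smooth_taylor partial_taylor) (simp add: taylor_def)

lemma test_matrix_entry:
  assumes h: "h \<in> sym4"
  shows "\<exists>r. flat3 r \<and> (\<lambda>y. test_matrix b h s a u y $ i $ j) =
    (\<lambda>y. b $ i $ j + (taylor (h $ i $ j) (s * a $ i * a $ j) u y + r y))"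
proof -
  let ?k = "\<lambda>i j. taylor (h $ i $ j) (s * a $ i * a $ j) u"
  let ?r = "\<lambda>y. 1 / 4 * (\<Sum>q\<in>UNIV. \<Sum>p\<in>UNIV. matrix_inv b $ p $ q * (?k i p y * ?k q j y))"
  have "flat3 ?r"
    by (intro flat3_cmult flat3_sum flat3_mult flat1_taylor transpose_slice h)
  moreover have "(\<lambda>y. test_matrix b h s a u y $ i $ j) = (\<lambda>y. b $ i $ j + (?k i j y + ?r y))"
    by (simp add: fun_eq_iff test_matrix_def taylor_matrix_def matrix_matrix_mult_def
        sum_distrib_left sum_distrib_right mult_ac)
  ultimately show ?thesis by blast
qed

lemma
  assumes h: "h \<in> sym4"
  shows smooth_test_matrix: "smooth_on UNIV (\<lambda>y. test_matrix b h s a u y $ i $ j)"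
    and partial_test_matrix: "partial k (\<lambda>y. test_matrix b h s a u y $ i $ j) 0 = 0"
    and partial2_test_matrix: "partial l (partial k (\<lambda>y. test_matrix b h s a u y $ i $ j)) 0 = h $ i $ j $ k $ l"
    and partial3_test_matrix: "partial m (partial l (partial k (\<lambda>y. test_matrix b h s a u y $ i $ j))) 0 =
      s * u $ m * direction a u $ i $ j $ k $ l"
    and test_matrix_0: "test_matrix b h s a u 0 = b"
proof -
  have sl: "transpose (h $ i $ j) = h $ i $ j" by (rule transpose_slice[OF h])
  obtain r where r: "flat3 r" "(\<lambda>y. test_matrix b h s a u y $ i $ j) =
    (\<lambda>y. b $ i $ j + (taylor (h $ i $ j) (s * a $ i * a $ j) u y + r y))"
    using test_matrix_entry[OF h] by blast
  note P = partials_flat_perturbation[OF smooth_taylor[OF sl] r(1)]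
  show "smooth_on UNIV (\<lambda>y. test_matrix b h s a u y $ i $ j)"
    "partial k (\<lambda>y. test_matrix b h s a u y $ i $ j) 0 = 0"
    "partial l (partial k (\<lambda>y. test_matrix b h s a u y $ i $ j)) 0 = h $ i $ j $ k $ l"
    "partial m (partial l (partial k (\<lambda>y. test_matrix b h s a u y $ i $ j))) 0 =
      s * u $ m * direction a u $ i $ j $ k $ l"
    unfolding r(2) P(2-4)
    subgoal by (rule P(1))
    subgoal by (simp add: partial_taylor[OF sl])
    subgoal by (simp add: partial2_taylor[OF sl])
    subgoal by (simp add: partial3_taylor[OF sl] direction_def mult_ac)
    done
  show "test_matrix b h s a u 0 = b"
    by (simp add: test_matrix_def taylor_matrix_def taylor_def vec_eq_iff matrix_matrix_mult_def)
qed

section \<open>Signature and jets of the test metrics\<close>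

lemma continuous_on_det:
  fixes A :: "'v::topological_space \<Rightarrow> real^'n::finite^'n"
  assumes "\<And>i j. continuous_on S (\<lambda>y. A y $ i $ j)"
  shows "continuous_on S (\<lambda>y. det (A y))"
  unfolding det_def by (intro continuous_intros assms)

text \<open>The factor of the congruence to \<open>b\<close> is the identity at the origin, and the
  nonvanishing of its determinant is an open condition.\<close>

lemma test_matrix_signature:
  fixes b :: "real^'n::finite^'n"
  assumes h: "h \<in> sym4" and b: "has_signature \<sigma> b" "transpose b = b"
  shows "\<exists>R. open R \<and> 0 \<in> R \<and> (\<forall>y\<in>R. has_signature \<sigma> (test_matrix b h s a u y) \<and>
    transpose (test_matrix b h s a u y) = test_matrix b h s a u y)"
proof -
  let ?N = "\<lambda>y. mat 1 + (1 / 2) *\<^sub>R (taylor_matrix h s a u y ** matrix_inv b)"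
  have eq: "test_matrix b h s a u y = ?N y ** b ** transpose (?N y)" for y
    unfolding test_matrix_def
    by (rule test_matrix_congruent[OF has_signature_invertible[OF b(1)] b(2) transpose_taylor_matrix[OF h]])
  have Kc: "continuous_on UNIV (taylor (h $ i $ p) \<kappa> u)" for i p \<kappa>
    by (rule smooth_on_continuous_on[OF smooth_taylor[OF transpose_slice[OF h]]])
  have "(\<lambda>y. ?N y $ i $ j) = (\<lambda>y. mat 1 $ i $ j +
      1 / 2 * (\<Sum>p\<in>UNIV. taylor (h $ i $ p) (s * a $ i * a $ p) u y * matrix_inv b $ p $ j))" for i j
    by (simp add: fun_eq_iff matrix_matrix_mult_def taylor_matrix_def)
  then have "continuous_on UNIV (\<lambda>y. ?N y $ i $ j)" for i j
    by (simp only:) (intro continuous_intros Kc)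
  then have cont: "continuous_on UNIV (\<lambda>y. det (?N y))" by (rule continuous_on_det)
  let ?R = "{y. det (?N y) \<noteq> 0}"
  have "open ?R" using open_vimage[OF open_Compl[OF closed_singleton[of 0]] cont] by (simp add: vimage_def)
  moreover have "?N 0 = mat 1"
    by (simp add: taylor_matrix_def taylor_def vec_eq_iff matrix_matrix_mult_def)
  then have "0 \<in> ?R" by simp
  moreover have "has_signature \<sigma> (test_matrix b h s a u y)" if "y \<in> ?R" for y
  proof -
    have "invertible (?N y)" using that by (simp add: invertible_det_nz)
    then obtain M where "?N y ** M = mat 1" "M ** ?N y = mat 1" unfolding invertible_def by blast
    from has_signature_congruence[OF b(1) this] show ?thesis unfolding eq .
  qed
  moreover have "transpose (test_matrix b h s a u y) = test_matrix b h s a u y" for y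
    unfolding eq by (simp only: matrix_transpose_mul transpose_transpose b(2) matrix_mul_assoc)
  ultimately show ?thesis by blast
qed

definition test_jet :: "real^'n::finite^'n \<Rightarrow> real^'n^'n^'n^'n \<Rightarrow> real \<Rightarrow> real^'n \<Rightarrow> real^'n \<Rightarrow> real^'n \<Rightarrow> 'n jet_coordinates" where
  "test_jet b h s a u y = (y, test_matrix b h s a u y,
     \<chi> i j k. partial k (\<lambda>y. test_matrix b h s a u y $ i $ j) y,
     \<chi> i j k l. partial l (partial k (\<lambda>y. test_matrix b h s a u y $ i $ j)) y)"

lemma smooth_test_jet:
  fixes h :: "real^'n::finite^'n^'n^'n"
  assumes h: "h \<in> sym4"
  shows "smooth_on UNIV (test_jet b h s a u)"
proof -
  have "smooth_on UNIV (\<lambda>y. \<chi> i j. test_matrix b h s a u y $ i $ j)"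
    by (intro smooth_on_vec_lambda smooth_test_matrix h) auto
  then have 1: "smooth_on UNIV (\<lambda>y. test_matrix b h s a u y)" by simp
  have 2: "smooth_on UNIV (\<lambda>y. \<chi> i j k. partial k (\<lambda>y. test_matrix b h s a u y $ i $ j) y)"
    by (intro smooth_on_vec_lambda smooth_on_partial[OF smooth_test_matrix[OF h]]) auto
  have 3: "smooth_on UNIV (\<lambda>y. \<chi> i j k l. partial l (partial k (\<lambda>y. test_matrix b h s a u y $ i $ j)) y)"
    by (intro smooth_on_vec_lambda smooth_on_partial[OF smooth_on_partial[OF smooth_test_matrix[OF h]]]) auto
  show ?thesis
    unfolding test_jet_def[abs_def]
    by (intro smooth_on_Pair smooth_on_linear bounded_linear_ident 1 2 3) auto
qed

lemma test_jet_0: "h \<in> sym4 \<Longrightarrow> test_jet b h s a u 0 = (0, b, 0, h)"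
  by (simp add: test_jet_def test_matrix_0 partial_test_matrix partial2_test_matrix vec_eq_iff)

text \<open>The parameter \<open>s\<close> enters the last slot only, which holds the third
  derivatives of the metric. The factor \<open>u $ p\<close> there is what turns the sum over the
  last index in the divergence into a contraction of \<open>T\<close> with \<open>u\<close>.\<close>

lemma frechet_derivative_test_jet:
  fixes h :: "real^'n::finite^'n^'n^'n"
  assumes h: "h \<in> sym4"
  shows "frechet_derivative (test_jet b h s a u) (at 0) (axis p 1) =
    (axis p 1, 0, (\<chi> i j k. h $ i $ j $ k $ p), (s * u $ p) *\<^sub>R direction a u)"
proof -
  let ?J = "test_jet b h s a u"
  let ?D = "frechet_derivative ?J (at 0)"
  have D: "(?J has_derivative ?D) (at 0)"
    by (rule smooth_on_has_derivative[OF smooth_test_jet[OF h]]) simp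
  note Ds = has_derivative_snd[OF D] has_derivative_snd[OF has_derivative_snd[OF D]]
    has_derivative_snd[OF has_derivative_snd[OF has_derivative_snd[OF D]]]
  note nth = bounded_linear.has_derivative[OF bounded_linear_vec_nth]
  have "((\<lambda>y. fst (?J y)) has_derivative (\<lambda>v. fst (?D v))) (at 0)" by (rule has_derivative_fst[OF D])
  moreover have "((\<lambda>y. fst (?J y)) has_derivative (\<lambda>v. v)) (at 0)" by (simp add: test_jet_def)
  ultimately have "(\<lambda>v. fst (?D v)) = (\<lambda>v. v)" by (rule has_derivative_unique)
  then have 1: "fst (?D (axis p 1)) = axis p 1" by metis
  have "partial p (\<lambda>y. fst (snd (?J y)) $ i $ j) 0 = fst (snd (?D (axis p 1))) $ i $ j" for i j
    by (rule has_derivative_partial[OF nth[OF nth[OF has_derivative_fst[OF Ds(1)]]]])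
  then have 2: "fst (snd (?D (axis p 1))) = 0"
    by (simp add: test_jet_def vec_eq_iff partial_test_matrix[OF h])
  have "partial p (\<lambda>y. fst (snd (snd (?J y))) $ i $ j $ k) 0 = fst (snd (snd (?D (axis p 1)))) $ i $ j $ k" for i j k
    by (rule has_derivative_partial[OF nth[OF nth[OF nth[OF has_derivative_fst[OF Ds(2)]]]]])
  then have 3: "fst (snd (snd (?D (axis p 1)))) = (\<chi> i j k. h $ i $ j $ k $ p)"
    by (simp add: test_jet_def vec_eq_iff partial2_test_matrix[OF h])
  have "partial p (\<lambda>y. snd (snd (snd (?J y))) $ i $ j $ k $ l) 0 = snd (snd (snd (?D (axis p 1)))) $ i $ j $ k $ l" for i j k l
    by (rule has_derivative_partial[OF nth[OF nth[OF nth[OF nth[OF Ds(3)]]]]])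
  then have 4: "snd (snd (snd (?D (axis p 1)))) = (s * u $ p) *\<^sub>R direction a u"
    by (simp add: test_jet_def vec_eq_iff partial3_test_matrix[OF h])
  show ?thesis using 1 2 3 4 by (simp add: prod_eq_iff)
qed

section \<open>Divergence-free tensors are polynomial in the second derivatives\<close>

context manifold
begin

definition test_metric :: "('a, 'n) chart \<Rightarrow> real^'n^'n \<Rightarrow> real^'n^'n^'n^'n \<Rightarrow> real \<Rightarrow> real^'n \<Rightarrow> real^'n \<Rightarrow> ('a, 'n) field" where
  "test_metric c b h s a u = chart_metric c (test_matrix b h s a u)"

lemma test_metric_on:
  assumes c: "c \<in> charts_at \<A> x" "cmap c x = 0" and h: "h \<in> sym4"
    and b: "has_signature \<sigma> b" "transpose b = b"
  shows "\<exists>W. openin X W \<and> x \<in> W \<and> W \<subseteq> cdom c \<and> metric_on \<A> \<sigma> W (test_metric c b h s a u)"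
proof -
  have c': "c \<in> \<A>" "x \<in> cdom c" using c charts_at_atlas by auto
  obtain R where R: "open R" "0 \<in> R" "\<forall>y\<in>R. has_signature \<sigma> (test_matrix b h s a u y) \<and>
      transpose (test_matrix b h s a u y) = test_matrix b h s a u y"
    using test_matrix_signature[OF h b, of s a u] by (elim exE conjE)
  let ?W = "{z \<in> topspace (subtopology X (cdom c)). cmap c z \<in> R}"
  have "openin (subtopology X (cdom c)) ?W"
    by (rule openin_continuous_map_preimage[OF continuous_map_cmap[OF c'(1)]]) (simp add: R(1))
  then have W: "openin X ?W" using openin_open_subtopology[OF openin_cdom[OF c'(1)]] by blast
  have sub: "?W \<subseteq> cdom c" by auto
  have "metric_on \<A> \<sigma> ?W (test_metric c b h s a u)"
    unfolding test_metric_def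
  proof (rule metric_on_chart_metric[OF c'(1) W sub])
    show "smooth_on (cmap c ` ?W) (\<lambda>y. test_matrix b h s a u y $ i $ j)" for i j
      by (rule smooth_on_mono[OF smooth_test_matrix[OF h] subset_UNIV])
  qed (auto simp: R)
  moreover have "x \<in> ?W" using c' c(2) R(2) cdom_subset[OF c'(1)] by auto
  ultimately show ?thesis using W sub by (intro exI[of _ ?W] conjI)
qed

lemma test_metric_near:
  assumes "c \<in> charts_at \<A> x" "cmap c x = 0" "h \<in> sym4" "has_signature \<sigma> b" "transpose b = b"
  shows "metric_near X \<A> \<sigma> x (test_metric c b h s a u)"
  using test_metric_on[OF assms] unfolding metric_near_def by blast

lemma jet_coords_test_metric:
  assumes c: "c \<in> \<A>" and z: "z \<in> cdom c"
  shows "jet_coords c z (test_metric c b h s a u) = test_jet b h s a u (cmap c z)"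
proof -
  let ?\<Omega> = "cmap c ` cdom c"
  have \<Omega>: "open ?\<Omega>" "cmap c z \<in> ?\<Omega>" using open_cmap_cdom[OF c] z by auto
  have comp: "components c (test_metric c b h s a u) [i, j] y = test_matrix b h s a u y $ i $ j" if "y \<in> ?\<Omega>" for i j y
    unfolding test_metric_def by (rule components_chart_metric[OF c that])
  have p1: "partial k (components c (test_metric c b h s a u) [i, j]) y = partial k (\<lambda>y. test_matrix b h s a u y $ i $ j) y"
    if "y \<in> ?\<Omega>" for i j k y
    by (rule partial_cong_open[OF \<Omega>(1) that comp])
  have p2: "second_partials c (test_metric c b h s a u) z i j k l =
      partial l (partial k (\<lambda>y. test_matrix b h s a u y $ i $ j)) (cmap c z)" for i j k l
    unfolding second_partials_def by (rule partial_cong_open[OF \<Omega> p1])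
  have "gram (test_metric c b h s a u z c) = test_matrix b h s a u (cmap c z)"
    unfolding test_metric_def using c z by (simp add: gram_def chart_metric_self charts_at_def)
  then show ?thesis by (simp add: jet_coords_def test_jet_def p1[OF \<Omega>(2)] p2)
qed

text \<open>The function in \<open>second_order_tensor\<close> is smooth only in the sense of local
  extensions. Differentiating \<open>T\<close> needs a function that is smooth on an open set and
  serves all metrics and points with jets in that set at once.\<close>

lemma local_representation:
  assumes T: "second_order_tensor X \<A> \<sigma> m T" and c: "c \<in> \<A>" and I: "I \<in> multi_indices m"
    and g: "x \<in> cdom c" "metric_near X \<A> \<sigma> x g"
  obtains W F where "open W" "jet_coords c x g \<in> W" "smooth_on W F"
    "\<And>z k. z \<in> cdom c \<Longrightarrow> metric_near X \<A> \<sigma> z k \<Longrightarrow> jet_coords c z k \<in> W \<Longrightarrow>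
      T (jet2 X \<A> \<sigma> z k) c I = F (jet_coords c z k)"
proof -
  let ?S = "{jet_coords c x g | x g. x \<in> cdom c \<and> metric_near X \<A> \<sigma> x g}"
  obtain F where F: "smooth_on_subset ?S F"
    "\<forall>x g. x \<in> cdom c \<and> metric_near X \<A> \<sigma> x g \<longrightarrow> T (jet2 X \<A> \<sigma> x g) c I = F (jet_coords c x g)"
    using bspec[OF bspec[OF conjunct2[OF T[unfolded second_order_tensor_def]] c] I] by (elim exE conjE)
  have jS: "jet_coords c z k \<in> ?S" if "z \<in> cdom c" "metric_near X \<A> \<sigma> z k" for z k using that by blast
  obtain W F' where W: "open W" "jet_coords c x g \<in> W" "smooth_on W F'" "\<forall>w\<in>?S \<inter> W. F' w = F w"
    using bspec[OF F(1)[unfolded smooth_on_subset_def] jS[OF g]] by (elim exE conjE)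
  show thesis
  proof (rule that[OF W(1-3)])
    fix z k assume "z \<in> cdom c" "metric_near X \<A> \<sigma> z k" "jet_coords c z k \<in> W"
    then show "T (jet2 X \<A> \<sigma> z k) c I = F' (jet_coords c z k)"
      using F(2)[rule_format, of z k] bspec[OF W(4), of "jet_coords c z k"] jS[of z k] by simp
  qed
qed

text \<open>A component of \<open>T\<close> as a function of the second derivatives alone, the value
  of the metric at \<open>x\<close> being \<open>b\<close> and its first derivatives zero. The test
  metric without cubic term is a convenient representative; \<open>tensor_at_eq\<close> shows that
  the choice is immaterial.\<close>

definition tensor_at :: "nat \<times> nat \<Rightarrow> (('a, 'n) jet \<Rightarrow> ('a, 'n) tensor) \<Rightarrow> ('a, 'n) chart \<Rightarrow> 'a \<Rightarrow> real^'n^'n \<Rightarrow>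
    'n list \<Rightarrow> real^'n^'n^'n^'n \<Rightarrow> real" where
  "tensor_at \<sigma> T c x b I h = T (jet2 X \<A> \<sigma> x (test_metric c b h 0 0 0)) c I"

text \<open>Jets are compared in all charts, but the function that
  \<open>second_order_tensor\<close> attaches to the single chart \<open>c\<close> already
  determines the component from the coordinates in \<open>c\<close>. So agreement in one chart is
  enough.\<close>

lemma tensor_at_eq:
  assumes T: "second_order_tensor X \<A> \<sigma> m T" and c: "c \<in> charts_at \<A> x" "cmap c x = 0"
    and b: "has_signature \<sigma> b" "transpose b = b" and I: "I \<in> multi_indices m" and h: "h \<in> sym4"
    and g: "metric_near X \<A> \<sigma> x g" "jet_coords c x g = (0, b, 0, h)"
  shows "T (jet2 X \<A> \<sigma> x g) c I = tensor_at \<sigma> T c x b I h"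
proof -
  have c': "c \<in> \<A>" "x \<in> cdom c" using c charts_at_atlas by auto
  obtain F where F: "\<forall>x g. x \<in> cdom c \<and> metric_near X \<A> \<sigma> x g \<longrightarrow> T (jet2 X \<A> \<sigma> x g) c I = F (jet_coords c x g)"
    using bspec[OF bspec[OF conjunct2[OF T[unfolded second_order_tensor_def]] c'(1)] I] by (elim exE conjE)
  show ?thesis
    using F[rule_format, of x g] F[rule_format, of x "test_metric c b h 0 0 0"] g c' test_metric_near[OF c h b]
    by (simp add: tensor_at_def jet_coords_test_metric test_jet_0[OF h] c(2))
qed

text \<open>One extension \<open>F\<close> has to be used twice, for the derivative along the base
  point in the divergence and for the derivative in \<open>h\<close>; therefore both descriptions of
  \<open>T\<close> are stated for the same \<open>W\<close> and \<open>F\<close>.\<close>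

lemma tensor_at_local:
  assumes T: "second_order_tensor X \<A> \<sigma> m T" and c: "c \<in> charts_at \<A> x" "cmap c x = 0"
    and b: "has_signature \<sigma> b" "transpose b = b" and I: "I \<in> multi_indices m" and h: "h \<in> sym4"
  shows "\<exists>W F. open W \<and> (0, b, 0, h) \<in> W \<and> smooth_on W F \<and>
    (\<forall>z g. z \<in> cdom c \<longrightarrow> metric_near X \<A> \<sigma> z g \<longrightarrow> jet_coords c z g \<in> W \<longrightarrow>
      T (jet2 X \<A> \<sigma> z g) c I = F (jet_coords c z g)) \<and>
    (\<forall>h'\<in>sym4. (0, b, 0, h') \<in> W \<longrightarrow> tensor_at \<sigma> T c x b I h' = F (0, b, 0, h'))"
proof -
  have c': "c \<in> \<A>" "x \<in> cdom c" using c charts_at_atlas by auto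
  have j: "jet_coords c x (test_metric c b h' s a u) = (0, b, 0, h')" if "h' \<in> sym4" for h' s a u
    using jet_coords_test_metric[OF c'] test_jet_0[OF that] c(2) by simp
  obtain W F where W: "open W" "jet_coords c x (test_metric c b h 0 0 0) \<in> W" "smooth_on W F"
    "\<And>z k. z \<in> cdom c \<Longrightarrow> metric_near X \<A> \<sigma> z k \<Longrightarrow> jet_coords c z k \<in> W \<Longrightarrow>
      T (jet2 X \<A> \<sigma> z k) c I = F (jet_coords c z k)"
    using local_representation[OF T c'(1) I c'(2) test_metric_near[OF c h b]] by metis
  show ?thesis
  proof (intro exI[of _ W] exI[of _ F] conjI allI impI ballI W(1,3,4))
    show "(0, b, 0, h) \<in> W" using W(2) j[OF h] by simp
    fix h' assume h': "h' \<in> sym4" "(0, b, 0, h') \<in> W"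
    show "tensor_at \<sigma> T c x b I h' = F (0, b, 0, h')"
      unfolding tensor_at_def using W(4)[OF c'(2) test_metric_near[OF c h'(1) b]] h'
      by (simp add: j)
  qed
qed

lemma continuous_on_tensor_at:
  assumes "second_order_tensor X \<A> \<sigma> m T" "c \<in> charts_at \<A> x" "cmap c x = 0"
    and "has_signature \<sigma> b" "transpose b = b" "I \<in> multi_indices m"
  shows "continuous_on sym4 (tensor_at \<sigma> T c x b I)"
  unfolding continuous_on_eq_continuous_within
proof
  fix h :: "real^'n^'n^'n^'n" assume h: "h \<in> sym4"
  obtain W and F :: "'n jet_coordinates \<Rightarrow> real" where W: "open W" "(0, b, 0, h) \<in> W" "smooth_on W F"
    and F: "\<forall>h'\<in>sym4. (0, b, 0, h') \<in> W \<longrightarrow> tensor_at \<sigma> T c x b I h' = F (0, b, 0, h')"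
    using tensor_at_local[OF assms h] by (elim exE conjE) (rule that; assumption)
  let ?j = "\<lambda>h. (0, b, 0, h) :: 'n jet_coordinates"
  have cj: "continuous_on UNIV ?j" by (intro continuous_intros)
  have O: "open (?j -` W)" by (rule open_vimage[OF W(1) cj])
  have "continuous_on (?j -` W) (\<lambda>h. F (?j h))"
    by (rule continuous_on_compose2[OF smooth_on_continuous_on[OF W(3)] continuous_on_subset[OF cj]]) auto
  then have "isCont (\<lambda>h. F (?j h)) h" using O W(2) by (simp add: continuous_on_eq_continuous_at)
  then have "continuous (at h within sym4) (\<lambda>h. F (?j h))" by (rule continuous_at_imp_continuous_within)
  then show "continuous (at h within sym4) (tensor_at \<sigma> T c x b I)"
  proof (rule continuous_transform_within_openin)
    show "openin (top_of_set sym4) (sym4 \<inter> ?j -` W)" using O by (rule openin_open_Int)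
  qed (use W F h in auto)
qed

lemma christoffel_zero:
  assumes "jet_coords c x g = (y, b, 0, h)"
  shows "christoffel c g x i j k = 0"
proof -
  have "(\<chi> i j k. partial k (components c g [i, j]) (cmap c x)) = 0"
    using assms unfolding jet_coords_def prod.inject by (elim conjE)
  then have "partial k (components c g [i, j]) (cmap c x) = 0" for i j k
    by (simp add: vec_eq_iff)
  then show ?thesis by (simp add: christoffel_def)
qed

text \<open>The first derivatives of the metric vanish at \<open>x\<close>, so the Christoffel terms
  drop out and the chain rule along \<open>test_jet\<close> gives the partial derivatives. The
  extensions \<open>F k\<close> are independent of \<open>s\<close>, \<open>a\<close> and
  \<open>u\<close>, so that different test metrics can be compared.\<close>

lemma divergence_test_metric:
  assumes c: "c \<in> charts_at \<A> x" "cmap c x = 0" and b: "has_signature \<sigma> b" "transpose b = b" and h: "h \<in> sym4"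
    and div: "divergence_free X \<A> \<sigma> p T" and J: "J \<in> multi_indices (p - 1)"
    and W: "\<And>k. open (W k)" "\<And>k. (0, b, 0, h) \<in> W k" "\<And>k. smooth_on (W k) (F k)"
    and F: "\<And>k z g. z \<in> cdom c \<Longrightarrow> metric_near X \<A> \<sigma> z g \<Longrightarrow> jet_coords c z g \<in> W k \<Longrightarrow>
      T (jet2 X \<A> \<sigma> z g) c (J @ [k]) = F k (jet_coords c z g)"
  shows "(\<Sum>k\<in>UNIV. frechet_derivative (F k) (at (0, b, 0, h))
    (axis k 1, 0, (\<chi> i j l. h $ i $ j $ l $ k), (s * u $ k) *\<^sub>R direction a u)) = 0"
proof -
  have c': "c \<in> \<A>" "x \<in> cdom c" using c charts_at_atlas by auto
  let ?g = "test_metric c b h s a u" and ?j = "test_jet b h s a u"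
  obtain V where V: "openin X V" "x \<in> V" "V \<subseteq> cdom c" "metric_on \<A> \<sigma> V ?g"
    using test_metric_on[OF c h b] by blast
  have j0: "?j 0 = (0, b, 0, h)" by (rule test_jet_0[OF h])
  have dj: "(?j has_derivative frechet_derivative ?j (at 0)) (at 0)"
    by (rule smooth_on_has_derivative[OF smooth_test_jet[OF h]]) simp
  have "partial k (components c (\<lambda>z. T (jet2 X \<A> \<sigma> z ?g)) (J @ [k])) 0 =
      frechet_derivative (F k) (at (0, b, 0, h)) (axis k 1, 0, (\<chi> i j l. h $ i $ j $ l $ k), (s * u $ k) *\<^sub>R direction a u)" for k
  proof -
    let ?O = "cmap c ` (cdom c \<inter> V) \<inter> ?j -` W k"
    have "open (?j -` W k)"
      by (rule open_vimage[OF W(1) smooth_on_continuous_on[OF smooth_test_jet[OF h]]])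
    then have O: "open ?O" "0 \<in> ?O"
      using open_cmap_image[OF c'(1) V(1)] W(2)[of k] j0 c' V(2) c(2)
      by (auto simp: image_iff intro!: bexI[of _ x])
    have "components c (\<lambda>z. T (jet2 X \<A> \<sigma> z ?g)) (J @ [k]) y = F k (?j y)" if y: "y \<in> ?O" for y
    proof -
      obtain z where z: "z \<in> cdom c" "z \<in> V" "y = cmap c z" using y by auto
      have "metric_near X \<A> \<sigma> z ?g" using V z(2) unfolding metric_near_def by blast
      then show ?thesis
        using F[where g="?g" and k=k, OF z(1)] y z c'(1) by (simp add: components_def jet_coords_test_metric)
    qed
    then have "partial k (components c (\<lambda>z. T (jet2 X \<A> \<sigma> z ?g)) (J @ [k])) 0 = partial k (\<lambda>y. F k (?j y)) 0"
      by (rule partial_cong_open[OF O])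
    also have "\<dots> = frechet_derivative (F k) (at (?j 0)) (frechet_derivative ?j (at 0) (axis k 1))"
      by (intro has_derivative_partial has_derivative_compose[OF dj] smooth_on_has_derivative[OF W(3)])
        (simp add: j0 W(2))
    finally show ?thesis by (simp add: j0 frechet_derivative_test_jet[OF h])
  qed
  moreover have "christoffel c ?g x i j k = 0" for i j k
    using jet_coords_test_metric[OF c'] j0 c(2) by (intro christoffel_zero) simp
  moreover have "divergence c ?g (\<lambda>z. T (jet2 X \<A> \<sigma> z ?g)) x J = 0"
    using div V(1,2,4) c(1) J unfolding divergence_free_def by blast
  ultimately show ?thesis by (simp add: divergence_def cov_deriv_def c(2))
qed

lemma tensor_at_derivative:
  assumes T: "second_order_tensor X \<A> \<sigma> p T" and div: "divergence_free X \<A> \<sigma> p T" and p: "p \<ge> 1"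
    and c: "c \<in> charts_at \<A> x" "cmap c x = 0" and b: "has_signature \<sigma> b" "transpose b = b"
    and h: "h \<in> sym4" and J: "J \<in> multi_indices (p - 1)"
  shows "((\<lambda>t. \<Sum>k\<in>UNIV. u $ k * tensor_at \<sigma> T c x b (J @ [k]) (h + t *\<^sub>R direction a u)) has_real_derivative 0) (at t)"
proof -
  let ?d = "direction a u"
  \<comment> \<open>The derivative has to vanish at every point of the line, so the extensions are
    centred at the point with parameter \<open>t\<close>.\<close>
  define h0 where "h0 = h + t *\<^sub>R ?d"
  have hd: "h + r *\<^sub>R ?d \<in> sym4" for r
    by (intro subspace_add[OF subspace_sym4] subspace_scale[OF subspace_sym4] h direction_sym4)
  have h0: "h0 \<in> sym4" unfolding h0_def by (rule hd)
  have Jk: "J @ [k] \<in> multi_indices p" for k using J p by (simp add: multi_indices_def)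
  have "\<exists>W F. open W \<and> (0, b, 0, h0) \<in> W \<and> smooth_on W F \<and>
    (\<forall>z g. z \<in> cdom c \<longrightarrow> metric_near X \<A> \<sigma> z g \<longrightarrow> jet_coords c z g \<in> W \<longrightarrow>
      T (jet2 X \<A> \<sigma> z g) c (J @ [k]) = F (jet_coords c z g)) \<and>
    (\<forall>h'\<in>sym4. (0, b, 0, h') \<in> W \<longrightarrow> tensor_at \<sigma> T c x b (J @ [k]) h' = F (0, b, 0, h'))" for k
    by (rule tensor_at_local[OF T c b Jk[of k] h0])
  then obtain W F where W: "\<And>k. open (W k)" "\<And>k. (0, b, 0, h0) \<in> W k" "\<And>k. smooth_on (W k) (F k)"
    and F: "\<And>k z g. z \<in> cdom c \<Longrightarrow> metric_near X \<A> \<sigma> z g \<Longrightarrow> jet_coords c z g \<in> W k \<Longrightarrow>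
      T (jet2 X \<A> \<sigma> z g) c (J @ [k]) = F k (jet_coords c z g)"
    and A: "\<And>k h'. h' \<in> sym4 \<Longrightarrow> (0, b, 0, h') \<in> W k \<Longrightarrow> tensor_at \<sigma> T c x b (J @ [k]) h' = F k (0, b, 0, h')"
    by metis
  define D where "D = (\<lambda>k. frechet_derivative (F k) (at (0, b, 0, h0)))"
  have FD: "(F k has_derivative D k) (at (0, b, 0, h0))" for k
    unfolding D_def by (rule smooth_on_has_derivative[OF W(3,2)])
  have lin: "linear (D k)" for k using FD has_derivative_linear by blast
  let ?H = "\<lambda>k. (\<chi> i j l. h0 $ i $ j $ l $ k) :: real^'n^'n^'n"
  have "(\<Sum>k\<in>UNIV. D k (axis k 1, 0, ?H k, (s * u $ k) *\<^sub>R ?d)) = 0" for s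
    unfolding D_def by (rule divergence_test_metric[OF c b h0 div J W F])
  \<comment> \<open>Two metrics with the same 2-jet at \<open>x\<close>, whose third derivatives
    differ by the cubic term alone: subtraction removes the contributions of the base point and of
    the lower slots.\<close>
  from this[of 1] this[of 0]
  have "(\<Sum>k\<in>UNIV. D k (axis k 1, 0, ?H k, u $ k *\<^sub>R ?d) - D k (axis k 1, 0, ?H k, 0)) = 0"
    by (simp add: sum_subtractf)
  moreover have "D k (axis k 1, 0, ?H k, u $ k *\<^sub>R ?d) - D k (axis k 1, 0, ?H k, 0) = u $ k * D k (0, 0, 0, ?d)" for k
    using linear_diff[OF lin, of k "(axis k 1, 0, ?H k, u $ k *\<^sub>R ?d)" "(axis k 1, 0, ?H k, 0)"]
      linear_scale[OF lin, of k "u $ k" "(0, 0, 0, ?d)"] by simp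
  ultimately have zero: "(\<Sum>k\<in>UNIV. u $ k * D k (0, 0, 0, ?d)) = 0" by simp
  have "((\<lambda>r. tensor_at \<sigma> T c x b (J @ [k]) (h + r *\<^sub>R ?d)) has_real_derivative D k (0, 0, 0, ?d)) (at t)" for k
  proof -
    let ?l = "\<lambda>r::real. (0, b, 0, h + r *\<^sub>R ?d) :: 'n jet_coordinates"
    have "(?l has_derivative (\<lambda>r. (0, 0, 0, r *\<^sub>R ?d))) (at t)"
      by (auto intro!: derivative_eq_intros has_derivative_Pair)
    moreover have "(F k has_derivative D k) (at (?l t))" using FD[of k] by (simp add: h0_def)
    ultimately have "((\<lambda>r. F k (?l r)) has_derivative (\<lambda>r. D k (0, 0, 0, r *\<^sub>R ?d))) (at t)"
      by (rule has_derivative_compose)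
    moreover have "D k (0, 0, 0, r *\<^sub>R ?d) = D k (0, 0, 0, ?d) * r" for r
      using linear_scale[OF lin, of k r "(0, 0, 0, ?d)"] by (simp add: mult.commute)
    ultimately have d: "((\<lambda>r. F k (?l r)) has_real_derivative D k (0, 0, 0, ?d)) (at t)"
      by (simp add: has_field_derivative_def)
    have O: "open (?l -` W k)" by (rule open_vimage[OF W(1)]) (intro continuous_intros)
    show ?thesis
      by (rule has_field_derivative_transform_within_open[OF d O]) (use W(2)[of k] A hd in \<open>auto simp: h0_def\<close>)
  qed
  then have "((\<lambda>r. \<Sum>k\<in>UNIV. u $ k * tensor_at \<sigma> T c x b (J @ [k]) (h + r *\<^sub>R ?d)) has_real_derivative
      (\<Sum>k\<in>UNIV. u $ k * D k (0, 0, 0, ?d))) (at t)"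
    by (intro DERIV_sum DERIV_cmult)
  then show ?thesis by (simp only: zero)
qed

text \<open>Depends on the dimension only, hence is common to all points, metrics, charts and
  components; it becomes the \<open>m\<close> of the theorem.\<close>

definition degree_bound :: nat where
  "degree_bound = CARD('n \<times> 'n \<times> bool \<times> 'n \<times> 'n \<times> bool) * CARD('n)"

lemma tensor_at_polynomial:
  assumes T: "second_order_tensor X \<A> \<sigma> p T" and div: "divergence_free X \<A> \<sigma> p T" and p: "p \<ge> 1"
    and c: "c \<in> charts_at \<A> x" "cmap c x = 0" and b: "has_signature \<sigma> b" "transpose b = b"
    and I: "I \<in> multi_indices p"
  shows "\<exists>f. poly_upto (multi_indices 4) degree_bound f \<and> (\<forall>h\<in>sym4. tensor_at \<sigma> T c x b I h = f (coords4 h))"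
proof -
  obtain J k where J: "I = J @ [k]" "J \<in> multi_indices (p - 1)"
    using I p by (cases I rule: rev_cases) (auto simp: multi_indices_def)
  have Jk: "J @ [k] \<in> multi_indices p" for k using J p by (simp add: multi_indices_def)
  show ?thesis
    unfolding J(1) degree_bound_def
  proof (rule invariant_imp_polynomial[where \<phi>="\<lambda>k. tensor_at \<sigma> T c x b (J @ [k])"])
    show "continuous_on sym4 (tensor_at \<sigma> T c x b (J @ [k]))" for k
      by (rule continuous_on_tensor_at[OF T c b Jk])
    fix h :: "real^'n^'n^'n^'n" and a u :: "real^'n" and t assume h: "h \<in> sym4"
    have "(\<Sum>k\<in>UNIV. u $ k * tensor_at \<sigma> T c x b (J @ [k]) (h + t *\<^sub>R direction a u)) =
        (\<Sum>k\<in>UNIV. u $ k * tensor_at \<sigma> T c x b (J @ [k]) (h + 0 *\<^sub>R direction a u))"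
      by (rule DERIV_isconst_all) (use tensor_at_derivative[OF T div p c b h J(2)] in blast)
    then show "(\<Sum>k\<in>UNIV. u $ k * tensor_at \<sigma> T c x b (J @ [k]) (h + t *\<^sub>R direction a u)) =
        (\<Sum>k\<in>UNIV. u $ k * tensor_at \<sigma> T c x b (J @ [k]) h)" by simp
  qed
qed

end

section \<open>Extraction of the homogeneous parts\<close>

text \<open>\<open>V k i\<close> is the coefficient of degree \<open>k\<close> in the Lagrange
  polynomial of node \<open>i\<close>. The first identity says that interpolation reproduces
  monomials and serves to isolate one degree; the second evaluates the Lagrange polynomials at the
  nodes and serves to add the parts up again.\<close>

lemma inverse_vandermonde:
  fixes x :: "nat \<Rightarrow> real"
  assumes x: "inj_on x {..m}"
  shows "\<exists>V. (\<forall>k\<le>m. \<forall>l\<le>m. (\<Sum>i\<le>m. V k i * x i ^ l) = (if k = l then 1 else 0)) \<and>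
    (\<forall>i\<le>m. \<forall>j\<le>m. (\<Sum>k\<le>m. V k i * x j ^ k) = (if i = j then 1 else 0))"
proof -
  define P where "P = (\<lambda>i. \<Prod>j\<in>{..m} - {i}. [:- x j, 1:])"
  define \<l> where "\<l> = (\<lambda>i. smult (1 / poly (P i) (x i)) (P i))"
  have degP: "degree (P i) \<le> m" if "i \<le> m" for i
  proof -
    have "degree (P i) \<le> (\<Sum>j\<in>{..m} - {i}. 1)"
      unfolding P_def by (rule order_trans[OF degree_prod_sum_le]) auto
    then show ?thesis using that by simp
  qed
  have deg: "degree (\<l> i) \<le> m" if "i \<le> m" for i
    unfolding \<l>_def by (rule order_trans[OF degree_smult_le degP[OF that]])
  have val: "poly (\<l> i) (x j) = (if i = j then 1 else 0)" if "i \<le> m" "j \<le> m" for i j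
  proof (cases "i = j")
    case True
    have "poly (P i) (x i) \<noteq> 0"
      using inj_onD[OF x, of i] that by (auto simp: P_def poly_prod)
    then show ?thesis using True by (simp add: \<l>_def)
  next
    case False
    then have "poly (P i) (x j) = 0" using that by (auto simp: P_def poly_prod)
    then show ?thesis using False by (simp add: \<l>_def)
  qed
  have card: "card (x ` {..m}) = Suc m" using card_image[OF x] by simp
  have "(\<Sum>i\<le>m. coeff (\<l> i) k * x i ^ l) = (if k = l then 1 else 0)" if "k \<le> m" "l \<le> m" for k l
  proof -
    have "(\<Sum>i\<le>m. smult (x i ^ l) (\<l> i)) = monom 1 l"
    proof (rule poly_eqI_degree[of "x ` {..m}"])
      show "degree (\<Sum>i\<le>m. smult (x i ^ l) (\<l> i)) < card (x ` {..m})"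
        unfolding card less_Suc_eq_le
        by (intro degree_sum_le order_trans[OF degree_smult_le] deg) auto
      show "degree (monom 1 l :: real poly) < card (x ` {..m})"
        using that by (simp add: card degree_monom_eq)
      fix z assume "z \<in> x ` {..m}"
      then obtain j where j: "j \<le> m" "z = x j" by auto
      have "poly (\<Sum>i\<le>m. smult (x i ^ l) (\<l> i)) z = (\<Sum>i\<le>m. if i = j then x i ^ l else 0)"
        unfolding poly_sum j(2) by (rule sum.cong) (auto simp: val j(1))
      then show "poly (\<Sum>i\<le>m. smult (x i ^ l) (\<l> i)) z = poly (monom 1 l) z"
        using j by (simp add: poly_monom)
    qed
    from arg_cong[OF this, of "\<lambda>p. coeff p k"] show ?thesis
      by (simp add: coeff_sum mult.commute eq_commute)
  qed
  moreover have "(\<Sum>k\<le>m. coeff (\<l> i) k * x j ^ k) = (if i = j then 1 else 0)" if "i \<le> m" "j \<le> m" for i j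
  proof -
    have "(\<Sum>k\<le>m. coeff (\<l> i) k * x j ^ k) = poly (\<l> i) (x j)"
      unfolding poly_altdef using deg[OF that(1)]
      by (intro sum.mono_neutral_right) (auto simp: coeff_eq_0)
    then show ?thesis using val[OF that] by simp
  qed
  ultimately show ?thesis by (intro exI[of _ "\<lambda>k i. coeff (\<l> i) k"]) auto
qed

section \<open>Smoothness by local extension\<close>

lemma smooth_on_subset_const: "smooth_on_subset S (\<lambda>w. r)"
  unfolding smooth_on_subset_def using smooth_on_const open_UNIV by blast

lemma smooth_on_subset_add:
  fixes f g :: "'v::real_normed_vector \<Rightarrow> real"
  assumes "smooth_on_subset S f" "smooth_on_subset S g"
  shows "smooth_on_subset S (\<lambda>w. f w + g w)"
  unfolding smooth_on_subset_def
proof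
  fix z assume z: "z \<in> S"
  obtain W F where W: "open W" "z \<in> W" "smooth_on W F" "\<forall>w\<in>S \<inter> W. F w = f w"
    using assms(1) z unfolding smooth_on_subset_def by blast
  obtain W' F' where W': "open W'" "z \<in> W'" "smooth_on W' F'" "\<forall>w\<in>S \<inter> W'. F' w = g w"
    using assms(2) z unfolding smooth_on_subset_def by blast
  have "smooth_on (W \<inter> W') (\<lambda>w. F w + F' w)"
    by (intro smooth_on_add smooth_on_mono[OF W(3)] smooth_on_mono[OF W'(3)]) (use W W' in auto)
  then show "\<exists>W F. open W \<and> z \<in> W \<and> smooth_on W F \<and> (\<forall>w\<in>S \<inter> W. F w = f w + g w)"
    using W W' by (intro exI[of _ "W \<inter> W'"] exI[of _ "\<lambda>w. F w + F' w"]) auto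
qed

lemma smooth_on_subset_sum:
  fixes f :: "'i \<Rightarrow> 'v::real_normed_vector \<Rightarrow> real"
  shows "(\<And>i. i \<in> I \<Longrightarrow> smooth_on_subset S (f i)) \<Longrightarrow> smooth_on_subset S (\<lambda>w. \<Sum>i\<in>I. f i w)"
  by (induction I rule: infinite_finite_induct) (auto intro: smooth_on_subset_add smooth_on_subset_const)

lemma smooth_on_subset_linear:
  fixes f :: "'v::euclidean_space \<Rightarrow> real"
  assumes f: "smooth_on_subset S f" and L: "bounded_linear L" "\<And>w. w \<in> S \<Longrightarrow> L w \<in> S"
  shows "smooth_on_subset S (\<lambda>w. r * f (L w))"
  unfolding smooth_on_subset_def
proof
  fix z assume z: "z \<in> S"
  then obtain W F where W: "open W" "L z \<in> W" "smooth_on W F" "\<forall>w\<in>S \<inter> W. F w = f w"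
    using f L(2) unfolding smooth_on_subset_def by blast
  have O: "open (L -` W)" by (rule open_vimage[OF W(1) linear_continuous_on[OF L(1)]])
  have "smooth_on (L -` W) (\<lambda>w. r * F (L w))"
    by (intro smooth_on_mult smooth_on_const smooth_on_compose[OF W(3)] smooth_on_linear[OF L(1)] O) auto
  then show "\<exists>W F. open W \<and> z \<in> W \<and> smooth_on W F \<and> (\<forall>w\<in>S \<inter> W. F w = r * f (L w))"
    using W L(2) O by (intro exI[of _ "L -` W"] exI[of _ "\<lambda>w. r * F (L w)"]) auto
qed

lemma bounded_linear_scale_coords: "bounded_linear (scale_coords \<mu> :: 'n::finite jet_coordinates \<Rightarrow> _)"
  unfolding scale_coords_def split_beta
  by (intro bounded_linear_Pair bounded_linear_fst bounded_linear_compose[OF bounded_linear_scaleR_right]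
      bounded_linear_fst_comp bounded_linear_snd_comp bounded_linear_snd bounded_linear_ident)

lemma contra_tensors_sum:
  fixes \<A> :: "('a, 'n::finite) chart set"
  assumes "\<And>i. i \<in> S \<Longrightarrow> t i \<in> contra_tensors \<A> x m"
  shows "(\<lambda>c I. \<Sum>i\<in>S. v i * t i c I) \<in> contra_tensors \<A> x m"
  unfolding contra_tensors_iff
proof (intro conjI allI impI)
  fix c and I :: "'n list" assume "c \<notin> charts_at \<A> x \<or> length I \<noteq> m"
  then show "(\<Sum>i\<in>S. v i * t i c I) = 0"
    using contra_tensorsD(1)[OF assms] by (intro sum.neutral) auto
next
  fix c d and J :: "'n list" assume "c \<in> charts_at \<A> x" "d \<in> charts_at \<A> x" "length J = m"
  then show "(\<Sum>i\<in>S. v i * t i d J) = transform (jacobian c d x) (\<lambda>I. \<Sum>i\<in>S. v i * t i c I) J"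
    using contra_tensorsD(2)[OF assms] unfolding transform_sum by (intro sum.cong) auto
qed

context manifold
begin

text \<open>The homogeneous parts are combinations of this kind. Smoothness, naturality and
  vanishing divergence pass to them for arbitrary coefficients and positive factors, because scaling
  is compatible with jets, push-forward and the connection.\<close>

definition scale_comb :: "nat set \<Rightarrow> (nat \<Rightarrow> real) \<Rightarrow> (nat \<Rightarrow> real) \<Rightarrow> (('a, 'n) jet \<Rightarrow> ('a, 'n) tensor) \<Rightarrow>
    ('a, 'n) jet \<Rightarrow> ('a, 'n) tensor" where
  "scale_comb S v \<mu> T = (\<lambda>j c I. \<Sum>i\<in>S. v i * T (scale_jet (\<mu> i) j) c I)"

lemma scale_comb_jet2:
  assumes "metric_near X \<A> \<sigma> x g" "\<forall>i\<in>S. \<mu> i > 0"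
  shows "scale_comb S v \<mu> T (jet2 X \<A> \<sigma> x g) = (\<lambda>c I. \<Sum>i\<in>S. v i * T (jet2 X \<A> \<sigma> x (scale_field (\<mu> i) g)) c I)"
  unfolding scale_comb_def by (intro ext sum.cong refl) (use assms(2) in \<open>simp add: jet2_scale[OF assms(1)]\<close>)

lemma J2M_jet2: "x \<in> topspace X \<Longrightarrow> metric_near X \<A> \<sigma> x g \<Longrightarrow> jet2 X \<A> \<sigma> x g \<in> J2M X \<A> \<sigma>"
  unfolding J2M_def by blast

lemma metric_near_topspace: "metric_near X \<A> \<sigma> x g \<Longrightarrow> x \<in> topspace X"
  unfolding metric_near_def using openin_subset by blast

lemma fst_jet2 [simp]: "fst (jet2 X \<A> \<sigma> x g) = x"
  by (simp add: jet2_def)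

lemma tensor_contra:
  assumes "second_order_tensor X \<A> \<sigma> m T" "metric_near X \<A> \<sigma> x g"
  shows "T (jet2 X \<A> \<sigma> x g) \<in> contra_tensors \<A> x m"
  using bspec[OF conjunct1[OF assms(1)[unfolded second_order_tensor_def]]
      J2M_jet2[OF metric_near_topspace[OF assms(2)] assms(2)]] by simp

lemma second_order_scale_comb:
  assumes T: "second_order_tensor X \<A> \<sigma> m T" and mu: "\<forall>i\<in>S. \<mu> i > 0"
  shows "second_order_tensor X \<A> \<sigma> m (scale_comb S v \<mu> T)"
  unfolding second_order_tensor_def
proof (intro conjI ballI)
  fix j assume "j \<in> J2M X \<A> \<sigma>"
  then obtain x g where j: "j = jet2 X \<A> \<sigma> x g" "metric_near X \<A> \<sigma> x g" unfolding J2M_def by blast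
  show "scale_comb S v \<mu> T j \<in> contra_tensors \<A> (fst j) m"
    unfolding j(1) scale_comb_jet2[OF j(2) mu] fst_jet2
    by (intro contra_tensors_sum tensor_contra[OF T] metric_near_scale j(2) mu[rule_format])
next
  fix c and I :: "'n list" assume c: "c \<in> \<A>" and I: "I \<in> multi_indices m"
  let ?S = "{jet_coords c x g | x g. x \<in> cdom c \<and> metric_near X \<A> \<sigma> x g}"
  obtain F where F: "smooth_on_subset ?S F"
    "\<forall>x g. x \<in> cdom c \<and> metric_near X \<A> \<sigma> x g \<longrightarrow> T (jet2 X \<A> \<sigma> x g) c I = F (jet_coords c x g)"
    using bspec[OF bspec[OF conjunct2[OF T[unfolded second_order_tensor_def]] c] I] by (elim exE conjE)
  have sc: "scale_coords (\<mu> i) (jet_coords c x g) = jet_coords c x (scale_field (\<mu> i) g)"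
    "metric_near X \<A> \<sigma> x (scale_field (\<mu> i) g)"
    if "x \<in> cdom c" "metric_near X \<A> \<sigma> x g" "i \<in> S" for x g i
    using jet_coords_scale[OF that(2) charts_atI[OF c that(1)]] metric_near_scale[OF that(2) mu[rule_format, OF that(3)]] by auto
  have img: "scale_coords (\<mu> i) w \<in> ?S" if i: "i \<in> S" and w: "w \<in> ?S" for i w
  proof -
    obtain x g where "w = jet_coords c x g" "x \<in> cdom c" "metric_near X \<A> \<sigma> x g" using w by blast
    then show ?thesis using sc[of x g i] i by blast
  qed
  let ?F = "\<lambda>w. \<Sum>i\<in>S. v i * F (scale_coords (\<mu> i) w)"
  have "smooth_on_subset ?S ?F"
    by (intro smooth_on_subset_sum smooth_on_subset_linear[OF F(1)] bounded_linear_scale_coords img)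
  moreover have "scale_comb S v \<mu> T (jet2 X \<A> \<sigma> x g) c I = ?F (jet_coords c x g)"
    if "x \<in> cdom c" "metric_near X \<A> \<sigma> x g" for x g
    unfolding scale_comb_jet2[OF that(2) mu]
    using sc[OF that] F(2) that(1) by (intro sum.cong) auto
  ultimately show "\<exists>F. smooth_on_subset ?S F \<and>
      (\<forall>x g. x \<in> cdom c \<and> metric_near X \<A> \<sigma> x g \<longrightarrow> scale_comb S v \<mu> T (jet2 X \<A> \<sigma> x g) c I = F (jet_coords c x g))"
    by (intro exI[of _ ?F] conjI allI impI) auto
qed

lemma naturalD:
  "natural X \<A> \<sigma> T \<Longrightarrow> diffeo X \<A> U V \<tau> \<Longrightarrow> x \<in> U \<Longrightarrow> metric_near X \<A> \<sigma> x g \<Longrightarrow>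
    T (jet2 X \<A> \<sigma> (\<tau> x) (push_field \<A> U \<tau> g)) = push_tensor \<A> U \<tau> x (T (jet2 X \<A> \<sigma> x g))"
  unfolding natural_def by blast

lemma natural_scale_comb:
  assumes T: "natural X \<A> \<sigma> T" and mu: "\<forall>i\<in>S. \<mu> i > 0"
  shows "natural X \<A> \<sigma> (scale_comb S v \<mu> T)"
  unfolding natural_def
proof (intro allI impI, elim conjE)
  fix U V \<tau> x g assume D: "diffeo X \<A> U V \<tau>" and x: "x \<in> U" and g: "metric_near X \<A> \<sigma> x g"
  have "T (jet2 X \<A> \<sigma> (\<tau> x) (scale_field (\<mu> i) (push_field \<A> U \<tau> g))) =
      push_tensor \<A> U \<tau> x (T (jet2 X \<A> \<sigma> x (scale_field (\<mu> i) g)))" if "i \<in> S" for i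
    using naturalD[OF T D x metric_near_scale[OF g mu[rule_format, OF that]]] by (simp add: push_field_scale)
  then show "scale_comb S v \<mu> T (jet2 X \<A> \<sigma> (\<tau> x) (push_field \<A> U \<tau> g)) =
      push_tensor \<A> U \<tau> x (scale_comb S v \<mu> T (jet2 X \<A> \<sigma> x g))"
    unfolding scale_comb_jet2[OF g mu] scale_comb_jet2[OF metric_near_push_field[OF D x g] mu]
    by (intro ext) (auto simp: push_tensor_def intro!: sum.cong)
qed

text \<open>\<open>partial\<close>, and with it \<open>divergence\<close>, distributes over a sum
  only when the summands are differentiable; this supplies the hypothesis of
  \<open>divergence_sum\<close>.\<close>

lemma differentiable_components_tensor:
  assumes T: "second_order_tensor X \<A> \<sigma> m T" and U: "openin X U" "metric_on \<A> \<sigma> U g"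
    and x: "x \<in> U" and c: "c \<in> charts_at \<A> x" and I: "I \<in> multi_indices m"
  shows "components c (\<lambda>z. T (jet2 X \<A> \<sigma> z g)) I differentiable (at (cmap c x))"
proof -
  have c': "c \<in> \<A>" "x \<in> cdom c" using c charts_at_atlas by auto
  have near: "metric_near X \<A> \<sigma> z g" if "z \<in> U" for z using U that unfolding metric_near_def by blast
  obtain W F where W: "open W" "jet_coords c x g \<in> W" "smooth_on W F"
    and F: "\<And>z k. z \<in> cdom c \<Longrightarrow> metric_near X \<A> \<sigma> z k \<Longrightarrow> jet_coords c z k \<in> W \<Longrightarrow>
      T (jet2 X \<A> \<sigma> z k) c I = F (jet_coords c z k)"
    using local_representation[OF T c'(1) I c'(2) near[OF x]] by metis
  let ?O = "cmap c ` (cdom c \<inter> U)"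
  have O: "open ?O" by (rule open_cmap_image[OF c'(1) U(1)])
  have sm: "smooth_on ?O (components c g [i, j])" for i j
    using U(2) c'(1) by (simp only: metric_on_def)
  let ?j = "\<lambda>y. (y, (\<chi> i j. components c g [i, j] y), (\<chi> i j k. partial k (components c g [i, j]) y),
      (\<chi> i j k l. partial l (partial k (components c g [i, j])) y)) :: 'n jet_coordinates"
  have j: "smooth_on ?O ?j"
    by (intro smooth_on_Pair smooth_on_vec_lambda smooth_on_linear bounded_linear_ident
        sm smooth_on_partial[OF sm] smooth_on_partial[OF smooth_on_partial[OF sm]] O)
  have jj: "?j (cmap c z) = jet_coords c z g" if "z \<in> cdom c" for z
    using c'(1) that by (simp add: jet_coords_def gram_def components_def second_partials_def)
  let ?P = "?O \<inter> ?j -` W"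
  have P: "open ?P" using smooth_on_continuous_on[OF j] O W(1) by (simp add: continuous_on_open_vimage Int_commute)
  have "smooth_on ?P (\<lambda>y. F (?j y))"
    by (rule smooth_on_compose[OF W(3) smooth_on_mono[OF j] P]) auto
  moreover have xP: "cmap c x \<in> ?P" using jj[OF c'(2)] W(2) x c' by auto
  ultimately have "(\<lambda>y. F (?j y)) differentiable (at (cmap c x))" by (rule smooth_on_differentiable)
  then show ?thesis
  proof (rule differentiable_cong_open[OF P xP, rotated])
    fix y assume y: "y \<in> ?P"
    then obtain z where z: "z \<in> cdom c" "z \<in> U" "y = cmap c z" by auto
    then show "F (?j y) = components c (\<lambda>z. T (jet2 X \<A> \<sigma> z g)) I y"
      using F[OF z(1) near[OF z(2)]] jj[OF z(1)] y c'(1) by (simp add: components_def)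
  qed
qed

lemma divergence_sum:
  assumes "\<And>i I. i \<in> S \<Longrightarrow> I \<in> multi_indices (Suc (length J)) \<Longrightarrow> components c (R i) I differentiable (at (cmap c x))"
    and O: "openin X U" "x \<in> U" "c \<in> charts_at \<A> x"
    and eq: "\<And>z I. z \<in> U \<Longrightarrow> Q z c I = (\<Sum>i\<in>S. v i * R i z c I)"
  shows "divergence c g Q x J = (\<Sum>i\<in>S. v i * divergence c g (R i) x J)"
proof -
  have c: "c \<in> \<A>" "x \<in> cdom c" using O(3) charts_at_atlas by auto
  have p: "partial k (components c Q (J @ [k])) (cmap c x) =
      (\<Sum>i\<in>S. v i * partial k (components c (R i) (J @ [k])) (cmap c x))" for k
  proof -
    have "partial k (components c Q (J @ [k])) (cmap c x) =
        partial k (\<lambda>y. \<Sum>i\<in>S. v i * components c (R i) (J @ [k]) y) (cmap c x)"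
      by (rule partial_cong_open[OF open_cmap_image[OF c(1) O(1)]]) (use c O eq in \<open>auto simp: components_def\<close>)
    also have "\<dots> = (\<Sum>i\<in>S. partial k (\<lambda>y. v i * components c (R i) (J @ [k]) y) (cmap c x))"
      by (intro partial_sum differentiable_mult assms(1)) (auto simp: multi_indices_def)
    also have "\<dots> = (\<Sum>i\<in>S. v i * partial k (components c (R i) (J @ [k])) (cmap c x))"
      by (intro sum.cong refl partial_cmult assms(1)) (auto simp: multi_indices_def)
    finally show ?thesis .
  qed
  have "cov_deriv c g Q x k (J @ [k]) = (\<Sum>i\<in>S. v i * cov_deriv c g (R i) x k (J @ [k]))" for k
  proof -
    have "(\<Sum>a<length (J @ [k]). \<Sum>l\<in>UNIV. christoffel c g x ((J @ [k]) ! a) k l * Q x c ((J @ [k])[a := l])) =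
      (\<Sum>i\<in>S. \<Sum>a<length (J @ [k]). \<Sum>l\<in>UNIV. v i * (christoffel c g x ((J @ [k]) ! a) k l * R i x c ((J @ [k])[a := l])))"
      unfolding eq[OF O(2)] sum_distrib_left
      by (subst sum.swap, subst sum.swap[of _ S]) (simp add: mult_ac sum.swap[of _ S])
    then show ?thesis
      unfolding cov_deriv_def p by (simp add: distrib_left sum.distrib sum_distrib_left)
  qed
  then show ?thesis
    unfolding divergence_def by (simp add: sum_distrib_left) (rule sum.swap)
qed

lemma divergence_free_scale_comb:
  assumes T: "second_order_tensor X \<A> \<sigma> m T" and div: "divergence_free X \<A> \<sigma> m T" and m: "m \<ge> 1"
    and mu: "\<forall>i\<in>S. \<mu> i > 0"
  shows "divergence_free X \<A> \<sigma> m (scale_comb S v \<mu> T)"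
  unfolding divergence_free_def
proof (intro allI impI ballI, elim conjE)
  fix U g x c and J :: "'n list"
  assume U: "openin X U" "metric_on \<A> \<sigma> U g" and x: "x \<in> U" and c: "c \<in> charts_at \<A> x" and J: "J \<in> multi_indices (m - 1)"
  have near: "metric_near X \<A> \<sigma> z g" if "z \<in> U" for z using U that unfolding metric_near_def by blast
  let ?R = "\<lambda>i z. T (jet2 X \<A> \<sigma> z (scale_field (\<mu> i) g))"
  have sm: "metric_on \<A> \<sigma> U (scale_field (\<mu> i) g)" if "i \<in> S" for i
    by (rule metric_on_scale[OF U(2) mu[rule_format, OF that] U(1)])
  have len: "Suc (length J) = m" using J m by (simp add: multi_indices_def)
  have "divergence c g (\<lambda>z. scale_comb S v \<mu> T (jet2 X \<A> \<sigma> z g)) x J = (\<Sum>i\<in>S. v i * divergence c g (?R i) x J)"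
  proof (rule divergence_sum[OF _ U(1) x c])
    show "components c (?R i) I differentiable (at (cmap c x))" if "i \<in> S" "I \<in> multi_indices (Suc (length J))" for i I
      using that len by (intro differentiable_components_tensor[OF T U(1) sm x c]) auto
    show "scale_comb S v \<mu> T (jet2 X \<A> \<sigma> z g) c I = (\<Sum>i\<in>S. v i * ?R i z c I)" if "z \<in> U" for z I
      by (simp add: scale_comb_jet2[OF near[OF that] mu])
  qed
  moreover have "divergence c g (?R i) x J = 0" if i: "i \<in> S" for i
  proof -
    have "divergence c (scale_field (\<mu> i) g) (?R i) x J = 0"
      using div U(1) sm[OF i] x c J unfolding divergence_free_def by blast
    then show ?thesis by (simp add: divergence_scale[OF near[OF x] c mu[rule_format, OF i]])
  qed
  ultimately show "divergence c g (\<lambda>z. scale_comb S v \<mu> T (jet2 X \<A> \<sigma> z g)) x J = 0" by simp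
qed

end

section \<open>Homogeneity\<close>

lemma hpoly_cong:
  assumes "hpoly A k f" "\<And>I. I \<in> A \<Longrightarrow> x I = y I"
  shows "f x = f y"
proof -
  obtain a where f: "\<And>x. f x = (\<Sum>K | length K = k \<and> set K \<subseteq> A. a K * (\<Prod>I\<leftarrow>K. x I))"
    using assms(1) unfolding hpoly_def by blast
  show ?thesis
    unfolding f
  proof (rule sum.cong)
    fix K assume "K \<in> {K. length K = k \<and> set K \<subseteq> A}"
    then have "map x K = map y K" using assms(2) by auto
    then show "a K * (\<Prod>I\<leftarrow>K. x I) = a K * (\<Prod>I\<leftarrow>K. y I)" by (simp only:)
  qed simp
qed

lemma hpoly_transform:
  fixes M :: "real^'n::finite^'n"
  assumes "I \<in> multi_indices m"
  shows "hpoly (multi_indices m) 1 (\<lambda>x. transform M x I)"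
  unfolding transform_def using assms
  by (intro hpoly_sum hpoly_cmult hpoly_coord finite_multi_indices) (auto simp: multi_indices_length)

lemma contra_tensors_eqI:
  fixes \<A> :: "('a, 'n::finite) chart set"
  assumes t: "t \<in> contra_tensors \<A> x m" and u: "u \<in> contra_tensors \<A> x m" and c: "c \<in> charts_at \<A> x"
    and eq: "\<And>J. length J = m \<Longrightarrow> t c J = u c J"
  shows "t = u"
proof (intro ext)
  fix d J
  show "t d J = u d J"
  proof (cases "d \<in> charts_at \<A> x \<and> length J = m")
    case True
    then have "t d J = transform (jacobian c d x) (t c) J" "u d J = transform (jacobian c d x) (u c) J"
      using contra_tensorsD(2)[OF t c] contra_tensorsD(2)[OF u c] by auto
    moreover have "transform (jacobian c d x) (t c) J = transform (jacobian c d x) (u c) J"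
      by (rule transform_cong) (use True eq in \<open>auto simp: multi_indices_length\<close>)
    ultimately show ?thesis by simp
  qed (use contra_tensorsD(1)[OF t] contra_tensorsD(1)[OF u] in auto)
qed

definition tensor4 :: "('n list \<Rightarrow> real) \<Rightarrow> real^'n::finite^'n^'n^'n" where
  "tensor4 t = (\<chi> i j k l. t [i, j, k, l])"

lemma coords4_tensor4: "I \<in> multi_indices 4 \<Longrightarrow> coords4 (tensor4 t) I = t I"
  by (auto simp: multi_indices_length coords4_def tensor4_def numeral_eq_Suc length_Suc_conv)

lemma coords4_scale: "coords4 (r *\<^sub>R h) = (\<lambda>I. r * coords4 h I)"
  by (simp add: coords4_def fun_eq_iff)

context manifold
begin

lemma jet_coords_second:
  assumes "jet_coords c x g = (y, b, d, h)"
  shows "second_partials c g x i j k l = h $ i $ j $ k $ l"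
  using assms by (auto simp: jet_coords_def)

lemma jet_coords_flat:
  assumes "jet_coords c x g = (y, b, 0, h)"
  shows "partial k (components c g [i, j]) y = 0"
proof -
  have "(\<chi> i j k. partial k (components c g [i, j]) (cmap c x)) = 0"
    using assms unfolding jet_coords_def prod.inject by (elim conjE)
  moreover have "cmap c x = y"
    using assms unfolding jet_coords_def prod.inject by (elim conjE)
  ultimately show ?thesis by (simp add: vec_eq_iff)
qed

text \<open>Scaling the metric by \<open>r\<^sup>2\<close> amounts, up to a dilation of the chart, to scaling its second
  derivatives by \<open>r\<^sup>-\<^sup>2\<close>.\<close>

lemma tensor_scaled_metric:
  assumes T: "second_order_tensor X \<A> \<sigma> p T" and nat: "natural X \<A> \<sigma> T"
    and c: "c \<in> charts_at \<A> x" "cmap c x = 0" and b: "has_signature \<sigma> b" "transpose b = b"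
    and I: "I \<in> multi_indices p" and h: "h \<in> sym4" and r: "r > 0"
    and g: "metric_near X \<A> \<sigma> x g" "jet_coords c x g = (0, b, 0, h)"
  shows "r ^ p * T (jet2 X \<A> \<sigma> x (scale_field (r\<^sup>2) g)) c I = tensor_at \<sigma> T c x b I ((1 / r\<^sup>2) *\<^sub>R h)"
proof -
  let ?g = "scale_field (r\<^sup>2) g"
  let ?L = "mat r :: real^'n^'n" and ?L' = "mat (1 / r) :: real^'n^'n"
  have mm: "mat s ** (A :: real^'n^'n) = s *\<^sub>R A" "A ** mat s = s *\<^sub>R A" "transpose (mat s) = (mat s :: real^'n^'n)" for s A
    by (simp_all add: vec_eq_iff matrix_matrix_mult_def mat_def transpose_def
        if_distrib[of "\<lambda>x. x * _"] if_distrib[of "\<lambda>x. _ * x"] mult.commute cong: if_cong)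
  have ms: "s *\<^sub>R mat t = (mat (s * t) :: real^'n^'n)" for s t by (simp add: vec_eq_iff mat_def)
  have g': "metric_near X \<A> \<sigma> x ?g" by (rule metric_near_scale[OF g(1)]) (use r in simp)
  have j': "jet_coords c x ?g = (0, r\<^sup>2 *\<^sub>R b, 0, r\<^sup>2 *\<^sub>R h)"
    using jet_coords_scale[OF g(1) c(1)] g(2) by (simp add: scale_coords_def)
  have inv: "?L ** ?L' = mat 1" "?L' ** ?L = mat 1" using r by (simp_all add: mm ms)
  obtain k where k: "metric_near X \<A> \<sigma> x k"
    and jk: "jet_coords c x k = (0, transpose ?L' ** gram (?g x c) ** ?L', 0,
      \<chi> i j k l. transform (transpose ?L') (\<lambda>I. second_partials c ?g x (I!0) (I!1) (I!2) (I!3)) [i, j, k, l])"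
    and Tk: "\<forall>T m J. natural X \<A> \<sigma> T \<longrightarrow> T (jet2 X \<A> \<sigma> x ?g) \<in> contra_tensors \<A> x m \<longrightarrow> length J = m \<longrightarrow>
      T (jet2 X \<A> \<sigma> x k) c J = transform ?L (T (jet2 X \<A> \<sigma> x ?g) c) J"
    using link_metric[OF c c inv g' jet_coords_flat[OF j']] by (elim exE conjE)
  \<comment> \<open>The two indices of the metric contribute \<open>(1 / r)\<^sup>2\<close>, which
    cancels its factor \<open>r\<^sup>2\<close>; the four indices of the second derivatives
    contribute \<open>(1 / r) ^ 4\<close>, which leaves \<open>1 / r\<^sup>2\<close>.\<close>
  have "gram (?g x c) = r\<^sup>2 *\<^sub>R b" using j' by (simp add: jet_coords_def)
  then have 1: "transpose ?L' ** gram (?g x c) ** ?L' = b"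
    using r by (simp add: mm power2_eq_square)
  have "transform (transpose ?L') (\<lambda>I. second_partials c ?g x (I!0) (I!1) (I!2) (I!3)) [i, j, k, l] = ((1 / r\<^sup>2) *\<^sub>R h) $ i $ j $ k $ l" for i j k l
    unfolding mm(3) transform_mat jet_coords_second[OF j'] using r
    by (simp add: power2_eq_square eval_nat_numeral)
  then have "jet_coords c x k = (0, b, 0, (1 / r\<^sup>2) *\<^sub>R h)"
    unfolding jk 1 by (simp add: vec_eq_iff)
  then have "T (jet2 X \<A> \<sigma> x k) c I = tensor_at \<sigma> T c x b I ((1 / r\<^sup>2) *\<^sub>R h)"
    using subspace_scale[OF subspace_sym4 h] by (intro tensor_at_eq[OF T c b I _ k])
  moreover have "T (jet2 X \<A> \<sigma> x k) c I = r ^ p * T (jet2 X \<A> \<sigma> x ?g) c I"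
    using Tk[rule_format, OF nat tensor_contra[OF T g'], of I] I by (simp add: multi_indices_length transform_mat)
  ultimately show ?thesis by simp
qed

text \<open>With \<open>r\<^sup>2 = real (Suc i)\<close>, the power of the square root is
  \<open>r ^ p\<close> and removes the weight of the \<open>p\<close> contravariant indices. What
  remains at flat jets is a polynomial in \<open>1 / real (Suc i)\<close>, whose coefficient of
  degree \<open>k\<close> is selected by \<open>V k i\<close>. The index \<open>i = 0\<close>
  belongs to the metric itself.\<close>

definition homogeneous_part :: "(nat \<Rightarrow> nat \<Rightarrow> real) \<Rightarrow> nat \<Rightarrow> nat \<Rightarrow> (('a, 'n) jet \<Rightarrow> ('a, 'n) tensor) \<Rightarrow>
    ('a, 'n) jet \<Rightarrow> ('a, 'n) tensor" where
  "homogeneous_part V p k T = scale_comb {..degree_bound} (\<lambda>i. V k i * sqrt (real (Suc i)) ^ p) (\<lambda>i. real (Suc i)) T"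

lemma homogeneous_part_polynomial:
  assumes T: "second_order_tensor X \<A> \<sigma> p T" and nat: "natural X \<A> \<sigma> T"
    and div: "divergence_free X \<A> \<sigma> p T" and p: "p \<ge> 1"
    and V: "\<forall>k\<le>degree_bound. \<forall>l\<le>degree_bound. (\<Sum>i\<le>degree_bound. V k i * (1 / real (Suc i)) ^ l) = (if k = l then 1 else 0)"
    and k: "k \<le> degree_bound"
    and c: "c \<in> charts_at \<A> x" "cmap c x = 0" and b: "has_signature \<sigma> b" "transpose b = b"
    and I: "I \<in> multi_indices p"
  shows "\<exists>q. hpoly (multi_indices 4) k q \<and>
    (\<forall>h\<in>sym4. tensor_at \<sigma> (homogeneous_part V p k T) c x b I h = q (coords4 h))"
proof -
  obtain f where f: "poly_upto (multi_indices 4) degree_bound f"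
    "\<forall>h\<in>sym4. tensor_at \<sigma> T c x b I h = f (coords4 h)"
    using tensor_at_polynomial[OF T div p c b I] by blast
  obtain q where q: "\<forall>k. hpoly (multi_indices 4) k (q k)" "\<forall>x. f x = (\<Sum>k\<le>degree_bound. q k x)"
    using f(1) unfolding poly_upto_def by blast
  have "tensor_at \<sigma> (homogeneous_part V p k T) c x b I h = q k (coords4 h)" if h: "h \<in> sym4" for h
  proof -
    let ?g = "test_metric c b h 0 0 0"
    have g: "metric_near X \<A> \<sigma> x ?g" by (rule test_metric_near[OF c h b])
    have j: "jet_coords c x ?g = (0, b, 0, h)"
      using jet_coords_test_metric[OF charts_at_atlas[OF c(1)]] test_jet_0[OF h] c(2) by simp
    have scaled: "sqrt (real (Suc i)) ^ p * T (jet2 X \<A> \<sigma> x (scale_field (real (Suc i)) ?g)) c I =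
        (\<Sum>l\<le>degree_bound. (1 / real (Suc i)) ^ l * q l (coords4 h))" for i
    proof -
      have "sqrt (real (Suc i)) ^ p * T (jet2 X \<A> \<sigma> x (scale_field ((sqrt (real (Suc i)))\<^sup>2) ?g)) c I =
          tensor_at \<sigma> T c x b I ((1 / (sqrt (real (Suc i)))\<^sup>2) *\<^sub>R h)"
        by (rule tensor_scaled_metric[OF T nat c b I h _ g j]) simp
      then have "sqrt (real (Suc i)) ^ p * T (jet2 X \<A> \<sigma> x (scale_field (real (Suc i)) ?g)) c I =
          f (coords4 ((1 / real (Suc i)) *\<^sub>R h))"
        using f(2) subspace_scale[OF subspace_sym4 h] by simp
      then show ?thesis
        unfolding q(2)[rule_format] coords4_scale hpoly_homogeneous[OF q(1)[rule_format]] .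
    qed
    have "tensor_at \<sigma> (homogeneous_part V p k T) c x b I h =
        (\<Sum>i\<le>degree_bound. V k i * (sqrt (real (Suc i)) ^ p * T (jet2 X \<A> \<sigma> x (scale_field (real (Suc i)) ?g)) c I))"
      unfolding tensor_at_def homogeneous_part_def by (subst scale_comb_jet2[OF g]) (auto simp: mult.assoc)
    also have "\<dots> = (\<Sum>l\<le>degree_bound. (\<Sum>i\<le>degree_bound. V k i * (1 / real (Suc i)) ^ l) * q l (coords4 h))"
      unfolding scaled sum_distrib_left sum_distrib_right mult.assoc by (rule sum.swap)
    also have "\<dots> = (\<Sum>l\<le>degree_bound. if k = l then q l (coords4 h) else 0)"
      by (rule sum.cong) (use V k in auto)
    also have "\<dots> = q k (coords4 h)" using k by simp
    finally show ?thesis .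
  qed
  then show ?thesis using q(1) by blast
qed

lemma N2_sym4:
  assumes "h \<in> N2 \<A> x" "c \<in> charts_at \<A> x"
  shows "tensor4 (h c) \<in> sym4"
proof -
  have "h c [i, j, k, l] = h c [j, i, k, l] \<and> h c [i, j, k, l] = h c [i, j, l, k]" for i j k l
    using assms unfolding N2_def mem_Collect_eq by blast
  then show ?thesis unfolding sym4_def tensor4_def by simp
qed

lemma homogeneous_polynomial_map_zero:
  "homogeneous_polynomial_map \<A> x p k (\<lambda>h c J. 0)"
proof -
  have "(\<lambda>c J. 0) \<in> contra_tensors \<A> x p" by (simp add: contra_tensors_iff transform_def)
  then show ?thesis
    unfolding homogeneous_polynomial_map_def by (intro conjI ballI exI[of _ "\<lambda>_. 0"]) auto
qed

text \<open>The hypothesis describes \<open>T\<close> in charts centred at \<open>x\<close>, whereas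
  \<open>represents\<close> ranges over the normal charts of all metrics with value \<beta>. One
  centred chart \<open>c\<close> is fixed to define the polynomial map. Since first derivatives
  vanish in a normal chart, \<open>link_metric\<close> with the Jacobian as linear map carries any
  such metric to \<open>c\<close>.\<close>

lemma homogeneous_if_polynomial:
  assumes T: "second_order_tensor X \<A> \<sigma> p T" and nat: "natural X \<A> \<sigma> T"
    and poly: "\<And>x c b I. c \<in> charts_at \<A> x \<Longrightarrow> cmap c x = 0 \<Longrightarrow> has_signature \<sigma> b \<Longrightarrow> transpose b = b \<Longrightarrow>
      I \<in> multi_indices p \<Longrightarrow>
      \<exists>q. hpoly (multi_indices 4) k q \<and> (\<forall>h\<in>sym4. tensor_at \<sigma> T c x b I h = q (coords4 h))"
  shows "homogeneous_of_degree X \<A> \<sigma> p k T"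
  unfolding homogeneous_of_degree_def
proof (intro ballI)
  fix x \<beta> assume x: "x \<in> topspace X" and \<beta>: "\<beta> \<in> metrics_at \<A> \<sigma> x"
  show "\<exists>\<tt>. homogeneous_polynomial_map \<A> x p k \<tt> \<and> represents X \<A> \<sigma> x \<beta> \<tt> T"
  proof (cases "\<exists>g c. metric_near X \<A> \<sigma> x g \<and> g x = \<beta> \<and> normal_chart \<A> \<sigma> g x c")
    \<comment> \<open>If no metric with value \<beta> has a normal chart, the representation
      condition is empty and the zero map will do. In the other case the normal chart provides a
      chart centred at \<open>x\<close>.\<close>
    case False
    then have "represents X \<A> \<sigma> x \<beta> (\<lambda>h c J. 0) T" unfolding represents_def by blast
    then show ?thesis using homogeneous_polynomial_map_zero by blast
  next
    case True
    then obtain c where c: "c \<in> charts_at \<A> x" "cmap c x = 0" unfolding normal_chart_def by blast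
    define b where "b = gram (\<beta> c)"
    have b: "has_signature \<sigma> b" "transpose b = b"
      using \<beta> c(1) by (auto simp: b_def metrics_at_def gram_def transpose_def vec_eq_iff)
    define \<tt> where "\<tt> = (\<lambda>h. T (jet2 X \<A> \<sigma> x (test_metric c b (tensor4 (h c)) 0 0 0)))"
    have tt: "\<tt> h \<in> contra_tensors \<A> x p" if "h \<in> N2 \<A> x" for h
      unfolding \<tt>_def by (intro tensor_contra[OF T] test_metric_near c b N2_sym4[OF that c(1)])
    \<comment> \<open>\<open>T\<close> is polynomial in the components with respect to
      \<open>c\<close>. The coefficients demanded in a chart \<open>d\<close> arise by substituting
      the linear transformation of the argument and transforming the values to
      \<open>d\<close>.\<close>
    have poly_tt: "\<exists>a. \<forall>h\<in>N2 \<A> x. \<tt> h d J = (\<Sum>K | length K = k \<and> set K \<subseteq> multi_indices 4. a K * (\<Prod>I\<leftarrow>K. h d I))"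
      if d: "d \<in> charts_at \<A> x" and J: "J \<in> multi_indices p" for d J
    proof -
      have "\<forall>I. \<exists>q. I \<in> multi_indices p \<longrightarrow> hpoly (multi_indices 4) k q \<and>
          (\<forall>h\<in>sym4. tensor_at \<sigma> T c x b I h = q (coords4 h))"
        using poly[OF c b] by blast
      then obtain q where q: "\<And>I. I \<in> multi_indices p \<Longrightarrow> hpoly (multi_indices 4) k (q I)"
        "\<And>I h. I \<in> multi_indices p \<Longrightarrow> h \<in> sym4 \<Longrightarrow> tensor_at \<sigma> T c x b I h = q I (coords4 h)"
        by metis
      let ?M = "transpose (jacobian c d x)" and ?N = "jacobian c d x"
      let ?f = "\<lambda>z. \<Sum>I\<in>multi_indices (length J). (\<Prod>a<length J. ?N $ (J ! a) $ (I ! a)) * q I (\<lambda>K. transform ?M z K)"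
      have "hpoly (multi_indices 4) k (\<lambda>z. q I (\<lambda>K. transform ?M z K))" if "I \<in> multi_indices p" for I
        by (rule hpoly_substitute[OF q(1)[OF that] hpoly_transform])
      then have hf: "hpoly (multi_indices 4) k ?f"
        using J by (intro hpoly_sum hpoly_cmult) (auto simp: multi_indices_length)
      have ttf: "\<tt> h d J = ?f (h d)" if h: "h \<in> N2 \<A> x" for h
      proof -
        have cov: "h \<in> cov_tensors \<A> x 4" using h by (simp add: N2_def)
        have "coords4 (tensor4 (h c)) I = transform ?M (h d) I" if "I \<in> multi_indices 4" for I
          using coords4_tensor4[OF that] cov_tensorsD(2)[OF cov d c(1), of I] that
          by (simp add: multi_indices_length)
        then have e: "q I (coords4 (tensor4 (h c))) = q I (\<lambda>K. transform ?M (h d) K)" if "I \<in> multi_indices p" for I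
          using hpoly_cong[OF q(1)[OF that]] by blast
        have tc: "\<tt> h c I = q I (coords4 (tensor4 (h c)))" if "I \<in> multi_indices p" for I
          using q(2)[OF that N2_sym4[OF h c(1)]] by (simp add: \<tt>_def tensor_at_def)
        have "\<tt> h d J = transform ?N (\<tt> h c) J"
          using contra_tensorsD(2)[OF tt[OF h] c(1) d] J by (simp add: multi_indices_length)
        also have "\<dots> = ?f (h d)"
          unfolding transform_def using J by (intro sum.cong) (auto simp: multi_indices_length tc e transform_def)
        finally show ?thesis .
      qed
      obtain a where "\<forall>z. ?f z = (\<Sum>K | length K = k \<and> set K \<subseteq> multi_indices 4. a K * (\<Prod>I\<leftarrow>K. z I))"
        using hf unfolding hpoly_def by (elim exE)
      then show ?thesis by (intro exI[of _ a] ballI) (simp only: ttf)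
    qed
    have "homogeneous_polynomial_map \<A> x p k \<tt>"
      unfolding homogeneous_polynomial_map_def using tt poly_tt by blast
    moreover have "represents X \<A> \<sigma> x \<beta> \<tt> T"
      unfolding represents_def
    proof (intro allI impI, elim conjE)
      fix g d assume g: "metric_near X \<A> \<sigma> x g" "g x = \<beta>" and N: "normal_chart \<A> \<sigma> g x d"
      have d: "d \<in> charts_at \<A> x" "cmap d x = 0" using N by (auto simp: normal_chart_def)
      let ?L = "jacobian d c x" and ?L' = "jacobian c d x"
      let ?h = "second_derivative_tensor \<A> x d g"
      \<comment> \<open>In \<open>c\<close>, the metric \<open>k\<close> has the transformed value
        and second derivatives of \<open>g\<close>, and its first derivatives vanish again, so it
        has the jet coordinates of a test metric.\<close>
      obtain k where k: "metric_near X \<A> \<sigma> x k"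
        and jk: "jet_coords c x k = (0, transpose ?L' ** gram (g x d) ** ?L', 0,
          \<chi> i j k l. transform (transpose ?L') (\<lambda>I. second_partials d g x (I!0) (I!1) (I!2) (I!3)) [i, j, k, l])"
        and Tk: "\<forall>T m J. natural X \<A> \<sigma> T \<longrightarrow> T (jet2 X \<A> \<sigma> x g) \<in> contra_tensors \<A> x m \<longrightarrow> length J = m \<longrightarrow>
          T (jet2 X \<A> \<sigma> x k) c J = transform ?L (T (jet2 X \<A> \<sigma> x g) d) J"
        using link_metric[OF d c jacobian_inverse[OF c(1) d(1)] jacobian_inverse[OF d(1) c(1)] g(1) normal_chart_flat[OF N]]
        by (elim exE conjE)
      have cov: "\<beta> \<in> cov_tensors \<A> x 2" using \<beta> by (simp add: metrics_at_def)
      have "b = gram (transform (transpose ?L') (\<beta> d))"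
        unfolding b_def gram_def using cov_tensorsD(2)[OF cov d(1) c(1)] by (simp add: vec_eq_iff)
      then have 1: "transpose ?L' ** gram (g x d) ** ?L' = b" by (simp add: gram_transform g(2))
      have h4: "(\<chi> i j k l. transform (transpose ?L') (\<lambda>I. second_partials d g x (I!0) (I!1) (I!2) (I!3)) [i, j, k, l]) = tensor4 (?h c)"
        using c(1) by (simp add: tensor4_def second_derivative_tensor_def cov_transform_eq multi_indices_length)
      have jk': "jet_coords c x k = (0, b, 0, tensor4 (?h c))" unfolding jk 1 h4 ..
      have s4: "tensor4 (?h c) \<in> sym4"
        unfolding sym4_def mem_Collect_eq jet_coords_second[OF jk', symmetric]
        using second_partials_symmetric[OF k c(1)] by blast
      have near: "metric_near X \<A> \<sigma> x (test_metric c b (tensor4 (?h c)) 0 0 0)"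
        by (rule test_metric_near[OF c s4 b])
      show "T (jet2 X \<A> \<sigma> x g) = \<tt> ?h"
      proof (rule contra_tensors_eqI[OF tensor_contra[OF T g(1)] _ c(1)])
        show "\<tt> ?h \<in> contra_tensors \<A> x p" unfolding \<tt>_def by (rule tensor_contra[OF T near])
        fix J :: "'n list" assume J: "length J = p"
        have "T (jet2 X \<A> \<sigma> x g) c J = T (jet2 X \<A> \<sigma> x k) c J"
          using Tk[rule_format, OF nat tensor_contra[OF T g(1)] J] contra_tensorsD(2)[OF tensor_contra[OF T g(1)] d(1) c(1) J] by simp
        also have "\<dots> = \<tt> ?h c J"
          using tensor_at_eq[OF T c b _ s4 k jk'] J by (simp add: \<tt>_def tensor_at_def multi_indices_length)
        finally show "T (jet2 X \<A> \<sigma> x g) c J = \<tt> ?h c J" .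
      qed
    qed
    ultimately show ?thesis by blast
  qed
qed

end

theorem proposition4p1:
  fixes X :: "'a topology"
    and \<A> :: "('a, 'n::finite) chart set"
    and r s p :: nat
    and T :: "('a, 'n) jet \<Rightarrow> ('a, 'n) tensor"
  assumes "smooth_manifold X \<A>"
    and "r + s = CARD('n)"
    and "p \<ge> 1"
    and "second_order_tensor X \<A> (r, s) p T"
    and "natural X \<A> (r, s) T"
    and "divergence_free X \<A> (r, s) p T"
  shows "\<exists>(m :: nat) (Tk :: nat \<Rightarrow> ('a, 'n) jet \<Rightarrow> ('a, 'n) tensor).
    (\<forall>k\<le>m. second_order_tensor X \<A> (r, s) p (Tk k) \<and>
       natural X \<A> (r, s) (Tk k) \<and>
       divergence_free X \<A> (r, s) p (Tk k) \<and>
       homogeneous_of_degree X \<A> (r, s) p k (Tk k)) \<and>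
    (\<forall>j\<in>J2M X \<A> (r, s). T j = (\<lambda>c I. \<Sum>k\<le>m. Tk k j c I))"
proof -
  interpret manifold X \<A> using assms(1) by unfold_locales
  let ?m = degree_bound
  \<comment> \<open>The nodes are the values of \<open>1 / r\<^sup>2\<close>, because the part of
    degree \<open>k\<close> acquires the factor \<open>(1 / r\<^sup>2) ^ k\<close>.\<close>
  have "inj_on (\<lambda>i. 1 / real (Suc i)) {..?m}" by (auto simp: inj_on_def)
  from inverse_vandermonde[OF this] obtain V where V: "\<forall>k\<le>?m. \<forall>l\<le>?m. (\<Sum>i\<le>?m. V k i * (1 / real (Suc i)) ^ l) = (if k = l then 1 else 0)"
    "\<forall>i\<le>?m. \<forall>j\<le>?m. (\<Sum>k\<le>?m. V k i * (1 / real (Suc j)) ^ k) = (if i = j then 1 else 0)"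
    by (elim exE conjE)
  let ?T = "\<lambda>k. homogeneous_part V p k T"
  have 2: "second_order_tensor X \<A> (r, s) p (?T k)" for k
    unfolding homogeneous_part_def by (rule second_order_scale_comb[OF assms(4)]) simp
  have n: "natural X \<A> (r, s) (?T k)" for k
    unfolding homogeneous_part_def by (rule natural_scale_comb[OF assms(5)]) simp
  have d: "divergence_free X \<A> (r, s) p (?T k)" for k
    unfolding homogeneous_part_def by (rule divergence_free_scale_comb[OF assms(4,6,3)]) simp
  have h: "homogeneous_of_degree X \<A> (r, s) p k (?T k)" if "k \<le> ?m" for k
    by (rule homogeneous_if_polynomial[OF 2 n])
      (rule homogeneous_part_polynomial[OF assms(4,5,6,3) V(1) that])
  have "T j c I = (\<Sum>k\<le>?m. ?T k j c I)" for j c I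
  proof -
    have j1: "scale_jet 1 j = j"
      by (simp add: scale_jet_def scale_field_def)
    have "(\<Sum>k\<le>?m. ?T k j c I) = (\<Sum>i\<le>?m. (\<Sum>k\<le>?m. V k i) * (sqrt (real (Suc i)) ^ p * T (scale_jet (real (Suc i)) j) c I))"
      unfolding homogeneous_part_def scale_comb_def sum_distrib_right mult.assoc by (rule sum.swap)
    \<comment> \<open>Node 0 equals 1, so all its powers are 1 and the second identity for
      \<open>V\<close> reduces to column sums that vanish except for \<open>i = 0\<close>.\<close>
    also have "\<dots> = (\<Sum>i\<le>?m. if i = 0 then T j c I else 0)"
    proof (rule sum.cong)
      fix i assume "i \<in> {..?m}"
      then have "(\<Sum>k\<le>?m. V k i) = (if i = 0 then 1 else 0)" using V(2)[rule_format, of i 0] by simp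
      then show "(\<Sum>k\<le>?m. V k i) * (sqrt (real (Suc i)) ^ p * T (scale_jet (real (Suc i)) j) c I) = (if i = 0 then T j c I else 0)"
        by (auto simp: j1)
    qed simp
    finally show ?thesis by simp
  qed
  then have "\<forall>j\<in>J2M X \<A> (r, s). T j = (\<lambda>c I. \<Sum>k\<le>?m. ?T k j c I)" by blast
  moreover have "\<forall>k\<le>?m. second_order_tensor X \<A> (r, s) p (?T k) \<and> natural X \<A> (r, s) (?T k) \<and>
      divergence_free X \<A> (r, s) p (?T k) \<and> homogeneous_of_degree X \<A> (r, s) p k (?T k)"
    using 2 n d h by blast
  ultimately show ?thesis by (intro exI[of _ ?m] exI[of _ ?T] conjI)
qed

end
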